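(* Assume $|U|\le|V_t|$. Consider the greedy algorithm that starts from $X=\emptyset$ and, until $|X|=N$, replaces $X$ by $X\cup\{\langle x,i\rangle^+\}$, where $$\langle x,i\rangle^+\in\arg\max_{\langle x,i\rangle\in V\setminus X}\ H(Y_{\langle x,i\rangle}|Y_X)-\delta_i\,H(Y_{\langle x,i\rangle}|Y_{X\cup (V_t\setminus X_t)}),$$ with $\delta_i=0$ if $i=t$ and $\delta_i=1$ otherwise, and $H(Y_{\langle x,i\rangle}|Y_A)=\tfrac12\log\big(2\pi e\,\Sigma^{\mathrm{PITC}}_{\langle x,i\rangle\langle x,i\rangle|A}\big)$. This algorithm can be carried out in $\mathcal O\big(N(|V||U|^2+N^3)+|V_t|^3\big)$ time.
   Context: Time is counted in arithmetic operations, with each covariance entry below computable in constant time and with inversion of an $n\times n$ matrix costing $\mathcal O(n^3)$; the dimension $d$ is treated as constant. Setting. $M\ge 1$ measurement types, a set $D\subseteq\mathbb{R}^d$ of locations, $D_i^+=\{\langle x,i\rangle: x\in D\}$, $D^+=\bigcup_{i=1}^M D_i^+$. Finite sets $V_i\subset D_i^+$ of candidates, $V=\bigcup_i V_i$; a fixed target type $t\in\{1,\ldots,M\}$; $N\le|V|$ is the sampling budget. For $A\subseteq D^+$ write $A_i=A\cap D_i^+$. $U\subset D$ is a finite set of inducing locations. $P_0,\ldots,P_M$ are diagonal positive definite $d\times d$ matrices, $\sigma_{s_i}$ real, $\sigma^2_{n_i}>0$. $\mathcal N(z\mid\underline 0,C)$ is the Gaussian density with mean zero and covariance $C$ evaluated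 at $z$. Covariances: $\sigma_{xx'}=\mathcal N(x-x'\mid\underline0,P_0^{-1})$ for $x,x'\in U$; $\sigma_{\langle x,i\rangle x'}=\sigma_{s_i}\mathcal N(x-x'\mid\underline0,P_0^{-1}+P_i^{-1})$ for $\langle x,i\rangle\in D^+$, $x'\in U$; $\sigma_{\langle x,i\rangle\langle x',j\rangle}=\sigma_{s_i}\sigma_{s_j}\mathcal N(x-x'\mid\underline0,P_0^{-1}+P_i^{-1}+P_j^{-1})+\delta\,\sigma^2_{n_i}$, with $\delta=1$ if $i=j$ and $x=x'$, else $0$. $\Sigma_{AA'},\Sigma_{AU},\Sigma_{UU}$ are the corresponding matrices, $\Sigma_{UA}=\Sigma_{AU}^\top$. $\Gamma_{AA'}=\Sigma_{AU}\Sigma_{UU}^{-1}\Sigma_{UA'}$, $\Sigma_{AA|U}=\Sigma_{AA}-\Gamma_{AA}$, and $\Lambda_A$ is the block-diagonal matrix with diagonal blocks $\Sigma_{A_iA_i|U}$, $i=1,\ldots,M$. PITC posterior covariance: for disjoint $Z,X\subset D^+$, $$\Sigma^{\mathrm{PITC}}_{ZZ|X}=\Gamma_{ZZ}+\Lambda_Z-\Gamma_{ZX}(\Gamma_{XX}+\Lambda_X)^{-1}\Gamma_{XZ}.$$ *)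

theory Defs
  imports
    "HOL-Analysis.Analysis"
    "HOL-Library.Countable_Set"
    "Jordan_Normal_Form.Gauss_Jordan_Elimination"
begin

text \<open>
  Two matrix libraries are used.  Points and precision matrices of fixed dimension \<open>d = CARD('d)\<close>
  use \<open>real ^ 'd\<close> and \<open>real ^ 'd ^ 'd\<close>; covariance matrices, whose dimensions are cardinalities of
  finite sets, use \<open>real mat\<close>.
\<close>

no_notation Matrix.vec_index (infixl "$" 100)
no_notation Matrix.scalar_prod (infix "\<bullet>" 70)
hide_const (open) Matrix.vec Matrix.row Matrix.rows


section \<open>The multi-output Gaussian process model\<close>

text \<open>The element \<open>\<langle>x, i\<rangle>\<close> of \<open>D\<^sup>+\<close> is the pair \<open>(x, i)\<close>.\<close>

type_synonym 'd obs = "(real ^ 'd) \<times> nat"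

record ('d::finite) mogp =
  num_types :: nat                         \<comment> \<open>\<open>M\<close>\<close>
  locs      :: "(real ^ 'd) set"           \<comment> \<open>\<open>D\<close>\<close>
  prec      :: "nat \<Rightarrow> real ^ 'd ^ 'd"     \<comment> \<open>\<open>P\<^sub>0, \<dots>, P\<^sub>M\<close>\<close>
  scale     :: "nat \<Rightarrow> real"               \<comment> \<open>\<open>\<sigma>\<close> with index \<open>s\<^sub>i\<close>\<close>
  noise     :: "nat \<Rightarrow> real"               \<comment> \<open>the noise variance \<open>\<sigma>\<^sup>2\<close> with index \<open>n\<^sub>i\<close>\<close>

definition diag_pos_def :: "real ^ 'd ^ 'd::finite \<Rightarrow> bool" where
  "diag_pos_def P \<longleftrightarrow>
     (\<forall>a b. a \<noteq> b \<longrightarrow> P $ a $ b = 0) \<and> (\<forall>v. v \<noteq> 0 \<longrightarrow> v \<bullet> (P *v v) > 0)"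

definition mogp_model :: "('d::finite) mogp \<Rightarrow> bool" where
  "mogp_model m \<longleftrightarrow> num_types m \<ge> 1 \<and>
     (\<forall>i \<in> {0..num_types m}. diag_pos_def (prec m i)) \<and>
     (\<forall>i \<in> {1..num_types m}. noise m i > 0)"

definition all_obs :: "('d::finite) mogp \<Rightarrow> 'd obs set" where
  "all_obs m = locs m \<times> {1..num_types m}"

definition of_type :: "nat \<Rightarrow> 'd obs set \<Rightarrow> ('d::finite) obs set" where
  "of_type i A = {z \<in> A. snd z = i}"

definition gauss :: "real ^ 'd ^ 'd \<Rightarrow> real ^ 'd::finite \<Rightarrow> real" where
  "gauss C z = exp (- (z \<bullet> (matrix_inv C *v z)) / 2) / sqrt ((2 * pi) ^ CARD('d) * det C)"

definition cov_UU :: "('d::finite) mogp \<Rightarrow> real ^ 'd \<Rightarrow> real ^ 'd \<Rightarrow> real" where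
  "cov_UU m x x' = gauss (matrix_inv (prec m 0)) (x - x')"

definition cov_VU :: "('d::finite) mogp \<Rightarrow> 'd obs \<Rightarrow> real ^ 'd \<Rightarrow> real" where
  "cov_VU m z x' = (case z of (x, i) \<Rightarrow>
     scale m i * gauss (matrix_inv (prec m 0) + matrix_inv (prec m i)) (x - x'))"

definition cov_VV :: "('d::finite) mogp \<Rightarrow> 'd obs \<Rightarrow> 'd obs \<Rightarrow> real" where
  "cov_VV m z z' = (case (z, z') of ((x, i), (x', j)) \<Rightarrow>
     scale m i * scale m j *
       gauss (matrix_inv (prec m 0) + matrix_inv (prec m i) + matrix_inv (prec m j)) (x - x')
     + (if i = j \<and> x = x' then 1 else 0) * noise m i)"


section \<open>PITC posterior covariance\<close>

text \<open>
  A matrix whose rows and columns are indexed by finite sets \<open>A\<close> and \<open>B\<close> is realised by means of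
  the library enumeration \<open>from_nat_into\<close>, which maps \<open>{..<card A}\<close> bijectively onto a finite \<open>A\<close>.
\<close>

definition set_mat :: "('a \<Rightarrow> 'b \<Rightarrow> real) \<Rightarrow> 'a set \<Rightarrow> 'b set \<Rightarrow> real mat" where
  "set_mat f A B =
     Matrix.mat (card A) (card B) (\<lambda>(k, l). f (from_nat_into A k) (from_nat_into B l))"

definition mat_inv :: "real mat \<Rightarrow> real mat" where
  "mat_inv A = the (mat_inverse A)"

definition Gamma :: "('d::finite) mogp \<Rightarrow> (real ^ 'd) set \<Rightarrow> 'd obs set \<Rightarrow> 'd obs set \<Rightarrow> real mat" where
  "Gamma m U A B =
     set_mat (cov_VU m) A U * mat_inv (set_mat (cov_UU m) U U)
       * transpose_mat (set_mat (cov_VU m) B U)"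

definition Sigma_cond :: "('d::finite) mogp \<Rightarrow> (real ^ 'd) set \<Rightarrow> 'd obs set \<Rightarrow> real mat" where
  "Sigma_cond m U A = set_mat (cov_VV m) A A - Gamma m U A A"

text \<open>
  The enumeration of \<open>A\<close> need not list the types one after another, so "block-diagonal" means
  that the entries of \<^const>\<open>Sigma_cond\<close> between different types are replaced by zero.
\<close>

definition Lambda :: "('d::finite) mogp \<Rightarrow> (real ^ 'd) set \<Rightarrow> 'd obs set \<Rightarrow> real mat" where
  "Lambda m U A = Matrix.mat (card A) (card A) (\<lambda>(k, l).
     if snd (from_nat_into A k) = snd (from_nat_into A l) then Sigma_cond m U A $$ (k, l) else 0)"

definition Sigma_PITC ::
  "('d::finite) mogp \<Rightarrow> (real ^ 'd) set \<Rightarrow> 'd obs set \<Rightarrow> 'd obs set \<Rightarrow> real mat" where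
  "Sigma_PITC m U Z X =
     Gamma m U Z Z + Lambda m U Z
       - Gamma m U Z X * mat_inv (Gamma m U X X + Lambda m U X) * Gamma m U X Z"

definition entropy :: "('d::finite) mogp \<Rightarrow> (real ^ 'd) set \<Rightarrow> 'd obs \<Rightarrow> 'd obs set \<Rightarrow> real" where
  "entropy m U z A = 1/2 * ln (2 * pi * exp 1 * (Sigma_PITC m U {z} A $$ (0, 0)))"


section \<open>The greedy algorithm\<close>

definition score :: "('d::finite) mogp \<Rightarrow> (real ^ 'd) set \<Rightarrow> 'd obs set \<Rightarrow> nat
    \<Rightarrow> 'd obs set \<Rightarrow> 'd obs \<Rightarrow> real" where
  "score m U V t X z =
     entropy m U z X
     - (if snd z = t then 0 else 1) * entropy m U z (X \<union> (of_type t V - of_type t X))"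

text \<open>
  \<open>greedy_run m U V t zs\<close>: the list \<open>zs\<close> is a possible sequence of selections of the greedy
  algorithm, started from the empty set; ties are resolved arbitrarily.
\<close>

inductive greedy_run :: "('d::finite) mogp \<Rightarrow> (real ^ 'd) set \<Rightarrow> 'd obs set \<Rightarrow> nat
    \<Rightarrow> 'd obs list \<Rightarrow> bool" for m U V t where
  start: "greedy_run m U V t []"
| select: "greedy_run m U V t zs \<Longrightarrow>
    is_arg_max (score m U V t (set zs)) (\<lambda>z. z \<in> V - set zs) z \<Longrightarrow>
    greedy_run m U V t (zs @ [z])"


section \<open>Cost model: a real random access machine\<close>

text \<open>
  Programs are syntactic objects working on named arrays of natural numbers (indices, types) and
  named two-dimensional arrays of reals; a scalar is an array cell with fixed index.  Every constant,
  memory access, arithmetic operation, logarithm, comparison, test and assignment costs one unit, as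
  does an access to a covariance entry, and the inversion of an \<open>n \<times> n\<close> matrix costs \<open>n ^ 3 + 1\<close>.
  The problem instance is accessible only through the initial memory and the covariance entries, so
  that one fixed program has to serve all instances.
\<close>

datatype cov_query = QUU | QVU | QVV

datatype nexp =
    NConst nat
  | NCell string nexp
  | NAdd nexp nexp
  | NSub nexp nexp

datatype rexp =
    RConst real
  | RCell string nexp nexp
  | RCov cov_query nexp nexp
  | RAdd rexp rexp
  | RSub rexp rexp
  | RMul rexp rexp
  | RDiv rexp rexp
  | RLn rexp

datatype bexp =
    NLess nexp nexp
  | RLess rexp rexp
  | BNot bexp
  | BAnd bexp bexp

datatype com =
    Skip
  | NAssign string nexp nexp         \<comment> \<open>\<open>x[a] := e\<close>\<close>
  | RAssign string nexp nexp rexp    \<comment> \<open>\<open>x[a, b] := e\<close>\<close>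
  | Invert string nexp string        \<comment> \<open>\<open>Invert y e x\<close>: write the inverse of the leading \<open>e \<times> e\<close> block of \<open>x\<close> to that of \<open>y\<close>\<close>
  | Seq com com
  | If bexp com com
  | While bexp com

record state =
  nmem :: "string \<Rightarrow> nat \<Rightarrow> nat"
  rmem :: "string \<Rightarrow> nat \<Rightarrow> nat \<Rightarrow> real"

type_synonym cov_oracle = "cov_query \<Rightarrow> nat \<Rightarrow> nat \<Rightarrow> real"

primrec nval :: "nexp \<Rightarrow> state \<Rightarrow> nat" where
  "nval (NConst c) s = c"
| "nval (NCell x a) s = nmem s x (nval a s)"
| "nval (NAdd a b) s = nval a s + nval b s"
| "nval (NSub a b) s = nval a s - nval b s"

primrec ncost :: "nexp \<Rightarrow> nat" where
  "ncost (NConst c) = 1"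
| "ncost (NCell x a) = ncost a + 1"
| "ncost (NAdd a b) = ncost a + ncost b + 1"
| "ncost (NSub a b) = ncost a + ncost b + 1"

primrec rval :: "cov_oracle \<Rightarrow> rexp \<Rightarrow> state \<Rightarrow> real" where
  "rval K (RConst c) s = c"
| "rval K (RCell x a b) s = rmem s x (nval a s) (nval b s)"
| "rval K (RCov q a b) s = K q (nval a s) (nval b s)"
| "rval K (RAdd a b) s = rval K a s + rval K b s"
| "rval K (RSub a b) s = rval K a s - rval K b s"
| "rval K (RMul a b) s = rval K a s * rval K b s"
| "rval K (RDiv a b) s = rval K a s / rval K b s"
| "rval K (RLn a) s = ln (rval K a s)"

primrec rcost :: "rexp \<Rightarrow> nat" where
  "rcost (RConst c) = 1"
| "rcost (RCell x a b) = ncost a + ncost b + 1"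
| "rcost (RCov q a b) = ncost a + ncost b + 1"
| "rcost (RAdd a b) = rcost a + rcost b + 1"
| "rcost (RSub a b) = rcost a + rcost b + 1"
| "rcost (RMul a b) = rcost a + rcost b + 1"
| "rcost (RDiv a b) = rcost a + rcost b + 1"
| "rcost (RLn a) = rcost a + 1"

primrec bval :: "cov_oracle \<Rightarrow> bexp \<Rightarrow> state \<Rightarrow> bool" where
  "bval K (NLess a b) s = (nval a s < nval b s)"
| "bval K (RLess a b) s = (rval K a s < rval K b s)"
| "bval K (BNot a) s = (\<not> bval K a s)"
| "bval K (BAnd a b) s = (bval K a s \<and> bval K b s)"

primrec bcost :: "bexp \<Rightarrow> nat" where
  "bcost (NLess a b) = ncost a + ncost b + 1"
| "bcost (RLess a b) = rcost a + rcost b + 1"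
| "bcost (BNot a) = bcost a + 1"
| "bcost (BAnd a b) = bcost a + bcost b + 1"

text \<open>
  \<open>exec K c s T s'\<close>: program \<open>c\<close>, started in state \<open>s\<close>, terminates in state \<open>s'\<close> after time \<open>T\<close>.
  There is no rule for inverting a singular matrix: such a run does not terminate properly.
\<close>

inductive exec :: "cov_oracle \<Rightarrow> com \<Rightarrow> state \<Rightarrow> nat \<Rightarrow> state \<Rightarrow> bool" for K where
  Skip: "exec K Skip s 1 s"
| NAssign: "exec K (NAssign x a e) s (ncost a + ncost e + 1)
    (s\<lparr>nmem := (nmem s)(x := (nmem s x)(nval a s := nval e s))\<rparr>)"
| RAssign: "exec K (RAssign x a b e) s (ncost a + ncost b + rcost e + 1)
    (s\<lparr>rmem := (rmem s)(x := (rmem s x)(nval a s := (rmem s x (nval a s))(nval b s := rval K e s)))\<rparr>)"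
| Invert: "n = nval e s \<Longrightarrow>
    mat_inverse (Matrix.mat n n (\<lambda>(k, l). rmem s x k l)) = Some B \<Longrightarrow>
    exec K (Invert y e x) s (ncost e + n ^ 3 + 1)
    (s\<lparr>rmem := (rmem s)(y := (\<lambda>k l. if k < n \<and> l < n then B $$ (k, l) else rmem s y k l))\<rparr>)"
| Seq: "exec K c1 s1 T1 s2 \<Longrightarrow> exec K c2 s2 T2 s3 \<Longrightarrow> exec K (Seq c1 c2) s1 (T1 + T2) s3"
| IfTrue: "bval K b s \<Longrightarrow> exec K c1 s T s' \<Longrightarrow> exec K (If b c1 c2) s (bcost b + T + 1) s'"
| IfFalse: "\<not> bval K b s \<Longrightarrow> exec K c2 s T s' \<Longrightarrow> exec K (If b c1 c2) s (bcost b + T + 1) s'"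
| WhileFalse: "\<not> bval K b s \<Longrightarrow> exec K (While b c) s (bcost b + 1) s"
| WhileTrue: "bval K b s1 \<Longrightarrow> exec K c s1 T1 s2 \<Longrightarrow> exec K (While b c) s2 T2 s3 \<Longrightarrow>
    exec K (While b c) s1 (bcost b + T1 + T2 + 1) s3"

inductive_cases exec_SkipE: "exec K Skip s T s'"
inductive_cases exec_NAssignE: "exec K (NAssign x a e) s T s'"
inductive_cases exec_RAssignE: "exec K (RAssign x a b e) s T s'"
inductive_cases exec_InvertE: "exec K (Invert y e x) s T s'"
inductive_cases exec_SeqE: "exec K (Seq c1 c2) s T s'"
inductive_cases exec_IfE: "exec K (If b c1 c2) s T s'"
inductive_cases exec_WhileE: "exec K (While b c) s T s'"

text \<open>The machine is deterministic, so "some run" and "the run" of a program coincide.\<close>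

lemma exec_deterministic:
  "exec K c s T s' \<Longrightarrow> exec K c s T' s'' \<Longrightarrow> T' = T \<and> s'' = s'"
proof (induction arbitrary: T' s'' rule: exec.induct)
  case (Seq c1 s1 T1 s2 c2 T2 s3)
  then show ?case by (blast elim: exec_SeqE)
next
  case (WhileTrue b s1 c T1 s2 T2 s3)
  obtain U1 r U2 where run: "T' = Suc (bcost b + U1 + U2)"
      "exec K c s1 U1 r" "exec K (While b c) r U2 s''"
    using exec_WhileE[OF WhileTrue.prems] WhileTrue.hyps(1) by metis
  from run(2) have "U1 = T1 \<and> r = s2" by (rule WhileTrue.IH(1))
  moreover from this run(3) have "U2 = T2 \<and> s'' = s3" using WhileTrue.IH(2) by simp
  ultimately show ?case using run(1) by simp
next
  case (IfTrue b s c1 T s' c2)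
  then show ?case by (metis (no_types, lifting) exec_IfE Suc_eq_plus1)
next
  case (IfFalse b s c2 T s' c1)
  then show ?case by (metis (no_types, lifting) exec_IfE Suc_eq_plus1)
next
  case (WhileFalse b s c)
  then show ?case by (metis exec_WhileE Suc_eq_plus1)
next
  case (Invert n e s x B y)
  then show ?case by (auto elim!: exec_InvertE)
qed (auto elim: exec_SkipE exec_NAssignE exec_RAssignE)


section \<open>Presenting an instance to the machine\<close>

text \<open>
  Candidates and inducing locations are addressed by their positions in enumerations \<open>vs\<close> of \<open>V\<close>
  and \<open>us\<close> of \<open>U\<close>.  The output is the sequence of positions stored in the array named \<open>X\<close>.
\<close>

definition cov_entries :: "('d::finite) mogp \<Rightarrow> (real ^ 'd) list \<Rightarrow> 'd obs list \<Rightarrow> cov_oracle" where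
  "cov_entries m us vs q k l = (case q of
       QUU \<Rightarrow> cov_UU m (us ! k) (us ! l)
     | QVU \<Rightarrow> cov_VU m (vs ! k) (us ! l)
     | QVV \<Rightarrow> cov_VV m (vs ! k) (vs ! l))"

definition initial_state :: "(real ^ 'd) list \<Rightarrow> ('d::finite) obs list \<Rightarrow> nat \<Rightarrow> nat \<Rightarrow> state" where
  "initial_state us vs t N =
     \<lparr>nmem = (\<lambda>_ _. 0)
        (''sizeU'' := (\<lambda>_. 0)(0 := length us),
         ''sizeV'' := (\<lambda>_. 0)(0 := length vs),
         ''t''     := (\<lambda>_. 0)(0 := t),
         ''N''     := (\<lambda>_. 0)(0 := N),
         ''type''  := (\<lambda>k. if k < length vs then snd (vs ! k) else 0)),
      rmem = (\<lambda>_ _ _. 0)\<rparr>"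

definition selections :: "'d obs list \<Rightarrow> nat \<Rightarrow> state \<Rightarrow> ('d::finite) obs list" where
  "selections vs N s = map (\<lambda>k. vs ! nmem s ''X'' k) [0..<N]"

end

theory Submission
  imports Defs "Jordan_Normal_Form.Determinant" "HOL-Probability.Distributions"
begin

text \<open>
  Write \<open>K\<close> for the covariance matrix of the inducing locations and \<open>k\<^sub>z\<close> for the vector of covariances
  between \<open>z\<close> and \<open>U\<close>.  By the Woodbury identity the PITC variance of \<open>z\<close> given \<open>A\<close> equals
  \<open>\<sigma>\<^sub>z\<^sub>z - k\<^sub>z\<^sup>T (K\<^sup>-\<^sup>1 - (K + S\<^sub>A)\<^sup>-\<^sup>1) k\<^sub>z\<close> with \<open>S\<^sub>A = \<Sigma>\<^sub>U\<^sub>A \<Lambda>\<^sub>A\<^sup>-\<^sup>1 \<Sigma>\<^sub>A\<^sub>U\<close>.  Since \<open>\<Lambda>\<^sub>A\<close> is block-diagonal, \<open>S\<^sub>A\<close>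
  is additive over sets without common types.  Hence the expensive summand, that of \<open>V\<^sub>t\<close>, is computed
  only once, in time \<open>O(|V\<^sub>t|\<^sup>3)\<close> as \<open>|U| \<le> |V\<^sub>t|\<close>; every iteration adds the summand of the selected observations of
  the other types, in time \<open>O(N\<^sup>3 + |U|\<^sup>3)\<close>, and evaluates a quadratic form of size \<open>|U|\<close> for every
  candidate.

  No inversion fails: the covariances are inner products in \<open>L\<^sup>2\<close> of Gaussian densities (the one of
  a location has covariance \<open>P\<^sub>0\<^sup>-\<^sup>1 / 2\<close>, that of an observation of type \<open>i\<close> has
  \<open>P\<^sub>0\<^sup>-\<^sup>1 / 2 + P\<^sub>i\<^sup>-\<^sup>1\<close>), so that the joint noiseless covariance is positive semidefinite; the noise makes
  its Schur complement positive definite, and \<open>K\<close> is positive definite because translates of a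
  Gaussian are linearly independent.
\<close>

section \<open>Matrices indexed by finite sets\<close>

no_notation Matrix.vec_index (infixl "$" 100)
no_notation Matrix.scalar_prod (infix "\<bullet>" 70)
hide_const (open) Determinant.det

text \<open>The specification enumerates every finite set by \<open>from_nat_into\<close>, whereas
  the machine stores rows in the order of \<open>us\<close>, of \<open>vs\<close> or of selection.
  Matrices are therefore treated as functions of two set elements. \<open>inverse_on\<close> and
  \<open>inv_on\<close> speak of inverses without any enumeration, and uniqueness of the inverse
  makes the specified matrices and the machine arrays meet in \<open>inv_on\<close>. The additivity
  of \<open>S\<^sub>A\<close> applies to the second entropy because X together with the unselected
  target candidates is the same set as V_t together with the selected observations of the other
  types. The two parts have no type in common, and only the second one changes from one iteration to
  the next; the program keeps a separate list of these selections for this purpose. Positive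
  definiteness means positivity of the quadratic form only. It excludes null vectors, passes to sums
  with nonnegative forms, and yields nonnegativity of the inverse, so that symmetry never becomes a
  side condition.\<close>

definition pos_def_on :: "'a set \<Rightarrow> ('a \<Rightarrow> 'a \<Rightarrow> real) \<Rightarrow> bool" where
  "pos_def_on A f \<longleftrightarrow>
     (\<forall>c. (\<exists>a\<in>A. c a \<noteq> 0) \<longrightarrow> 0 < (\<Sum>a\<in>A. \<Sum>b\<in>A. c a * f a b * c b))"

definition inverse_on :: "'a set \<Rightarrow> ('a \<Rightarrow> 'a \<Rightarrow> real) \<Rightarrow> ('a \<Rightarrow> 'a \<Rightarrow> real) \<Rightarrow> bool" where
  "inverse_on A f g \<longleftrightarrow>
     (\<forall>a\<in>A. \<forall>b\<in>A. (\<Sum>c\<in>A. f a c * g c b) = (if a = b then 1 else 0) \<and>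
                   (\<Sum>c\<in>A. g a c * f c b) = (if a = b then 1 else 0))"

text \<open>A choice operator suffices: on \<open>A \<times> A\<close> the value is determined as
  soon as an inverse exists, by \<open>inverse_on_unique\<close>; elsewhere it is
  unspecified.\<close>

definition inv_on :: "'a set \<Rightarrow> ('a \<Rightarrow> 'a \<Rightarrow> real) \<Rightarrow> 'a \<Rightarrow> 'a \<Rightarrow> real" where
  "inv_on A f = (SOME g. inverse_on A f g)"

definition app :: "'b set \<Rightarrow> ('a \<Rightarrow> 'b \<Rightarrow> real) \<Rightarrow> ('b \<Rightarrow> real) \<Rightarrow> 'a \<Rightarrow> real" where
  "app B f v = (\<lambda>x. \<Sum>b\<in>B. f x b * v b)"

lemma app_cong: "(\<And>b. b \<in> B \<Longrightarrow> v b = w b) \<Longrightarrow> app B f v = app B f w"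
  by (simp add: app_def)

lemma app_diff: "app B f (\<lambda>x. v x - w x) x = app B f v x - app B f w x"
  by (simp add: app_def algebra_simps sum_subtractf)

lemma app_add_left: "app B (\<lambda>x y. f x y + g x y) v x = app B f v x + app B g v x"
  by (simp add: app_def algebra_simps sum.distrib)

lemma app_app: "app A f (app B g v) = app B (\<lambda>x y. \<Sum>a\<in>A. f x a * g a y) v"
proof
  fix x
  have "app A f (app B g v) x = (\<Sum>a\<in>A. \<Sum>b\<in>B. f x a * g a b * v b)"
    by (simp add: app_def sum_distrib_left mult.assoc)
  also have "\<dots> = (\<Sum>b\<in>B. \<Sum>a\<in>A. f x a * g a b * v b)" by (rule sum.swap)
  also have "\<dots> = app B (\<lambda>x y. \<Sum>a\<in>A. f x a * g a y) v x"
    by (simp add: app_def sum_distrib_right)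
  finally show "app A f (app B g v) x = app B (\<lambda>x y. \<Sum>a\<in>A. f x a * g a y) v x" .
qed

lemma app_inverse_on:
  assumes "finite A" "inverse_on A f g" "a \<in> A"
  shows "app A f (app A g v) a = v a" "app A g (app A f v) a = v a"
proof -
  have "app A f (app A g v) a = (\<Sum>b\<in>A. (if a = b then 1 else 0) * v b)"
    unfolding app_app unfolding app_def
    by (intro sum.cong refl) (use assms in \<open>simp add: inverse_on_def\<close>)
  also have "\<dots> = (\<Sum>b\<in>A. if a = b then v b else 0)" by (intro sum.cong) auto
  finally show "app A f (app A g v) a = v a" using assms by simp
  have "app A g (app A f v) a = (\<Sum>b\<in>A. (if a = b then 1 else 0) * v b)"
    unfolding app_app unfolding app_def
    by (intro sum.cong refl) (use assms in \<open>simp add: inverse_on_def\<close>)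
  also have "\<dots> = (\<Sum>b\<in>A. if a = b then v b else 0)" by (intro sum.cong) auto
  finally show "app A g (app A f v) a = v a" using assms by simp
qed

lemma inverse_on_unique:
  assumes "finite A" "inverse_on A f g" "inverse_on A f h" "a \<in> A" "b \<in> A"
  shows "g a b = h a b"
proof -
  have "g a b = (\<Sum>c\<in>A. if c = b then g a c else 0)" using assms by simp
  also have "\<dots> = (\<Sum>c\<in>A. g a c * (if c = b then 1 else 0))" by (intro sum.cong) auto
  also have "\<dots> = (\<Sum>c\<in>A. g a c * (\<Sum>d\<in>A. f c d * h d b))"
    using assms by (intro sum.cong refl) (simp add: inverse_on_def)
  also have "\<dots> = app A g (app A f (\<lambda>d. h d b)) a" by (simp add: app_def)
  also have "\<dots> = h a b" using app_inverse_on assms by metis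
  finally show ?thesis .
qed

lemma inverse_on_inv_on: "inverse_on A f g \<Longrightarrow> inverse_on A f (inv_on A f)"
  unfolding inv_on_def by (rule someI[of "inverse_on A f"])

text \<open>A kernel vector of the matrix, read back as coefficients on \<open>A\<close>, would make
  the quadratic form zero, so the determinant is nonzero. The enumeration \<open>e\<close> is left
  arbitrary because both \<open>from_nat_into\<close> and the storage orders of the machine are
  plugged in.\<close>

lemma mat_inverse_pos_def:
  fixes f :: "'a \<Rightarrow> 'a \<Rightarrow> real"
  assumes e: "bij_betw e {..<n} A" and pd: "pos_def_on A f"
  shows "\<exists>B \<in> carrier_mat n n. mat_inverse (Matrix.mat n n (\<lambda>(k, l). f (e k) (e l))) = Some B \<and>
           inverse_on A f (inv_on A f) \<and> (\<forall>k<n. \<forall>l<n. B $$ (k, l) = inv_on A f (e k) (e l))"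
proof -
  define F where "F = Matrix.mat n n (\<lambda>(k, l). f (e k) (e l))"
  have F: "F \<in> carrier_mat n n" by (simp add: F_def)
  have finA: "finite A" using e bij_betw_finite by blast
  have re: "(\<Sum>a\<in>A. h a) = (\<Sum>k<n. h (e k))" for h :: "'a \<Rightarrow> real"
    using sum.reindex_bij_betw[OF e, of h] by simp
  define i where "i = the_inv_into {..<n} e"
  have ie: "i (e k) = k" if "k < n" for k
    using e that unfolding i_def bij_betw_def by (simp add: the_inv_into_f_f)
  have ei: "e (i a) = a" "i a < n" if "a \<in> A" for a
    using e that bij_betwE[OF bij_betw_the_inv_into[OF e]] unfolding i_def bij_betw_def
    by (auto simp: f_the_inv_into_f)
  have einj: "e k = e l \<longleftrightarrow> k = l" if "k < n" "l < n" for k l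
    using ie that by metis
  have det: "Determinant.det F \<noteq> 0"
  proof
    assume "Determinant.det F = 0"
    then obtain v where v: "v \<in> carrier_vec n" "v \<noteq> 0\<^sub>v n" "F *\<^sub>v v = 0\<^sub>v n"
      using det_0_iff_vec_prod_zero_field[OF F] by blast
    have row: "(\<Sum>l<n. f (e k) (e l) * vec_index v l) = 0" if "k < n" for k
    proof -
      have "vec_index (F *\<^sub>v v) k = (\<Sum>l<n. f (e k) (e l) * vec_index v l)"
        using that v(1) by (simp add: F_def scalar_prod_def atLeast0LessThan)
      then show ?thesis using v(3) that by simp
    qed
    define c where "c a = vec_index v (i a)" for a
    obtain k where k: "k < n" "vec_index v k \<noteq> 0"
      using v(1,2) by (metis (no_types) carrier_vecD eq_vecI index_zero_vec)
    have "\<exists>a\<in>A. c a \<noteq> 0"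
      using k ie e by (intro bexI[of _ "e k"]) (auto simp: c_def bij_betw_def)
    then have "0 < (\<Sum>a\<in>A. \<Sum>b\<in>A. c a * f a b * c b)" using pd by (simp add: pos_def_on_def)
    also have "\<dots> = (\<Sum>k<n. vec_index v k * (\<Sum>l<n. f (e k) (e l) * vec_index v l))"
      unfolding re sum_distrib_left by (intro sum.cong refl) (simp add: c_def ie)
    also have "\<dots> = 0" by (intro sum.neutral) (simp add: row)
    finally show False by simp
  qed
  obtain B where B: "mat_inverse F = Some B"
    \<comment> \<open>The \<open>()\<close> only instantiates the record extension of the matrix
      ring.\<close>
    using mat_inverse(1)[OF F, of "()"] det_non_zero_imp_unit[OF F det, of "()"]
    by (cases "mat_inverse F") blast+
  from mat_inverse(2)[OF F B] have BB: "F * B = 1\<^sub>m n" "B * F = 1\<^sub>m n" "B \<in> carrier_mat n n" by auto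
  \<comment> \<open>Pulling \<open>B\<close> back along the inverse enumeration turns the two matrix
    equations into \<open>inverse_on\<close>; uniqueness then identifies \<open>g\<close> with
    \<open>inv_on A f\<close>.\<close>
  define g where "g a b = B $$ (i a, i b)" for a b
  have g: "inverse_on A f g"
    unfolding inverse_on_def
  proof (intro ballI conjI)
    fix a b assume ab: "a \<in> A" "b \<in> A"
    have "(F * B) $$ (i a, i b) = (\<Sum>l<n. f a (e l) * B $$ (l, i b))"
      using BB(3) ei ab by (simp add: F_def scalar_prod_def atLeast0LessThan)
    then show "(\<Sum>c\<in>A. f a c * g c b) = (if a = b then 1 else 0)"
      unfolding re using ei ab by (auto simp: g_def ie BB(1)) metis
    have "(B * F) $$ (i a, i b) = (\<Sum>l<n. B $$ (i a, l) * f (e l) b)"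
      using BB(3) ei ab by (simp add: F_def scalar_prod_def atLeast0LessThan)
    then show "(\<Sum>c\<in>A. g a c * f c b) = (if a = b then 1 else 0)"
      unfolding re using ei ab by (auto simp: g_def ie BB(2)) metis
  qed
  note inv = inverse_on_inv_on[OF g]
  have "B $$ (k, l) = inv_on A f (e k) (e l)" if "k < n" "l < n" for k l
    using inverse_on_unique[OF finA g inv, of "e k" "e l"] e that ie
    by (auto simp: g_def bij_betw_def)
  then show ?thesis using B BB(3) inv unfolding F_def by blast
qed

lemma inverse_on_pos_def:
  assumes "finite A" "pos_def_on A f"
  shows "inverse_on A f (inv_on A f)"
  using mat_inverse_pos_def[OF bij_betw_from_nat_into_finite[OF assms(1)] assms(2)] by blast

lemma mat_inv_set_mat:
  assumes "finite A" "pos_def_on A f"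
  shows "mat_inv (set_mat f A A) = set_mat (inv_on A f) A A"
proof -
  obtain B where B: "B \<in> carrier_mat (card A) (card A)" "mat_inverse (set_mat f A A) = Some B"
    "\<forall>k<card A. \<forall>l<card A. B $$ (k, l) = inv_on A f (from_nat_into A k) (from_nat_into A l)"
    using mat_inverse_pos_def[OF bij_betw_from_nat_into_finite[OF assms(1)] assms(2)]
    unfolding set_mat_def by blast
  have "B = set_mat (inv_on A f) A A"
    using B(1,3) unfolding set_mat_def by (intro eq_matI) auto
  then show ?thesis by (simp add: mat_inv_def B(2))
qed

section \<open>Algebra of set-indexed matrices and the Woodbury identity\<close>

lemma set_mat_mult:
  fixes B :: "'b set"
  assumes "finite B"
  shows "set_mat f A B * set_mat g B C = set_mat (\<lambda>a c. \<Sum>b\<in>B. f a b * g b c) A C"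
proof -
  have "(\<Sum>b\<in>B. h b) = (\<Sum>k<card B. h (from_nat_into B k))" for h :: "'b \<Rightarrow> real"
    using sum.reindex_bij_betw[OF bij_betw_from_nat_into_finite[OF assms], of h] by simp
  then show ?thesis
    by (intro eq_matI) (auto simp: set_mat_def scalar_prod_def atLeast0LessThan)
qed

lemma set_mat_transpose: "transpose_mat (set_mat f A B) = set_mat (\<lambda>b a. f a b) B A"
  by (intro eq_matI) (auto simp: set_mat_def)

lemma set_mat_add: "set_mat f A B + set_mat g A B = set_mat (\<lambda>a b. f a b + g a b) A B"
  by (intro eq_matI) (auto simp: set_mat_def)

lemma set_mat_diff: "set_mat f A B - set_mat g A B = set_mat (\<lambda>a b. f a b - g a b) A B"
  by (intro eq_matI) (auto simp: set_mat_def)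

text \<open>It is enough to know \<open>I\<close> on the single vector \<open>C Ki k\<close>. Put
  \<open>m = M k\<close> and \<open>h = Li C m\<close>. Then the transpose of \<open>C\<close> maps
  \<open>h\<close> to \<open>S m = k - K m\<close>, whence
  \<open>(G + L) h = C Ki (k - K m) + C m = C Ki k\<close>, that is, \<open>I\<close> maps
  \<open>C Ki k\<close> to \<open>h\<close>. The left-hand side becomes the product of
  \<open>k\<close> with \<open>Ki S m = Ki k - m\<close>.\<close>

lemma woodbury_form:
  fixes C :: "'a \<Rightarrow> 'u \<Rightarrow> real"
  assumes fin: "finite U" "finite A"
    and K: "inverse_on U K Ki" and L: "inverse_on A L Li"
    and M: "inverse_on U (\<lambda>u v. K u v + (\<Sum>a\<in>A. \<Sum>b\<in>A. C a u * Li a b * C b v)) M"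
    and I: "inverse_on A (\<lambda>a b. (\<Sum>u\<in>U. \<Sum>v\<in>U. C a u * Ki u v * C b v) + L a b) I"
  shows "(\<Sum>a\<in>A. \<Sum>b\<in>A. (\<Sum>u\<in>U. \<Sum>v\<in>U. k u * Ki u v * C a v) * I a b *
             (\<Sum>u\<in>U. \<Sum>v\<in>U. C b u * Ki u v * k v))
       = (\<Sum>u\<in>U. \<Sum>v\<in>U. k u * (Ki u v - M u v) * k v)"
proof -
  let ?Ct = "\<lambda>u a. C a u"
  define S where "S u v = (\<Sum>a\<in>A. \<Sum>b\<in>A. C a u * Li a b * C b v)" for u v
  define G where "G a b = (\<Sum>u\<in>U. \<Sum>v\<in>U. C a u * Ki u v * C b v)" for a b
  define m where "m = app U M k"
  define h where "h = app A Li (app U C m)"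
  have S: "app U S m = app A ?Ct h"
    unfolding h_def app_app S_def
    by (auto simp: fun_eq_iff app_def sum_distrib_right sum_distrib_left mult.assoc)
  have G: "app A G w = app U C (app U Ki (app A ?Ct w))" for w
  proof -
    have "G a b = (\<Sum>u\<in>U. C a u * (\<Sum>v\<in>U. Ki u v * C b v))" for a b
      by (simp add: G_def sum_distrib_left mult.assoc)
    then show ?thesis unfolding app_app by (auto simp: fun_eq_iff app_def)
  qed
  have Kk: "app U K m u + app U S m u = k u" if "u \<in> U" for u
    using app_inverse_on(1)[OF fin(1) M that, of k] unfolding S_def[symmetric] m_def app_add_left .
  have KiS: "app U Ki (app U S m) u = app U Ki k u - m u" if "u \<in> U" for u
  proof -
    have "app U Ki (app U S m) = app U Ki (\<lambda>u. k u - app U K m u)"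
      by (rule app_cong) (use Kk in force)
    then show ?thesis using app_inverse_on(2)[OF fin(1) K that, of m] by (simp add: app_diff)
  qed
  have Gh: "app A G h a = app U C (app U Ki k) a - app U C m a" for a
  proof -
    have "app A G h a = app U C (app U Ki (app U S m)) a" by (simp add: G S)
    also have "\<dots> = app U C (\<lambda>u. app U Ki k u - m u) a"
      by (rule fun_cong, rule app_cong) (simp add: KiS)
    finally show ?thesis by (simp add: app_diff)
  qed
  have "app A (\<lambda>a b. G a b + L a b) h a = app U C (app U Ki k) a" if "a \<in> A" for a
    using app_inverse_on(1)[OF fin(2) L that, of "app U C m"] Gh[of a]
    by (simp add: app_add_left flip: h_def)
  then have eq: "app A I (app A (\<lambda>a b. G a b + L a b) h) = app A I (app U C (app U Ki k))"
    by (intro app_cong) auto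
  have h: "app A I (app U C (app U Ki k)) a = h a" if "a \<in> A" for a
    using app_inverse_on(2)[OF fin(2) I that, of h] unfolding G_def[symmetric] eq .
  have r: "(\<Sum>u\<in>U. \<Sum>v\<in>U. C b u * Ki u v * k v) = app U C (app U Ki k) b" for b
    by (simp add: app_def sum_distrib_left mult.assoc)
  have "(\<Sum>a\<in>A. \<Sum>b\<in>A. (\<Sum>u\<in>U. \<Sum>v\<in>U. k u * Ki u v * C a v) * I a b *
             (\<Sum>u\<in>U. \<Sum>v\<in>U. C b u * Ki u v * k v))
      = (\<Sum>a\<in>A. (\<Sum>u\<in>U. \<Sum>v\<in>U. k u * Ki u v * C a v) * app A I (app U C (app U Ki k)) a)"
    unfolding r by (subst (2) app_def) (simp add: sum_distrib_left mult.assoc)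
  also have "\<dots> = (\<Sum>a\<in>A. (\<Sum>u\<in>U. \<Sum>v\<in>U. k u * Ki u v * C a v) * h a)"
    by (intro sum.cong refl) (simp add: h)
  also have "\<dots> = (\<Sum>u\<in>U. k u * app U Ki (app A ?Ct h) u)"
    unfolding app_def sum_distrib_left sum_distrib_right
    by (subst sum.swap, intro sum.cong refl, subst sum.swap) (simp add: mult.assoc)
  also have "\<dots> = (\<Sum>u\<in>U. k u * (app U Ki k u - app U M k u))"
    by (intro sum.cong refl) (simp add: KiS flip: S m_def)
  also have "\<dots> = (\<Sum>u\<in>U. \<Sum>v\<in>U. k u * (Ki u v - M u v) * k v)"
    by (simp add: app_def sum_distrib_left algebra_simps flip: sum_subtractf)
  finally show ?thesis .
qed

section \<open>Positive definiteness of Gaussian kernels\<close>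

text \<open>Translating the integration variable by \<open>v\<close> turns the product of the two
  densities into the integrand of the convolution of centred densities at
  \<open>u - v\<close>.\<close>

lemma normal_density_convolution:
  assumes "0 < a" "0 < b"
  shows "integrable lborel (\<lambda>y. normal_density u (sqrt a) y * normal_density v (sqrt b) y)"
    and "(\<integral>y. normal_density u (sqrt a) y * normal_density v (sqrt b) y \<partial>lborel)
           = normal_density 0 (sqrt (a + b)) (u - v)"
proof -
  let ?f = "\<lambda>y. normal_density 0 (sqrt a) (u - v - y) * normal_density 0 (sqrt b) y"
  have "(\<integral>\<^sup>+y. ennreal (?f y) \<partial>lborel) = ennreal (normal_density 0 (sqrt (a + b)) (u - v))"
    using fun_cong[OF conv_normal_density_zero_mean[of "sqrt a" "sqrt b"], of "u - v"] assms by simp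
  then have nn: "has_bochner_integral lborel ?f (normal_density 0 (sqrt (a + b)) (u - v))"
    by (intro has_bochner_integral_nn_integral) (auto simp: assms)
  \<comment> \<open>The translation is written as an affine map of slope 1 to fit the substitution
    rule.\<close>
  have "has_bochner_integral lborel (\<lambda>y. ?f (- v + 1 * y)) (normal_density 0 (sqrt (a + b)) (u - v) /\<^sub>R \<bar>1\<bar>)"
    using nn by (subst lborel_has_bochner_integral_real_affine_iff[symmetric]) auto
  moreover have "?f (- v + 1 * y) = normal_density u (sqrt a) y * normal_density v (sqrt b) y" for y
    by (simp add: normal_density_def power2_commute algebra_simps)
  ultimately have "has_bochner_integral lborel
      (\<lambda>y. normal_density u (sqrt a) y * normal_density v (sqrt b) y)
      (normal_density 0 (sqrt (a + b)) (u - v))" by simp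
  then show "integrable lborel (\<lambda>y. normal_density u (sqrt a) y * normal_density v (sqrt b) y)"
    and "(\<integral>y. normal_density u (sqrt a) y * normal_density v (sqrt b) y \<partial>lborel)
           = normal_density 0 (sqrt (a + b)) (u - v)"
    by (auto simp: has_bochner_integral_iff)
qed

text \<open>Density of a centred Gaussian with independent coordinates. \<open>a\<close> holds
  variances while \<open>normal_density\<close> expects standard deviations, hence the square
  roots.\<close>

definition prod_density :: "('d::finite \<Rightarrow> real) \<Rightarrow> real ^ 'd \<Rightarrow> real" where
  "prod_density a z = (\<Prod>i\<in>UNIV. normal_density 0 (sqrt (a i)) (z $ i))"

text \<open>The kernel value at \<open>p\<close>, \<open>q\<close> is the integral of
  \<open>f p * f q\<close>, so the form is the integral of a square. Every index carries its own
  variances, which lets locations and observations of all types share one Gram matrix. The product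
  measure on functions, rather than Lebesgue measure on vectors, gives direct access to
  coordinatewise factorisation of the integrals.\<close>

lemma prod_density_psd:
  fixes x :: "'k \<Rightarrow> real ^ 'd::finite" and a :: "'k \<Rightarrow> 'd \<Rightarrow> real"
  assumes fin: "finite I" and pos: "\<And>p i. p \<in> I \<Longrightarrow> 0 < a p i"
  shows "0 \<le> (\<Sum>p\<in>I. \<Sum>q\<in>I. c p * prod_density (\<lambda>i. a p i + a q i) (x p - x q) * c q)"
proof -
  let ?M = "Pi\<^sub>M UNIV (\<lambda>_::'d. lborel :: real measure)"
  interpret product_sigma_finite "\<lambda>_::'d. lborel :: real measure" ..
  define f where "f p y = (\<Prod>i\<in>UNIV. normal_density (x p $ i) (sqrt (a p i)) (y i))" for p y
  have prod: "f p y * f q y = (\<Prod>i\<in>UNIV. normal_density (x p $ i) (sqrt (a p i)) (y i)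
      * normal_density (x q $ i) (sqrt (a q i)) (y i))" for p q y
    by (simp add: f_def prod.distrib)
  have int: "integrable ?M (\<lambda>y. f p y * f q y)" if "p \<in> I" "q \<in> I" for p q
    unfolding prod by (intro product_integrable_prod normal_density_convolution(1)) (auto intro: pos that)
  have val: "(\<integral>y. f p y * f q y \<partial>?M) = prod_density (\<lambda>i. a p i + a q i) (x p - x q)"
    if "p \<in> I" "q \<in> I" for p q
    unfolding prod prod_density_def
    by (subst product_integral_prod)
      (auto intro!: prod.cong normal_density_convolution simp: pos that)
  have "0 \<le> (\<integral>y. (\<Sum>p\<in>I. c p * f p y)\<^sup>2 \<partial>?M)" by simp
  also have "\<dots> = (\<integral>y. (\<Sum>p\<in>I. \<Sum>q\<in>I. (c p * c q) * (f p y * f q y)) \<partial>?M)"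
    by (simp add: power2_eq_square sum_product algebra_simps)
  also have "\<dots> = (\<Sum>p\<in>I. \<Sum>q\<in>I. (c p * c q) * (\<integral>y. f p y * f q y \<partial>?M))"
    using int by (simp add: Bochner_Integration.integral_sum)
  also have "\<dots> = (\<Sum>p\<in>I. \<Sum>q\<in>I. c p * prod_density (\<lambda>i. a p i + a q i) (x p - x q) * c q)"
    by (intro sum.cong refl) (simp add: val algebra_simps)
  finally show ?thesis .
qed

section \<open>Diagonal covariances and factorisation of the Gaussian density\<close>

definition diag :: "('d::finite \<Rightarrow> real) \<Rightarrow> real ^ 'd ^ 'd" where
  "diag c = (\<chi> i j. if i = j then c i else 0)"

lemma diag_mult_vec: "(diag c *v z) $ i = c i * z $ i"
proof -
  have "(diag c *v z) $ i = (\<Sum>j\<in>UNIV. if i = j then c i * z $ j else 0)"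
    unfolding diag_def matrix_vector_mult_def vec_lambda_beta by (rule sum.cong) auto
  then show ?thesis by simp
qed

lemma matrix_inv_unique:
  fixes A :: "real ^ 'n ^ 'n"
  assumes "A ** B = Finite_Cartesian_Product.mat 1" "B ** A = Finite_Cartesian_Product.mat 1"
  shows "matrix_inv A = B"
proof -
  have "A ** matrix_inv A = Finite_Cartesian_Product.mat 1 \<and> matrix_inv A ** A = Finite_Cartesian_Product.mat 1"
    unfolding matrix_inv_def using assms by (intro someI[of "\<lambda>A'. A ** A' = Finite_Cartesian_Product.mat 1 \<and> A' ** A = Finite_Cartesian_Product.mat 1"]) simp
  then have "matrix_inv A = (matrix_inv A ** A) ** B"
    using assms by (metis matrix_mul_assoc matrix_mul_rid)
  then show ?thesis using \<open>A ** matrix_inv A = Finite_Cartesian_Product.mat 1 \<and> _\<close> by simp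
qed

lemma sqrt_prod: "sqrt (\<Prod>i\<in>A. f i) = (\<Prod>i\<in>A. sqrt (f i))"
  by (induction A rule: infinite_finite_induct) (simp_all add: real_sqrt_mult)

lemma matrix_inv_diag:
  assumes "\<And>i. c i \<noteq> 0"
  shows "matrix_inv (diag c) = diag (\<lambda>i. inverse (c i))"
proof (rule matrix_inv_unique)
  have "(\<Sum>k\<in>UNIV. (if i = k then p else 0) * (if k = j then g k else 0))
       = (if i = j then p * g i else 0)" for g :: "'a \<Rightarrow> real" and p i j
  proof -
    have "(\<Sum>k\<in>UNIV. (if i = k then p else 0) * (if k = j then g k else 0))
        = (\<Sum>k\<in>UNIV. if i = k then (if i = j then p * g i else 0) else 0)"
      by (intro sum.cong) auto
    then show ?thesis by simp
  qed
  note * = this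
  show "diag c ** diag (\<lambda>i. inverse (c i)) = Finite_Cartesian_Product.mat 1" "diag (\<lambda>i. inverse (c i)) ** diag c = Finite_Cartesian_Product.mat 1"
    using assms by (simp_all add: diag_def matrix_matrix_mult_def Finite_Cartesian_Product.mat_def Finite_Cartesian_Product.vec_eq_iff *)
qed

lemma diag_add: "diag c + diag e = diag (\<lambda>i. c i + e i)"
  by (simp add: diag_def Finite_Cartesian_Product.vec_eq_iff)

lemma gauss_diag:
  assumes "\<And>i. 0 < c i"
  shows "gauss (diag c) z = prod_density c z"
proof -
  have ne: "c i \<noteq> 0" for i using assms[of i] by simp
  have "det (diag c) = (\<Prod>i\<in>UNIV. c i)"
    by (subst det_diagonal) (auto simp: diag_def)
  moreover have "z \<bullet> (matrix_inv (diag c) *v z) = (\<Sum>i\<in>UNIV. (z $ i)\<^sup>2 / c i)"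
    by (simp add: matrix_inv_diag[OF ne] inner_vec_def diag_mult_vec power2_eq_square field_simps)
  ultimately have "gauss (diag c) z =
      exp (\<Sum>i\<in>UNIV. - ((z $ i)\<^sup>2 / (2 * c i))) / sqrt (\<Prod>i\<in>UNIV. 2 * pi * c i)"
    by (simp add: gauss_def prod.distrib sum_negf sum_divide_distrib mult.commute)
  also have "\<dots> = (\<Prod>i\<in>UNIV. exp (- ((z $ i)\<^sup>2 / (2 * c i))) / sqrt (2 * pi * c i))"
    by (simp add: exp_sum prod_dividef sqrt_prod)
  also have "\<dots> = prod_density c z"
    unfolding prod_density_def using assms
    by (intro prod.cong refl) (simp add: normal_density_def less_imp_le)
  finally show ?thesis .
qed

lemma diag_pos_def_diag:
  assumes "diag_pos_def P"
  shows "P = diag (\<lambda>i. P $ i $ i)" "0 < P $ i $ i"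
proof -
  show P: "P = diag (\<lambda>i. P $ i $ i)"
    using assms by (auto simp: diag_pos_def_def diag_def Finite_Cartesian_Product.vec_eq_iff)
  have "0 < axis i 1 \<bullet> (P *v axis i 1)" using assms by (simp add: diag_pos_def_def)
  also have "\<dots> = P $ i $ i" by (subst P) (simp add: inner_axis' diag_mult_vec)
  finally show "0 < P $ i $ i" .
qed

lemma prod_density_pos: "(\<And>i. 0 < a i) \<Longrightarrow> 0 < prod_density a z"
  unfolding prod_density_def by (intro prod_pos) (simp add: normal_density_pos)

lemma prod_density_exp:
  "prod_density a z = (\<Prod>i\<in>UNIV. 1 / sqrt (2 * pi * (sqrt (a i))\<^sup>2))
     * exp (- (\<Sum>i\<in>UNIV. (z $ i)\<^sup>2 / (2 * (sqrt (a i))\<^sup>2)))"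
  by (simp add: prod_density_def normal_density_def prod_dividef exp_sum flip: sum_negf)

text \<open>The core of Cauchy-Schwarz for a null vector: at its minimiser
  \<open>s = - f / k\<close> the polynomial takes the value minus \<open>f\<close> squared over
  \<open>k\<close>.\<close>

lemma quadratic_zero:
  fixes f k :: real
  assumes "\<And>s. 0 \<le> 2 * s * f + s\<^sup>2 * k" "0 < k"
  shows "f = 0"
proof -
  have "0 \<le> 2 * (- f / k) * f + (- f / k)\<^sup>2 * k" by (rule assms)
  also have "\<dots> = - (f\<^sup>2 / k)" using assms(2) by (simp add: field_simps power2_eq_square)
  finally show ?thesis using assms(2) by (simp add: divide_le_0_iff)
qed

text \<open>
  A null vector \<open>c\<close> of the kernel makes \<open>\<Sum>x. c x * k (x - y)\<close> vanish for every \<open>y\<close> by Cauchy-Schwarz.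
  Letting \<open>y\<close> go to infinity in the direction of the largest point in the support of \<open>c\<close>, the term of
  that point dominates all others.
\<close>

lemma prod_density_pos_def:
  fixes U :: "(real ^ 'd::finite) set"
  assumes fin: "finite U" and pos: "\<And>i. 0 < a i"
  shows "pos_def_on U (\<lambda>x y. prod_density a (x - y))"
  unfolding pos_def_on_def
proof (intro allI impI, rule ccontr)
  fix c :: "real ^ 'd \<Rightarrow> real"
  let ?k = "prod_density a"
  assume ex: "\<exists>x\<in>U. c x \<noteq> 0" and "\<not> 0 < (\<Sum>x\<in>U. \<Sum>y\<in>U. c x * ?k (x - y) * c y)"
  then have le: "(\<Sum>x\<in>U. \<Sum>y\<in>U. c x * ?k (x - y) * c y) \<le> 0" by simp
  have sym: "?k (x - y) = ?k (y - x)" for x y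
    by (simp add: prod_density_exp power2_commute)
  have F: "(\<Sum>x\<in>U. c x * ?k (x - y)) = 0" for y
  proof (rule quadratic_zero)
    fix s :: real
    \<comment> \<open>The index \<open>None\<close> stands for the point \<open>y\<close> with
      coefficient \<open>s\<close>; the option type keeps it apart from \<open>U\<close>, where
      \<open>y\<close> may also occur.\<close>
    let ?I = "insert None (Some ` U)"
    let ?x = "\<lambda>p. case p of None \<Rightarrow> y | Some x \<Rightarrow> x"
    let ?c = "\<lambda>p. case p of None \<Rightarrow> s | Some x \<Rightarrow> c x"
    \<comment> \<open>Giving every point half of the variances \<open>a\<close> makes the kernel
      with variances \<open>a\<close> an instance of the Gram form.\<close>
    have "0 \<le> (\<Sum>p\<in>?I. \<Sum>q\<in>?I. ?c p * prod_density (\<lambda>i. a i / 2 + a i / 2) (?x p - ?x q) * ?c q)"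
      using fin pos by (intro prod_density_psd) auto
    also have "\<dots> = s * ?k (y - y) * s + (\<Sum>x\<in>U. s * ?k (y - x) * c x)
        + ((\<Sum>x\<in>U. c x * ?k (x - y) * s) + (\<Sum>x\<in>U. \<Sum>y\<in>U. c x * ?k (x - y) * c y))"
      using fin by (simp add: sum.reindex sum.distrib)
    also have "\<dots> \<le> 2 * s * (\<Sum>x\<in>U. c x * ?k (x - y)) + s\<^sup>2 * ?k 0"
      using le by (simp add: sym[of y] sum_distrib_left sum_distrib_right algebra_simps power2_eq_square)
    finally show "0 \<le> 2 * s * (\<Sum>x\<in>U. c x * ?k (x - y)) + s\<^sup>2 * ?k 0" .
  qed (simp add: prod_density_pos pos)
  \<comment> \<open>The inner product weighted by inverse variances, which is the exponent of the
    kernel; the largest point of the support is taken in its norm.\<close>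
  define Q where "Q x y = (\<Sum>i\<in>UNIV. x $ i * y $ i / a i)" for x y :: "real ^ 'd"
  have Qexp: "Q (x - y) (x - y) = Q x x - 2 * Q x y + Q y y" for x y
    by (simp add: Q_def sum_distrib_left algebra_simps diff_divide_distrib add_divide_distrib
        flip: sum.distrib sum_subtractf)
  have Qs: "Q x (s *\<^sub>R y) = s * Q x y" "Q (s *\<^sub>R y) x = s * Q y x" for s x y
    by (simp_all add: Q_def sum_distrib_left algebra_simps)
  have Qpos: "0 < Q x x" if x: "x \<noteq> 0" for x
  proof -
    obtain i where "x $ i \<noteq> 0" using x by (auto simp: Finite_Cartesian_Product.vec_eq_iff)
    then show ?thesis unfolding Q_def using pos
      by (intro sum_pos2[of _ i]) (auto simp: less_imp_le zero_less_divide_iff zero_less_mult_iff linorder_neq_iff)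
  qed
  define P where "P = (\<Prod>i\<in>UNIV. 1 / sqrt (2 * pi * a i))"
  have k: "?k z = P * exp (- Q z z / 2)" for z
    using pos unfolding P_def by (simp add: prod_density_exp Q_def less_imp_le power2_eq_square sum_divide_distrib mult.commute)
  have cpos: "0 < P" unfolding P_def using pos by (intro prod_pos) simp
  define W where "W = {x\<in>U. c x \<noteq> 0}"
  have W: "finite W" "W \<noteq> {}" using fin ex by (auto simp: W_def)
  obtain x0 where x0: "x0 \<in> W" "\<And>x. x \<in> W \<Longrightarrow> Q x x \<le> Q x0 x0"
    using ex_is_arg_min_if_finite[OF W, of "\<lambda>x. - Q x x"] by (auto simp: is_arg_min_linorder)
  define w where "w x = c x * exp (- Q x x / 2)" for x
  \<comment> \<open>The exponential rate in \<open>s\<close> of the term of \<open>x\<close> along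
    the ray through \<open>x0\<close>, after the factor common to all terms has been split off. It
    is 0 at \<open>x0\<close>.\<close>
  define g where "g x = Q x x0 - Q x0 x0" for x
  have g: "g x < 0" if "x \<in> W - {x0}" for x
  proof -
    \<comment> \<open>Expanding gives \<open>2 * Q x x0 < Q x x + Q x0 x0 \<le> 2 * Q x0 x0\<close>,
      the second step by maximality of \<open>x0\<close>.\<close>
    have "0 < Q (x - x0) (x - x0)" using that by (intro Qpos) auto
    then show ?thesis using x0(2)[of x] that by (simp add: Qexp g_def)
  qed
  have zero: "(\<Sum>x\<in>W. w x * exp (s * g x)) = 0" for s
  proof -
    have trm: "c x * ?k (x - s *\<^sub>R x0)
        = P * exp (s * Q x0 x0 - s\<^sup>2 * Q x0 x0 / 2) * (w x * exp (s * g x))" for x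
    proof -
      have "exp (- Q (x - s *\<^sub>R x0) (x - s *\<^sub>R x0) / 2)
          = exp (s * Q x0 x0 - s\<^sup>2 * Q x0 x0 / 2) * exp (- Q x x / 2) * exp (s * g x)"
        by (simp add: Qexp Qs g_def power2_eq_square field_simps flip: exp_add)
      then show ?thesis by (simp add: k w_def)
    qed
    have "0 = (\<Sum>x\<in>W. c x * ?k (x - s *\<^sub>R x0))"
      using F[of "s *\<^sub>R x0"] fin unfolding W_def by (subst sum.mono_neutral_left[of U]) auto
    also have "\<dots> = P * exp (s * Q x0 x0 - s\<^sup>2 * Q x0 x0 / 2) * (\<Sum>x\<in>W. w x * exp (s * g x))"
      by (simp add: trm sum_distrib_left)
    finally show ?thesis using cpos by simp
  qed
  have "((\<lambda>s. \<Sum>x\<in>W. w x * exp (s * g x)) \<longlongrightarrow> (\<Sum>x\<in>W. if x = x0 then w x else 0)) at_top"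
  proof (intro tendsto_sum)
    fix x assume x: "x \<in> W"
    show "((\<lambda>s. w x * exp (s * g x)) \<longlongrightarrow> (if x = x0 then w x else 0)) at_top"
    proof (cases "x = x0")
      case True
      then show ?thesis by (simp add: g_def)
    next
      case False
      have "filterlim (\<lambda>s. g x * s) at_bot at_top"
        using g[of x] False x
        by (intro filterlim_tendsto_neg_mult_at_bot[OF tendsto_const _ filterlim_ident]) auto
      then have "filterlim (\<lambda>s. s * g x) at_bot at_top" by (simp add: mult.commute)
      then have "((\<lambda>s. w x * exp (s * g x)) \<longlongrightarrow> w x * 0) at_top"
        by (intro tendsto_intros filterlim_compose[OF exp_at_bot])
      then show ?thesis using False by simp
    qed
  qed
  then have "(\<Sum>x\<in>W. if x = x0 then w x else 0) = 0"
    unfolding zero by (simp add: tendsto_const_iff)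
  then show False using x0(1) W(1) by (simp add: w_def W_def)
qed

section \<open>The PITC variance\<close>

lemma pos_def_on_nonneg:
  assumes "pos_def_on A f"
  shows "0 \<le> (\<Sum>a\<in>A. \<Sum>b\<in>A. c a * f a b * c b)"
proof (cases "\<exists>a\<in>A. c a \<noteq> 0")
  case True
  then show ?thesis using assms by (simp add: pos_def_on_def less_imp_le)
next
  case False
  then show ?thesis by simp
qed

lemma pos_def_on_add_nonneg:
  assumes "pos_def_on A f" "\<And>c. 0 \<le> (\<Sum>a\<in>A. \<Sum>b\<in>A. c a * g a b * c b)"
  shows "pos_def_on A (\<lambda>a b. f a b + g a b)"
  using assms unfolding pos_def_on_def
  by (simp add: algebra_simps sum.distrib add_pos_nonneg)

lemma quadratic_app: "(\<Sum>a\<in>A. \<Sum>b\<in>B. c a * f a b * e b) = (\<Sum>a\<in>A. c a * app B f e a)"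
  by (simp add: app_def sum_distrib_left mult.assoc)

text \<open>A form with \<open>f\<close> between \<open>C\<close> and its transpose is the form of
  \<open>f\<close> at a transformed vector. It serves \<open>gam\<close> with \<open>C\<close> the
  covariances of observations with locations, and \<open>info\<close> with the two roles
  exchanged.\<close>

lemma quadratic_sandwich:
  fixes f :: "'u \<Rightarrow> 'u \<Rightarrow> real"
  shows
  "(\<Sum>a\<in>A. \<Sum>b\<in>A. c a * (\<Sum>u\<in>U. \<Sum>v\<in>U. C a u * f u v * C b v) * c b)
     = (\<Sum>u\<in>U. \<Sum>v\<in>U. (\<Sum>a\<in>A. C a u * c a) * f u v * (\<Sum>b\<in>A. C b v * c b))"
proof -
  have "(\<Sum>a\<in>A. \<Sum>b\<in>A. c a * (\<Sum>u\<in>U. \<Sum>v\<in>U. C a u * f u v * C b v) * c b)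
      = (\<Sum>a\<in>A. \<Sum>b\<in>A. \<Sum>u\<in>U. \<Sum>v\<in>U. C a u * c a * f u v * (C b v * c b))"
    unfolding sum_distrib_left sum_distrib_right by (simp only: mult_ac)
  also have "\<dots> = (\<Sum>a\<in>A. \<Sum>u\<in>U. \<Sum>v\<in>U. \<Sum>b\<in>A. C a u * c a * f u v * (C b v * c b))"
    by (intro sum.cong refl) (subst sum.swap, intro sum.cong refl, rule sum.swap)
  also have "\<dots> = (\<Sum>u\<in>U. \<Sum>v\<in>U. \<Sum>a\<in>A. \<Sum>b\<in>A. C a u * c a * f u v * (C b v * c b))"
    by (subst sum.swap, intro sum.cong refl, rule sum.swap)
  also have "\<dots> = (\<Sum>u\<in>U. \<Sum>v\<in>U. (\<Sum>a\<in>A. C a u * c a) * f u v * (\<Sum>b\<in>A. C b v * c b))"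
    by (simp only: sum_distrib_right) (simp only: sum_distrib_left)
  finally show ?thesis .
qed

text \<open>Substituting \<open>app A g c\<close> turns the form of \<open>f\<close> into that of
  its inverse, so nonnegativity is inherited without spectral theory.\<close>

lemma quadratic_inverse:
  assumes "finite A" "inverse_on A f g"
  shows "(\<Sum>a\<in>A. \<Sum>b\<in>A. app A g c a * f a b * app A g c b) = (\<Sum>a\<in>A. \<Sum>b\<in>A. c a * g a b * c b)"
proof -
  have "(\<Sum>a\<in>A. \<Sum>b\<in>A. app A g c a * f a b * app A g c b) = (\<Sum>a\<in>A. app A g c a * c a)"
    unfolding quadratic_app using app_inverse_on(1)[OF assms] by simp
  then show ?thesis unfolding quadratic_app by (simp add: mult.commute)
qed

lemma inverse_nonneg:
  assumes "finite A" "pos_def_on A f"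
  shows "0 \<le> (\<Sum>a\<in>A. \<Sum>b\<in>A. c a * inv_on A f a b * c b)"
  using quadratic_inverse[OF assms(1) inverse_on_pos_def[OF assms], of c]
    pos_def_on_nonneg[OF assms(2), of "app A (inv_on A f) c"] by simp

locale pitc =
  fixes m :: "('d::finite) mogp" and U :: "(real ^ 'd) set"
  assumes model: "mogp_model m" and finU: "finite U"
begin

section \<open>The covariances as entries of a Gaussian Gram matrix\<close>

definition var :: "nat \<Rightarrow> 'd \<Rightarrow> real" where
  "var i b = inverse (prec m i $ b $ b)"

lemma var_pos: "i \<le> num_types m \<Longrightarrow> 0 < var i b"
  using model diag_pos_def_diag(2)[of "prec m i"] by (auto simp: var_def mogp_model_def)

lemma prec_inv:
  assumes "i \<le> num_types m"
  shows "matrix_inv (prec m i) = diag (var i)"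
proof -
  have d: "diag_pos_def (prec m i)" using model assms by (auto simp: mogp_model_def)
  have "prec m i $ b $ b \<noteq> 0" for b using diag_pos_def_diag(2)[OF d, of b] by simp
  then show ?thesis
    using matrix_inv_diag[of "\<lambda>b. prec m i $ b $ b"] diag_pos_def_diag(1)[OF d]
    by (simp add: var_def[abs_def])
qed

lemma all_obs_type: "z \<in> all_obs m \<Longrightarrow> snd z \<in> {1..num_types m}"
  by (auto simp: all_obs_def)

text \<open>The variance is written as half plus half on purpose: each summand is the share of one
  argument, the shape required by \<open>prod_density_psd\<close>. \<open>cov_VU_eq\<close> and
  \<open>noiseless\<close> follow the same pattern, with share \<open>var 0 b / 2 + var i b\<close>
  for an observation of type \<open>i\<close>.\<close>

lemma cov_UU_eq: "cov_UU m x y = prod_density (\<lambda>b. var 0 b / 2 + var 0 b / 2) (x - y)"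
  by (simp add: cov_UU_def prec_inv gauss_diag var_pos)

lemma cov_VU_eq:
  assumes "snd z \<le> num_types m"
  shows "cov_VU m z y = scale m (snd z) *
    prod_density (\<lambda>b. (var 0 b / 2 + var (snd z) b) + var 0 b / 2) (fst z - y)"
  using assms by (cases z) (simp add: cov_VU_def prec_inv diag_add gauss_diag var_pos add_pos_pos
    algebra_simps)

definition noiseless :: "'d obs \<Rightarrow> 'd obs \<Rightarrow> real" where
  "noiseless z z' = scale m (snd z) * scale m (snd z') *
    prod_density (\<lambda>b. (var 0 b / 2 + var (snd z) b) + (var 0 b / 2 + var (snd z') b)) (fst z - fst z')"

lemma cov_VV_eq:
  assumes "snd z \<le> num_types m" "snd z' \<le> num_types m"
  shows "cov_VV m z z' = noiseless z z' + (if z = z' then noise m (snd z) else 0)"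
proof -
  have "gauss (diag (\<lambda>b. var 0 b + var (snd z) b + var (snd z') b)) x =
      prod_density (\<lambda>b. (var 0 b / 2 + var (snd z) b) + (var 0 b / 2 + var (snd z') b)) x" for x
    using assms by (subst gauss_diag) (auto simp: var_pos add_pos_pos algebra_simps)
  then show ?thesis using assms
    by (cases z; cases z') (simp add: cov_VV_def noiseless_def prec_inv diag_add)
qed

lemma cov_UU_pos_def: "pos_def_on U (cov_UU m)"
  unfolding cov_UU_eq[abs_def] by (intro prod_density_pos_def finU) (simp add: var_pos)

text \<open>One Gram matrix over the disjoint sum of locations and observations. The scale factors
  may have any sign and are moved into the coefficients; the two mixed blocks agree because the
  densities are even.\<close>

lemma joint_nonneg:
  assumes "finite A" "A \<subseteq> all_obs m"
  shows "0 \<le> (\<Sum>u\<in>U. \<Sum>v\<in>U. b u * cov_UU m u v * b v)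
    + 2 * (\<Sum>z\<in>A. \<Sum>u\<in>U. c z * cov_VU m z u * b u)
    + (\<Sum>z\<in>A. \<Sum>z'\<in>A. c z * noiseless z z' * c z')"
proof -
  let ?I = "Inl ` U \<union> Inr ` A :: (real ^ 'd + 'd obs) set"
  let ?x = "\<lambda>p. case p of Inl u \<Rightarrow> u | Inr z \<Rightarrow> fst z"
  let ?a = "\<lambda>p i. case p of Inl u \<Rightarrow> var 0 i / 2 | Inr z \<Rightarrow> var 0 i / 2 + var (snd z) i"
  let ?c = "\<lambda>p. case p of Inl u \<Rightarrow> b u | Inr z \<Rightarrow> c z * scale m (snd z)"
  let ?k = "\<lambda>p q. ?c p * prod_density (\<lambda>i. ?a p i + ?a q i) (?x p - ?x q) * ?c q"
  have ty: "snd z \<le> num_types m" if "z \<in> A" for z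
    using all_obs_type assms that by fastforce
  have comm: "prod_density f (x - y) = prod_density f (y - x)" for f :: "'d \<Rightarrow> real" and x y
    by (simp add: prod_density_exp power2_commute)
  have "0 \<le> (\<Sum>p\<in>?I. \<Sum>q\<in>?I. ?k p q)"
    using finU assms ty by (intro prod_density_psd) (auto simp: var_pos add_pos_pos)
  also have "\<dots> = (\<Sum>p\<in>?I. (\<Sum>u\<in>U. ?k p (Inl u)) + (\<Sum>z\<in>A. ?k p (Inr z)))"
    using finU assms by (intro sum.cong refl, subst sum.union_disjoint) (auto simp: sum.reindex)
  also have "\<dots> = (\<Sum>v\<in>U. (\<Sum>u\<in>U. ?k (Inl v) (Inl u)) + (\<Sum>z\<in>A. ?k (Inl v) (Inr z)))
      + (\<Sum>z'\<in>A. (\<Sum>u\<in>U. ?k (Inr z') (Inl u)) + (\<Sum>z\<in>A. ?k (Inr z') (Inr z)))"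
    using finU assms by (subst sum.union_disjoint) (auto simp: sum.reindex)
  also have "(\<Sum>v\<in>U. (\<Sum>u\<in>U. ?k (Inl v) (Inl u)) + (\<Sum>z\<in>A. ?k (Inl v) (Inr z)))
      = (\<Sum>u\<in>U. \<Sum>v\<in>U. b u * cov_UU m u v * b v) + (\<Sum>z\<in>A. \<Sum>u\<in>U. c z * cov_VU m z u * b u)"
  proof -
    have k: "?k (Inl v) (Inr z) = c z * cov_VU m z v * b v" if "z \<in> A" for v z
      using ty[OF that] by (simp add: cov_VU_eq comm[of _ v])
    have "(\<Sum>v\<in>U. \<Sum>z\<in>A. ?k (Inl v) (Inr z)) = (\<Sum>z\<in>A. \<Sum>v\<in>U. ?k (Inl v) (Inr z))"
      by (rule sum.swap)
    also have "\<dots> = (\<Sum>z\<in>A. \<Sum>u\<in>U. c z * cov_VU m z u * b u)"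
      by (intro sum.cong refl k)
    finally show ?thesis by (simp add: sum.distrib cov_UU_eq)
  qed
  also have "(\<Sum>z'\<in>A. (\<Sum>u\<in>U. ?k (Inr z') (Inl u)) + (\<Sum>z\<in>A. ?k (Inr z') (Inr z)))
      = (\<Sum>z\<in>A. \<Sum>u\<in>U. c z * cov_VU m z u * b u) + (\<Sum>z\<in>A. \<Sum>z'\<in>A. c z * noiseless z z' * c z')"
    unfolding sum.distrib
    by (intro arg_cong2[where f = "(+)"] sum.cong refl) (auto simp: cov_VU_eq ty noiseless_def mult_ac)
  finally show ?thesis by simp
qed

section \<open>Schur complement and block-diagonal conditional covariance\<close>

definition gam :: "'d obs \<Rightarrow> 'd obs \<Rightarrow> real" where
  "gam z z' = (\<Sum>u\<in>U. \<Sum>v\<in>U. cov_VU m z u * inv_on U (cov_UU m) u v * cov_VU m z' v)"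

definition lam :: "'d obs \<Rightarrow> 'd obs \<Rightarrow> real" where
  "lam z z' = (if snd z = snd z' then cov_VV m z z' - gam z z' else 0)"

text \<open>For fixed \<open>c\<close> the joint form is minimised over the coefficients on
  \<open>U\<close> by \<open>- b\<close>, where \<open>b\<close> is \<open>K^-1\<close> applied to
  \<open>w\<close>. The minimum is the form of the Schur complement at \<open>c\<close>.\<close>

lemma schur_nonneg:
  assumes "finite A" "A \<subseteq> all_obs m"
  shows "0 \<le> (\<Sum>z\<in>A. \<Sum>z'\<in>A. c z * (noiseless z z' - gam z z') * c z')"
proof -
  let ?K = "inv_on U (cov_UU m)"
  define w where "w u = (\<Sum>z\<in>A. cov_VU m z u * c z)" for u
  define b where "b = app U ?K w"
  note inv = inverse_on_pos_def[OF finU cov_UU_pos_def]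
  have g: "(\<Sum>z\<in>A. \<Sum>z'\<in>A. c z * gam z z' * c z') = (\<Sum>u\<in>U. w u * b u)"
    unfolding b_def by (subst quadratic_app[symmetric]) (simp add: gam_def quadratic_sandwich w_def)
  have 1: "(\<Sum>u\<in>U. \<Sum>v\<in>U. - b u * cov_UU m u v * - b v) = (\<Sum>u\<in>U. w u * b u)"
    using quadratic_inverse[OF finU inv, of w] by (simp add: b_def quadratic_app)
  have 2: "(\<Sum>z\<in>A. \<Sum>u\<in>U. c z * cov_VU m z u * - b u) = - (\<Sum>u\<in>U. w u * b u)"
    unfolding w_def sum_distrib_right
    by (subst sum.swap) (simp add: sum_negf mult_ac)
  have "0 \<le> - (\<Sum>u\<in>U. w u * b u) + (\<Sum>z\<in>A. \<Sum>z'\<in>A. c z * noiseless z z' * c z')"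
    using joint_nonneg[OF assms, of "\<lambda>u. - b u" c] unfolding 1 2 by simp
  then show ?thesis unfolding g[symmetric] by (simp add: algebra_simps sum_subtractf)
qed

text \<open>The noiseless part of the block-diagonal form is the sum, over all types, of the Schur
  complement forms at \<open>c\<close> restricted to one type, hence nonnegative. The noise adds a
  strictly positive diagonal.\<close>

lemma lam_pos_def:
  assumes "finite A" "A \<subseteq> all_obs m"
  shows "pos_def_on A lam"
  unfolding pos_def_on_def
proof (intro allI impI)
  fix c :: "'d obs \<Rightarrow> real" assume ex: "\<exists>a\<in>A. c a \<noteq> 0"
  let ?T = "{1..num_types m}"
  let ?n = "\<lambda>z z'. noiseless z z' - gam z z'"
  have ty: "snd z \<in> ?T" if "z \<in> A" for z using all_obs_type assms that by blast
  define d where "d i z = (if snd z = i then c z else 0)" for i z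
  have "0 \<le> (\<Sum>i\<in>?T. \<Sum>z\<in>A. \<Sum>z'\<in>A. d i z * ?n z z' * d i z')"
    by (intro sum_nonneg schur_nonneg assms)
  also have "\<dots> = (\<Sum>z\<in>A. \<Sum>z'\<in>A. \<Sum>i\<in>?T. d i z * ?n z z' * d i z')"
    by (subst sum.swap, intro sum.cong refl, rule sum.swap)
  also have "\<dots> = (\<Sum>z\<in>A. \<Sum>z'\<in>A. if snd z = snd z' then c z * ?n z z' * c z' else 0)"
  proof (intro sum.cong refl)
    fix z z' assume z: "z \<in> A" "z' \<in> A"
    have "(\<Sum>i\<in>?T. d i z * ?n z z' * d i z')
        = (\<Sum>i\<in>?T. if i = snd z then (if snd z = snd z' then c z * ?n z z' * c z' else 0) else 0)"
      by (intro sum.cong) (auto simp: d_def)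
    then show "(\<Sum>i\<in>?T. d i z * ?n z z' * d i z')
        = (if snd z = snd z' then c z * ?n z z' * c z' else 0)"
      using ty[OF z(1)] by simp
  qed
  finally have nonneg: "0 \<le> \<dots>" .
  have "0 < (\<Sum>z\<in>A. c z * noise m (snd z) * c z)"
  proof -
    obtain z where z: "z \<in> A" "c z \<noteq> 0" using ex by blast
    have np: "0 < noise m (snd x)" if "x \<in> A" for x
      using model ty[OF that] by (simp add: mogp_model_def)
    have "0 \<le> c x * noise m (snd x) * c x" if "x \<in> A" for x
      using np[OF that] by (auto simp: zero_le_mult_iff mult_le_0_iff)
    moreover have "0 < c z * noise m (snd z) * c z"
      using np[OF z(1)] z(2) by (auto simp: zero_less_mult_iff mult_less_0_iff)
    ultimately show ?thesis using z(1) assms(1) by (intro sum_pos2[of A z]) auto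
  qed
  with nonneg have "0 < (\<Sum>z\<in>A. \<Sum>z'\<in>A. if snd z = snd z' then c z * ?n z z' * c z' else 0)
      + (\<Sum>z\<in>A. c z * noise m (snd z) * c z)" by simp
  also have "(\<Sum>z\<in>A. c z * noise m (snd z) * c z)
      = (\<Sum>z\<in>A. \<Sum>z'\<in>A. if z = z' then c z * noise m (snd z) * c z else 0)"
    using assms(1) by simp
  also have "(\<Sum>z\<in>A. \<Sum>z'\<in>A. if snd z = snd z' then c z * ?n z z' * c z' else 0) + \<dots>
      = (\<Sum>z\<in>A. \<Sum>z'\<in>A. c z * lam z z' * c z')"
    unfolding sum.distrib[symmetric]
    by (intro sum.cong refl) (use ty in \<open>auto simp: lam_def cov_VV_eq algebra_simps\<close>)
  finally show "0 < (\<Sum>z\<in>A. \<Sum>z'\<in>A. c z * lam z z' * c z')" .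
qed

lemma gam_nonneg: "0 \<le> (\<Sum>z\<in>A. \<Sum>z'\<in>A. c z * gam z z' * c z')"
  unfolding gam_def quadratic_sandwich by (intro inverse_nonneg finU cov_UU_pos_def)

text \<open>The matrix called \<open>S\<^sub>A\<close> above, through which alone the conditioning
  set enters the variance.\<close>

definition info :: "'d obs set \<Rightarrow> real ^ 'd \<Rightarrow> real ^ 'd \<Rightarrow> real" where
  "info A u v = (\<Sum>a\<in>A. \<Sum>b\<in>A. cov_VU m a u * inv_on A lam a b * cov_VU m b v)"

lemma info_pos_def:
  assumes "finite A" "A \<subseteq> all_obs m"
  shows "pos_def_on U (\<lambda>u v. cov_UU m u v + info A u v)"
proof (rule pos_def_on_add_nonneg[OF cov_UU_pos_def])
  show "0 \<le> (\<Sum>u\<in>U. \<Sum>v\<in>U. c u * info A u v * c v)" for c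
    unfolding info_def quadratic_sandwich[where C = "\<lambda>u a. cov_VU m a u"]
    by (intro inverse_nonneg assms lam_pos_def)
qed

section \<open>The PITC variance in terms of matrices indexed by U\<close>

lemma Gamma_eq:
  "Gamma m U A B = set_mat gam A B"
proof -
  have "(\<Sum>v\<in>U. (\<Sum>u\<in>U. cov_VU m a u * inv_on U (cov_UU m) u v) * cov_VU m b v) = gam a b" for a b
    unfolding gam_def sum_distrib_right by (rule sum.swap)
  then show ?thesis
    unfolding Gamma_def
    by (simp add: mat_inv_set_mat[OF finU cov_UU_pos_def] set_mat_transpose set_mat_mult[OF finU])
qed

lemma Lambda_eq: "Lambda m U A = set_mat lam A A"
  by (intro eq_matI) (auto simp: Lambda_def Sigma_cond_def Gamma_eq set_mat_def lam_def)

text \<open>The prior part collapses, since \<open>gam z z + lam z z = cov_VV m z z\<close>, and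
  \<open>woodbury_form\<close> rewrites the correction. The formula covers members of
  \<open>A\<close> too, so one program can evaluate all candidates alike.\<close>

lemma Sigma_PITC_eq:
  assumes A: "finite A" "A \<subseteq> all_obs m"
  shows "Sigma_PITC m U {z} A $$ (0, 0) = cov_VV m z z
    - (\<Sum>u\<in>U. \<Sum>v\<in>U. cov_VU m z u *
        (inv_on U (cov_UU m) u v - inv_on U (\<lambda>u v. cov_UU m u v + info A u v) u v) * cov_VU m z v)"
proof -
  let ?f = "\<lambda>a b. gam a b + lam a b"
  have pd: "pos_def_on A ?f"
    using pos_def_on_add_nonneg[OF lam_pos_def[OF A] gam_nonneg] by (simp add: add.commute)
  have fnz: "from_nat_into {z} 0 = z" by (metis from_nat_into insert_not_empty singletonD)
  have S: "Sigma_PITC m U {z} A = set_mat (\<lambda>x y. ?f x y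
      - (\<Sum>b\<in>A. (\<Sum>a\<in>A. gam x a * inv_on A ?f a b) * gam b y)) {z} {z}"
    unfolding Sigma_PITC_def Gamma_eq Lambda_eq set_mat_add mat_inv_set_mat[OF A(1) pd]
      set_mat_mult[OF A(1)] set_mat_diff ..
  have "Sigma_PITC m U {z} A $$ (0, 0)
      = cov_VV m z z - (\<Sum>b\<in>A. (\<Sum>a\<in>A. gam z a * inv_on A ?f a b) * gam b z)"
    unfolding S by (simp add: set_mat_def fnz lam_def)
  also have "(\<Sum>b\<in>A. (\<Sum>a\<in>A. gam z a * inv_on A ?f a b) * gam b z)
      = (\<Sum>a\<in>A. \<Sum>b\<in>A. gam z a * inv_on A ?f a b * gam b z)"
    unfolding sum_distrib_right by (rule sum.swap)
  also have "\<dots> = (\<Sum>u\<in>U. \<Sum>v\<in>U. cov_VU m z u *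
        (inv_on U (cov_UU m) u v - inv_on U (\<lambda>u v. cov_UU m u v + info A u v) u v) * cov_VU m z v)"
    unfolding gam_def
  proof (rule woodbury_form[OF finU A(1)])
    show "inverse_on U (cov_UU m) (inv_on U (cov_UU m))"
      by (rule inverse_on_pos_def[OF finU cov_UU_pos_def])
    show "inverse_on A lam (inv_on A lam)"
      by (rule inverse_on_pos_def[OF A(1) lam_pos_def[OF A]])
    show "inverse_on U (\<lambda>u v. cov_UU m u v +
        (\<Sum>a\<in>A. \<Sum>b\<in>A. cov_VU m a u * inv_on A lam a b * cov_VU m b v))
        (inv_on U (\<lambda>u v. cov_UU m u v + info A u v))"
      using inverse_on_pos_def[OF finU info_pos_def[OF A]] by (simp add: info_def)
    show "inverse_on A (\<lambda>a b. (\<Sum>u\<in>U. \<Sum>v\<in>U. cov_VU m a u * inv_on U (cov_UU m) u v * cov_VU m b v) + lam a b)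
        (inv_on A (\<lambda>a b. (\<Sum>u\<in>U. \<Sum>v\<in>U. cov_VU m a u * inv_on U (cov_UU m) u v * cov_VU m b v) + lam a b))"
      using inverse_on_pos_def[OF A(1) pd] by (simp add: gam_def)
  qed
  finally show ?thesis .
qed

text \<open>\<open>lam\<close> vanishes between \<open>A\<close> and \<open>B\<close>, so the
  block-diagonal function \<open>?g\<close> built from the two inverses satisfies the inverse
  equations on the union. By uniqueness it is the inverse, and the mixed terms of
  \<open>info\<close> are zero.\<close>

lemma info_union:
  assumes A: "finite A" "A \<subseteq> all_obs m" and B: "finite B" "B \<subseteq> all_obs m"
    and ne: "\<And>a b. a \<in> A \<Longrightarrow> b \<in> B \<Longrightarrow> snd a \<noteq> snd b"
  shows "info (A \<union> B) u v = info A u v + info B u v"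
proof -
  let ?g = "\<lambda>a b. if a \<in> A then (if b \<in> A then inv_on A lam a b else 0)
                  else (if b \<in> A then 0 else inv_on B lam a b)"
  have AB: "finite (A \<union> B)" "A \<union> B \<subseteq> all_obs m" using A B by auto
  have disj: "A \<inter> B = {}" using ne by blast
  have split: "(\<Sum>c\<in>A \<union> B. h c) = (\<Sum>c\<in>A. h c) + (\<Sum>c\<in>B. h c)" for h :: "'d obs \<Rightarrow> real"
    using A B disj by (intro sum.union_disjoint) auto
  have nB: "b \<notin> A" if "b \<in> B" for b using that disj by blast
  have l0: "lam a b = 0" "lam b a = 0" if "a \<in> A" "b \<in> B" for a b
    using ne[OF that] by (auto simp: lam_def)
  note iA = inverse_on_pos_def[OF A(1) lam_pos_def[OF A], unfolded inverse_on_def]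
  note iB = inverse_on_pos_def[OF B(1) lam_pos_def[OF B], unfolded inverse_on_def]
  have "inverse_on (A \<union> B) lam ?g"
    unfolding inverse_on_def split using iA iB l0 nB by (auto simp: ball_Un)
  then have g: "inv_on (A \<union> B) lam a b = ?g a b" if "a \<in> A \<union> B" "b \<in> A \<union> B" for a b
    using inverse_on_unique[OF AB(1) inverse_on_pos_def[OF AB(1) lam_pos_def[OF AB]]] that by blast
  have "info (A \<union> B) u v = (\<Sum>a\<in>A \<union> B. \<Sum>b\<in>A \<union> B. cov_VU m a u * ?g a b * cov_VU m b v)"
    unfolding info_def by (intro sum.cong refl) (simp add: g)
  also have "\<dots> = info A u v + info B u v"
    unfolding split info_def using nB by (simp add: sum.distrib)
  finally show ?thesis .
qed

end

section \<open>Reasoning about programs\<close>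

text \<open>Total correctness within a time budget, for one concrete start state: \<open>Q\<close>
  may mention \<open>s\<close>, so frame conditions need no auxiliary variables.\<close>

definition runs :: "cov_oracle \<Rightarrow> com \<Rightarrow> state \<Rightarrow> nat \<Rightarrow> (state \<Rightarrow> bool) \<Rightarrow> bool" where
  "runs K c s B Q \<longleftrightarrow> (\<exists>T s'. exec K c s T s' \<and> T \<le> B \<and> Q s')"

text \<open>A frame condition at the granularity of whole arrays: those named in \<open>NS\<close>
  and \<open>RS\<close> may have changed arbitrarily.\<close>

definition same :: "string set \<Rightarrow> string set \<Rightarrow> state \<Rightarrow> state \<Rightarrow> bool" where
  "same NS RS s s' \<longleftrightarrow> (\<forall>x. x \<notin> NS \<longrightarrow> nmem s' x = nmem s x) \<and> (\<forall>y. y \<notin> RS \<longrightarrow> rmem s' y = rmem s y)"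

definition nupd :: "state \<Rightarrow> string \<Rightarrow> nat \<Rightarrow> nat \<Rightarrow> state" where
  "nupd s x k v = s\<lparr>nmem := (nmem s)(x := (nmem s x)(k := v))\<rparr>"

definition rupd :: "state \<Rightarrow> string \<Rightarrow> nat \<Rightarrow> nat \<Rightarrow> real \<Rightarrow> state" where
  "rupd s y k l v = s\<lparr>rmem := (rmem s)(y := (rmem s y)(k := (rmem s y k)(l := v)))\<rparr>"

lemma nmem_nupd [simp]: "nmem (nupd s x k v) = (nmem s)(x := (nmem s x)(k := v))"
  and rmem_nupd [simp]: "rmem (nupd s x k v) = rmem s"
  by (simp_all add: nupd_def)

lemma nmem_rupd [simp]: "nmem (rupd s y k l v) = nmem s"
  and rmem_rupd [simp]: "rmem (rupd s y k l v) = (rmem s)(y := (rmem s y)(k := (rmem s y k)(l := v)))"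
  by (simp_all add: rupd_def)

lemma same_refl: "same NS RS s s"
  by (simp add: same_def)

lemma same_trans:
  "same NS RS s1 s2 \<Longrightarrow> same NS' RS' s2 s3 \<Longrightarrow> same (NS \<union> NS') (RS \<union> RS') s1 s3"
  by (simp add: same_def)

lemma same_trans_subset:
  "same NS' RS' s s1 \<Longrightarrow> same NS RS s1 s2 \<Longrightarrow> NS \<subseteq> NS' \<Longrightarrow> RS \<subseteq> RS' \<Longrightarrow> same NS' RS' s s2"
  unfolding same_def by (metis subsetD)

lemma same_mono: "same NS RS s s' \<Longrightarrow> NS \<subseteq> NS' \<Longrightarrow> RS \<subseteq> RS' \<Longrightarrow> same NS' RS' s s'"
  by (auto simp: same_def)

lemma same_nmem: "same NS RS s s' \<Longrightarrow> x \<notin> NS \<Longrightarrow> nmem s' x = nmem s x"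
  and same_rmem: "same NS RS s s' \<Longrightarrow> y \<notin> RS \<Longrightarrow> rmem s' y = rmem s y"
  by (simp_all add: same_def)

lemma same_nupd: "x \<in> NS \<Longrightarrow> same NS RS s s' \<Longrightarrow> same NS RS s (nupd s' x k v)"
  and same_rupd: "y \<in> RS \<Longrightarrow> same NS RS s s' \<Longrightarrow> same NS RS s (rupd s' y k l w)"
  by (auto simp: same_def)

section \<open>Rules for time-bounded execution\<close>

lemma runsI: "exec K c s T s' \<Longrightarrow> T \<le> B \<Longrightarrow> Q s' \<Longrightarrow> runs K c s B Q"
  by (auto simp: runs_def)

lemma runs_weaken:
  "runs K c s B Q \<Longrightarrow> B \<le> B' \<Longrightarrow> (\<And>s'. Q s' \<Longrightarrow> Q' s') \<Longrightarrow> runs K c s B' Q'"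
  unfolding runs_def by (fast intro: order.trans)

lemma runs_Skip: "1 \<le> B \<Longrightarrow> Q s \<Longrightarrow> runs K Skip s B Q"
  by (auto intro: runsI exec.Skip)

lemma runs_NAssign:
  "ncost a + ncost e + 1 \<le> B \<Longrightarrow> Q (nupd s x (nval a s) (nval e s)) \<Longrightarrow> runs K (NAssign x a e) s B Q"
  by (auto intro!: runsI exec.NAssign simp: nupd_def)

lemma runs_RAssign:
  "ncost a + ncost b + rcost e + 1 \<le> B \<Longrightarrow> Q (rupd s y (nval a s) (nval b s) (rval K e s)) \<Longrightarrow>
     runs K (RAssign y a b e) s B Q"
  by (auto intro!: runsI exec.RAssign simp: rupd_def)

lemma runs_Seq:
  assumes "runs K c1 s E P" "\<And>s'. P s' \<Longrightarrow> runs K c2 s' F Q" "E + F \<le> B"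
  shows "runs K (Seq c1 c2) s B Q"
proof -
  obtain T1 s1 where 1: "exec K c1 s T1 s1" "T1 \<le> E" "P s1" using assms(1) by (auto simp: runs_def)
  obtain T2 s2 where 2: "exec K c2 s1 T2 s2" "T2 \<le> F" "Q s2"
    using assms(2)[OF 1(3)] by (auto simp: runs_def)
  show ?thesis
    by (rule runsI[of _ _ _ _ _ B Q, OF exec.Seq[OF 1(1) 2(1)] _ 2(3)]) (use assms(3) 1(2) 2(2) in simp)
qed

lemma runs_If:
  assumes "bval K b s \<Longrightarrow> runs K c1 s B Q" "\<not> bval K b s \<Longrightarrow> runs K c2 s B Q" "bcost b + B + 1 \<le> B'"
  shows "runs K (If b c1 c2) s B' Q"
proof (cases "bval K b s")
  case True
  then obtain T s' where "exec K c1 s T s'" "T \<le> B" "Q s'" using assms(1) by (auto simp: runs_def)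
  then show ?thesis using assms(3) exec.IfTrue[OF True] by (auto intro!: runsI)
next
  case False
  then obtain T s' where "exec K c2 s T s'" "T \<le> B" "Q s'" using assms(2) by (auto simp: runs_def)
  then show ?thesis using assms(3) exec.IfFalse[OF False] by (auto intro!: runsI)
qed

text \<open>Positive definiteness supplies the successful \<open>mat_inverse\<close> that the
  machine rule demands. The result is stated by \<open>inv_on\<close>, hence independently of the
  storage order \<open>e'\<close>.\<close>

lemma runs_Invert:
  assumes n: "nval e s = n" and e: "bij_betw e' {..<n} A" and pd: "pos_def_on A f"
    and x: "\<And>k l. k < n \<Longrightarrow> l < n \<Longrightarrow> rmem s x k l = f (e' k) (e' l)"
    and B: "ncost e + n ^ 3 + 1 \<le> B"
    and Q: "\<And>s'. same {} {y} s s' \<Longrightarrow>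
        (\<And>k l. k < n \<Longrightarrow> l < n \<Longrightarrow> rmem s' y k l = inv_on A f (e' k) (e' l)) \<Longrightarrow> Q s'"
  shows "runs K (Invert y e x) s B Q"
proof -
  obtain M where M: "mat_inverse (Matrix.mat n n (\<lambda>(k, l). f (e' k) (e' l))) = Some M"
    "\<forall>k<n. \<forall>l<n. M $$ (k, l) = inv_on A f (e' k) (e' l)"
    using mat_inverse_pos_def[OF e pd] by blast
  have "Matrix.mat n n (\<lambda>(k, l). f (e' k) (e' l)) = Matrix.mat n n (\<lambda>(k, l). rmem s x k l)"
    using x by (intro eq_matI) auto
  with M(1) have "mat_inverse (Matrix.mat n n (\<lambda>(k, l). rmem s x k l)) = Some M" by simp
  from exec.Invert[OF n[symmetric] this, of K y]
  show ?thesis by (rule runsI) (use B M(2) in \<open>auto intro!: Q simp: same_def\<close>)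
qed

abbreviation cell :: "string \<Rightarrow> nexp" where
  "cell x \<equiv> NCell x (NConst 0)"

definition For :: "string \<Rightarrow> nexp \<Rightarrow> com \<Rightarrow> com" where
  "For x n c = Seq (NAssign x (NConst 0) (NConst 0))
     (While (NLess (cell x) n) (Seq c (NAssign x (NConst 0) (NAdd (cell x) (NConst 1)))))"

text \<open>The invariant describes the loop head, where the counter already holds \<open>i\<close>.
  The premise on the body therefore concerns the state after the increment, and requires that the
  body itself restores or keeps the counter.\<close>

lemma runs_For:
  assumes init: "I 0 (nupd s x 0 0)"
    and bound: "\<And>i s'. I i s' \<Longrightarrow> i \<le> n \<Longrightarrow> nval e s' = n"
    and body: "\<And>i s'. I i s' \<Longrightarrow> i < n \<Longrightarrow> nmem s' x 0 = i \<Longrightarrow>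
      runs K c s' B (\<lambda>s''. nmem s'' x 0 = i \<and> I (Suc i) (nupd s'' x 0 (Suc i)))"
    and post: "\<And>s'. I n s' \<Longrightarrow> Q s'"
    and B': "(n + 1) * (B + ncost e + 10) \<le> B'"
  shows "runs K (For x e c) s B' Q"
proof -
  let ?b = "NLess (cell x) e"
  let ?c = "Seq c (NAssign x (NConst 0) (NAdd (cell x) (NConst 1)))"
  \<comment> \<open>Per round, besides the body and the bound \<open>e\<close>: 3 for the
    comparison, 1 for the loop, 6 for the increment. The final failing test costs
    \<open>ncost e + 4\<close>.\<close>
  have loop: "runs K (While ?b ?c) s' (k * (B + ncost e + 10) + ncost e + 4) (I n)"
    if "I i s'" "nmem s' x 0 = i" "i + k = n" for i s' k
    using that
  proof (induction k arbitrary: i s')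
    case 0
    then have "\<not> bval K ?b s'" using bound[of i s'] by simp
    from exec.WhileFalse[OF this, of ?c] show ?case
      by (rule runsI) (use 0 in auto)
  next
    case (Suc k)
    have b: "bval K ?b s'" using Suc.prems bound[of i s'] by simp
    have "runs K ?c s' (B + 6) (\<lambda>s''. nmem s'' x 0 = Suc i \<and> I (Suc i) s'')"
      using Suc.prems
      by (intro runs_Seq[OF body]) (auto intro!: runs_NAssign)
    then obtain T1 s1 where 1: "exec K ?c s' T1 s1" "T1 \<le> B + 6" "nmem s1 x 0 = Suc i" "I (Suc i) s1"
      by (auto simp: runs_def)
    obtain T2 s2 where 2: "exec K (While ?b ?c) s1 T2 s2" "T2 \<le> k * (B + ncost e + 10) + ncost e + 4" "I n s2"
      using Suc.IH[OF 1(4,3)] Suc.prems(3) by (auto simp: runs_def)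
    show ?case
      by (rule runsI, rule exec.WhileTrue[OF b 1(1) 2(1)]) (use 1 2 in auto)
  qed
  have "runs K (For x e c) s (3 + (n * (B + ncost e + 10) + ncost e + 4)) (I n)"
    unfolding For_def
    by (rule runs_Seq[where E = 3 and P = "\<lambda>s'. I 0 s' \<and> nmem s' x 0 = 0"
          and F = "n * (B + ncost e + 10) + ncost e + 4"])
      (auto intro!: runs_NAssign init intro: loop[simplified])
  then show ?thesis by (rule runs_weaken) (use B' post in \<open>auto simp: algebra_simps\<close>)
qed

section \<open>Matrix sums by three nested loops\<close>

abbreviation loop_vars :: "string set" where
  "loop_vars \<equiv> {''i'', ''j'', ''k''}"

text \<open>
  Every step of linear algebra except inversion is an instance of the assignment
  \<open>y[i, j] := \<Sum>k<p. e(i, j, k)\<close> for all \<open>i < n\<close>, \<open>j < m\<close>, where \<open>e\<close> must not read \<open>y\<close>.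
\<close>

definition mat_sum :: "string \<Rightarrow> nexp \<Rightarrow> nexp \<Rightarrow> nexp \<Rightarrow> rexp \<Rightarrow> com" where
  "mat_sum y n m p e = For ''i'' n (For ''j'' m
     (Seq (RAssign y (cell ''i'') (cell ''j'') (RConst 0))
          (For ''k'' p (RAssign y (cell ''i'') (cell ''j'') (RAdd (RCell y (cell ''i'') (cell ''j'')) e)))))"

text \<open>Premise \<open>val\<close> ranges over all states that differ from \<open>s\<close> only
  in the counters and in \<open>y\<close>; this is how independence of \<open>e\<close> from the
  array being written is expressed.\<close>

lemma runs_mat_sum:
  assumes dims: "\<And>s'. same loop_vars {y} s s' \<Longrightarrow> nval n s' = n0 \<and> nval m s' = m0 \<and> nval p s' = p0"
    and val: "\<And>s' i j k. same loop_vars {y} s s' \<Longrightarrow> i < n0 \<Longrightarrow> j < m0 \<Longrightarrow> k < p0 \<Longrightarrow>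
      nmem s' ''i'' 0 = i \<Longrightarrow> nmem s' ''j'' 0 = j \<Longrightarrow> nmem s' ''k'' 0 = k \<Longrightarrow> rval K e s' = F i j k"
    and cost: "rcost e + ncost n + ncost m + ncost p \<le> 50"
    and B: "100 * ((n0 + 1) * (m0 + 1) * (p0 + 1)) \<le> B"
    and Q: "\<And>s'. same loop_vars {y} s s' \<Longrightarrow>
      (\<And>i j. i < n0 \<Longrightarrow> j < m0 \<Longrightarrow> rmem s' y i j = (\<Sum>k<p0. F i j k)) \<Longrightarrow> Q s'"
  shows "runs K (mat_sum y n m p e) s B Q"
proof -
  define filled where "filled s' a b \<longleftrightarrow> rmem s' y a b = (\<Sum>k<p0. F a b k)" for s' :: state and a b
  \<comment> \<open>Nested invariants: \<open>I\<close> for finished rows, \<open>J\<close> for the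
    finished cells of row \<open>i\<close>, \<open>L\<close> for the partial sum in the current
    cell.\<close>
  define I where "I i s' \<longleftrightarrow> same loop_vars {y} s s' \<and> (\<forall>a<i. \<forall>b<m0. filled s' a b)" for i s'
  define J where "J i j s' \<longleftrightarrow> I i s' \<and> nmem s' ''i'' 0 = i \<and> (\<forall>b<j. filled s' i b)" for i j s'
  define L where "L i j k s' \<longleftrightarrow> J i j s' \<and> nmem s' ''j'' 0 = j \<and> rmem s' y i j = (\<Sum>l<k. F i j l)"
    for i j k s'
  have same_I: "same loop_vars {y} s s'" if "I i s'" for i s' using that by (simp add: I_def)
  have nI: "I i (nupd s' x k v) = I i s'" if "x \<in> loop_vars" for i s' x k v
    using that by (auto simp: I_def filled_def same_def)
  have nJ: "J i j (nupd s' x k v) = J i j s'" if "x \<in> {''j'', ''k''}" for i j s' x k v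
    using that nI[of x] by (auto simp: J_def filled_def)
  have nL: "L i j k (nupd s' ''k'' l v) = L i j k s'" for i j k s' l v
    using nJ[of "''k''"] by (auto simp: L_def)
  have upd: "L i j k (rupd s' y i j v)" if "J i j s'" "nmem s' ''j'' 0 = j" "v = (\<Sum>l<k. F i j l)" for i j k s' v
    using that by (auto simp: L_def J_def I_def filled_def intro!: same_rupd)
  have kloop: "runs K (For ''k'' p (RAssign y (cell ''i'') (cell ''j'') (RAdd (RCell y (cell ''i'') (cell ''j'')) e)))
      s' ((p0 + 1) * (rcost e + ncost p + 21)) (L i j p0)" if "i < n0" "j < m0" "L i j 0 s'" for i j s'
  proof (rule runs_For[where I = "L i j" and n = p0 and B = "rcost e + 11"])
    show "L i j 0 (nupd s' ''k'' 0 0)" using that(3) nL by simp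
    show "nval p s'' = p0" if "L i j k s''" for k s''
      using that dims by (auto simp: L_def J_def I_def)
    show "runs K (RAssign y (cell ''i'') (cell ''j'') (RAdd (RCell y (cell ''i'') (cell ''j'')) e)) s'' (rcost e + 11)
        (\<lambda>s'''. nmem s''' ''k'' 0 = k \<and> L i j (Suc k) (nupd s''' ''k'' 0 (Suc k)))"
      if L: "L i j k s''" and k: "k < p0" "nmem s'' ''k'' 0 = k" for k s''
    proof (rule runs_RAssign)
      have i: "nmem s'' ''i'' 0 = i" and j: "nmem s'' ''j'' 0 = j" and J: "J i j s''"
        and r: "rmem s'' y i j = (\<Sum>l<k. F i j l)"
        using L by (auto simp: L_def J_def)
      have "rval K e s'' = F i j k"
        using val[OF same_I \<open>i < n0\<close> \<open>j < m0\<close> k(1) i j k(2)] J by (auto simp: J_def)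
      then show "nmem (rupd s'' y (nval (cell ''i'') s'') (nval (cell ''j'') s'')
            (rval K (RAdd (RCell y (cell ''i'') (cell ''j'')) e) s'')) ''k'' 0 = k \<and>
          L i j (Suc k) (nupd (rupd s'' y (nval (cell ''i'') s'') (nval (cell ''j'') s'')
            (rval K (RAdd (RCell y (cell ''i'') (cell ''j'')) e) s'')) ''k'' 0 (Suc k))"
        unfolding nL using upd[OF J j refl, of "Suc k"] i j k(2) r by simp
    qed simp
  qed (auto simp: algebra_simps)
  have jloop: "runs K (For ''j'' m (Seq (RAssign y (cell ''i'') (cell ''j'') (RConst 0))
      (For ''k'' p (RAssign y (cell ''i'') (cell ''j'') (RAdd (RCell y (cell ''i'') (cell ''j'')) e)))))
      s' ((m0 + 1) * ((p0 + 1) * (rcost e + ncost p + 21) + 6 + ncost m + 10)) (J i m0)"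
    if "i < n0" "J i 0 s'" for i s'
  proof (rule runs_For[where I = "J i" and n = m0 and B = "(p0 + 1) * (rcost e + ncost p + 21) + 6"])
    show "J i 0 (nupd s' ''j'' 0 0)" using that(2) nJ by simp
    show "nval m s'' = m0" if "J i j s''" for j s''
      using that dims by (auto simp: J_def I_def)
    show "runs K (Seq (RAssign y (cell ''i'') (cell ''j'') (RConst 0))
        (For ''k'' p (RAssign y (cell ''i'') (cell ''j'') (RAdd (RCell y (cell ''i'') (cell ''j'')) e)))) s''
        ((p0 + 1) * (rcost e + ncost p + 21) + 6)
        (\<lambda>s'''. nmem s''' ''j'' 0 = j \<and> J i (Suc j) (nupd s''' ''j'' 0 (Suc j)))"
      if J: "J i j s''" and j: "j < m0" "nmem s'' ''j'' 0 = j" for j s''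
    proof (rule runs_Seq[where P = "L i j 0" and E = 6])
      show "runs K (RAssign y (cell ''i'') (cell ''j'') (RConst 0)) s'' 6 (L i j 0)"
        using upd[OF J j(2), of 0 0] J j(2) by (intro runs_RAssign) (auto simp: J_def)
      show "runs K (For ''k'' p (RAssign y (cell ''i'') (cell ''j'') (RAdd (RCell y (cell ''i'') (cell ''j'')) e)))
          s3 ((p0 + 1) * (rcost e + ncost p + 21))
          (\<lambda>s'''. nmem s''' ''j'' 0 = j \<and> J i (Suc j) (nupd s''' ''j'' 0 (Suc j)))" if "L i j 0 s3" for s3
      proof (rule runs_weaken[OF kloop[OF \<open>i < n0\<close> j(1) that]])
        fix s4 assume "L i j p0 s4"
        then have "J i j s4" "nmem s4 ''j'' 0 = j" "filled s4 i j" by (auto simp: L_def filled_def)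
        then show "nmem s4 ''j'' 0 = j \<and> J i (Suc j) (nupd s4 ''j'' 0 (Suc j))"
          by (simp add: nJ) (auto simp: J_def less_Suc_eq)
      qed simp
    qed simp
  qed (auto simp: algebra_simps)
  show ?thesis
    unfolding mat_sum_def
  proof (rule runs_For[where I = I and n = n0
        and B = "(m0 + 1) * ((p0 + 1) * (rcost e + ncost p + 21) + 6 + ncost m + 10)"])
    show "I 0 (nupd s ''i'' 0 0)" by (simp add: nI) (simp add: I_def same_refl)
    show "nval n s' = n0" if "I i s'" for i s' using that dims by (auto simp: I_def)
    show "Q s'" if "I n0 s'" for s' using that Q by (auto simp: I_def filled_def)
    show "runs K (For ''j'' m (Seq (RAssign y (cell ''i'') (cell ''j'') (RConst 0))
        (For ''k'' p (RAssign y (cell ''i'') (cell ''j'') (RAdd (RCell y (cell ''i'') (cell ''j'')) e))))) s'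
        ((m0 + 1) * ((p0 + 1) * (rcost e + ncost p + 21) + 6 + ncost m + 10))
        (\<lambda>s''. nmem s'' ''i'' 0 = i \<and> I (Suc i) (nupd s'' ''i'' 0 (Suc i)))"
      if I: "I i s'" and i: "i < n0" "nmem s' ''i'' 0 = i" for i s'
    proof (rule runs_weaken[OF jloop])
      show "i < n0" "J i 0 s'" using I i by (auto simp: J_def)
      fix s'' assume "J i m0 s''"
      then show "nmem s'' ''i'' 0 = i \<and> I (Suc i) (nupd s'' ''i'' 0 (Suc i))"
        by (simp add: nI) (auto simp: J_def I_def less_Suc_eq)
    qed simp
    \<comment> \<open>All overheads move into the innermost factor: 21 + 6 + 10 + 10 = 47 on top of
      the at most 50 units for the expressions, below 100.\<close>
    have "(m0 + 1) * ((p0 + 1) * (rcost e + ncost p + 21) + 6 + ncost m + 10) + ncost n + 10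
        \<le> (m0 + 1) * ((p0 + 1) * (rcost e + ncost p + 21 + (6 + ncost m + 10 + (ncost n + 10))))"
    proof -
      have "(y + 1) * ((x + 1) * r + c) + d \<le> (y + 1) * ((x + 1) * (r + (c + d)))" for x y r c d :: nat
      proof -
        have "(y + 1) * ((x + 1) * r + c) + d \<le> (y + 1) * ((x + 1) * r + c) + (y + 1) * d" by simp
        also have "\<dots> = (y + 1) * ((x + 1) * r + (c + d))" by (simp only: add_mult_distrib2 add.assoc)
        also have "\<dots> \<le> (y + 1) * ((x + 1) * r + (x + 1) * (c + d))"
          by (intro mult_le_mono add_le_mono) simp_all
        finally show ?thesis by (simp only: add_mult_distrib2)
      qed
      from this[of m0 p0 "rcost e + ncost p + 21" "6 + ncost m + 10" "ncost n + 10"]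
      show ?thesis by (simp only: add.assoc)
    qed
    also have "\<dots> \<le> (m0 + 1) * ((p0 + 1) * 100)" using cost by (intro mult_le_mono) auto
    finally have "(n0 + 1) * ((m0 + 1) * ((p0 + 1) * (rcost e + ncost p + 21) + 6 + ncost m + 10) + ncost n + 10)
        \<le> (n0 + 1) * ((m0 + 1) * ((p0 + 1) * 100))" by (intro mult_le_mono) auto
    also have "\<dots> \<le> B" using B by (simp only: mult_ac)
    finally show "(n0 + 1) * ((m0 + 1) * ((p0 + 1) * (rcost e + ncost p + 21) + 6 + ncost m + 10) + ncost n + 10) \<le> B" .
  qed
qed

section \<open>Programs for the greedy algorithm\<close>

abbreviation "nU \<equiv> cell ''sizeU''"
abbreviation "nV \<equiv> cell ''sizeV''"
abbreviation "vi \<equiv> cell ''i''"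
abbreviation "vj \<equiv> cell ''j''"
abbreviation "vk \<equiv> cell ''k''"

text \<open>
  There is no coercion from \<open>nat\<close> to \<open>real\<close> and no conditional expression.  The Kronecker delta is read
  off the array \<open>E\<close> with \<open>E[0, 0] = 1\<close> and \<open>E[k, 0] = 0\<close> otherwise; by truncated subtraction the index is
  \<open>\<bar>a - b\<bar>\<close>.
\<close>

definition delta :: "nexp \<Rightarrow> nexp \<Rightarrow> rexp" where
  "delta a b = RCell ''E'' (NAdd (NSub a b) (NSub b a)) (NConst 0)"

text \<open>For the set A listed by positions in array \<open>a\<close> of length \<open>l\<close>:
  \<open>G\<close> and \<open>L\<close> hold the Gamma and Lambda matrices of A, \<open>LI\<close>
  the inverse of \<open>L\<close>, \<open>P\<close> its product with the covariances with U, and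
  \<open>out\<close> the matrix \<open>S\<^sub>A\<close>. An inner bound of 1 turns
  \<open>mat_sum\<close> into elementwise assignment.\<close>

definition info_prog :: "string \<Rightarrow> string \<Rightarrow> string \<Rightarrow> com" where
  "info_prog a l out =
     Seq (mat_sum ''G'' (cell l) (cell l) nU (RMul (RCell ''Q'' (NCell a vi) vk) (RCov QVU (NCell a vj) vk)))
    (Seq (mat_sum ''L'' (cell l) (cell l) (NConst 1)
       (RMul (delta (NCell ''type'' (NCell a vi)) (NCell ''type'' (NCell a vj)))
         (RSub (RCov QVV (NCell a vi) (NCell a vj)) (RCell ''G'' vi vj))))
    (Seq (Invert ''LI'' (cell l) ''L'')
    (Seq (mat_sum ''P'' (cell l) nU (cell l) (RMul (RCell ''LI'' vi vk) (RCov QVU (NCell a vk) vj)))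
     (mat_sum out nU nU (cell l) (RMul (RCov QVU (NCell a vk) vi) (RCell ''P'' vk vj))))))"

text \<open>\<open>D\<close> applies the difference of the two inverses to all candidates, and
  \<open>F\<close> keeps only the diagonal of the resulting form. This is what limits the cost to
  |V| |U|^2. \<open>F\<close> and \<open>out\<close> are columns with second index 0.\<close>

definition entropy_prog :: "string \<Rightarrow> string \<Rightarrow> com" where
  "entropy_prog S out =
     Seq (mat_sum ''M'' nU nU (NConst 1) (RAdd (RCov QUU vi vj) (RCell S vi vj)))
    (Seq (Invert ''MI'' nU ''M'')
    (Seq (mat_sum ''D'' nV nU nU (RMul (RCov QVU vi vk) (RSub (RCell ''KI'' vk vj) (RCell ''MI'' vk vj))))
    (Seq (mat_sum ''F'' nV (NConst 1) nU (RMul (RCell ''D'' vi vk) (RCov QVU vi vk)))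
     (mat_sum out nV (NConst 1) (NConst 1) (RMul (RConst (1/2)) (RLn (RMul (RConst (2 * pi * exp 1))
       (RSub (RCov QVV vi vi) (RCell ''F'' vi vj)))))))))"

locale pitc_input = pitc m "set us" for m :: "('d::finite) mogp" and us :: "(real ^ 'd) list" +
  fixes vs :: "'d obs list"
  assumes dist_us: "distinct us" and dist_vs: "distinct vs" and vs_obs: "set vs \<subseteq> all_obs m"
begin

abbreviation "Kov \<equiv> cov_entries m us vs"
abbreviation "Ki \<equiv> inv_on (set us) (cov_UU m)"

lemma sum_us: "(\<Sum>k<length us. f (us ! k)) = (\<Sum>u\<in>set us. f u)"
  using sum.reindex_bij_betw[OF bij_betw_nth[OF dist_us refl refl], of f] by simp

text \<open>The data fixed by the initialisation and left alone afterwards; \<open>Q\<close> holds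
  the product of the covariances of V and U with \<open>K^-1\<close>.\<close>

definition base :: "state \<Rightarrow> bool" where
  "base s \<longleftrightarrow> nmem s ''sizeU'' 0 = length us \<and> nmem s ''sizeV'' 0 = length vs \<and>
     (\<forall>k<length vs. nmem s ''type'' k = snd (vs ! k)) \<and>
     (\<forall>k. rmem s ''E'' k 0 = (if k = 0 then 1 else 0)) \<and>
     (\<forall>i<length us. \<forall>j<length us. rmem s ''KI'' i j = Ki (us ! i) (us ! j)) \<and>
     (\<forall>z<length vs. \<forall>j<length us.
        rmem s ''Q'' z j = (\<Sum>u\<in>set us. cov_VU m (vs ! z) u * Ki u (us ! j)))"

lemma base_same:
  assumes "base s" "same NS RS s s'" "NS \<inter> {''sizeU'', ''sizeV'', ''type''} = {}"
    "RS \<inter> {''E'', ''KI'', ''Q''} = {}"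
  shows "base s'"
  using assms by (auto simp: base_def same_def)

lemma rval_delta: "base s \<Longrightarrow> rval Kov (delta a b) s = (if nval a s = nval b s then 1 else 0)"
  by (auto simp: delta_def base_def)

lemma runs_info:
  assumes base: "base s" and n: "nmem s l 0 = n"
    and names: "a \<notin> loop_vars" "l \<notin> loop_vars" "out \<notin> {''E'', ''KI'', ''Q'', ''G'', ''L'', ''LI'', ''P''}"
    and idx: "\<And>k. k < n \<Longrightarrow> nmem s a k < length vs"
    and bij: "bij_betw (\<lambda>k. vs ! nmem s a k) {..<n} A"
    and B: "1000 * (n + length us + 2) ^ 3 \<le> B"
    and Q: "\<And>s'. same loop_vars {''G'', ''L'', ''LI'', ''P'', out} s s' \<Longrightarrow>
      (\<And>i j. i < length us \<Longrightarrow> j < length us \<Longrightarrow> rmem s' out i j = info A (us ! i) (us ! j)) \<Longrightarrow> Q s'"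
  shows "runs Kov (info_prog a l out) s B Q"
proof -
  define e where "e k = vs ! nmem s a k" for k
  have eV: "nmem s a k < length vs" "vs ! nmem s a k = e k" if "k < n" for k
    using idx[OF that] by (auto simp: e_def)
  have bij: "bij_betw e {..<n} A" using bij by (simp add: e_def[abs_def])
  have A: "finite A" "A \<subseteq> all_obs m"
  proof -
    show "finite A" using bij bij_betw_finite by blast
    show "A \<subseteq> all_obs m"
      using bij vs_obs idx nth_mem unfolding bij_betw_def e_def by fastforce
  qed
  have sumA: "(\<Sum>k<n. f (e k)) = (\<Sum>a\<in>A. f a)" for f :: "'d obs \<Rightarrow> real"
    using sum.reindex_bij_betw[OF bij, of f] by simp
  let ?u = "length us"
  define P1 where "P1 s' \<longleftrightarrow> same loop_vars {''G''} s s' \<and> (\<forall>i<n. \<forall>j<n. rmem s' ''G'' i j = gam (e i) (e j))" for s'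
  define P2 where "P2 s' \<longleftrightarrow> same loop_vars {''G'', ''L''} s s' \<and> (\<forall>i<n. \<forall>j<n. rmem s' ''L'' i j = lam (e i) (e j))" for s'
  define P3 where "P3 s' \<longleftrightarrow> same loop_vars {''G'', ''L'', ''LI''} s s' \<and>
    (\<forall>i<n. \<forall>j<n. rmem s' ''LI'' i j = inv_on A lam (e i) (e j))" for s'
  define P4 where "P4 s' \<longleftrightarrow> same loop_vars {''G'', ''L'', ''LI'', ''P''} s s' \<and>
    (\<forall>i<n. \<forall>j<?u. rmem s' ''P'' i j = (\<Sum>b\<in>A. inv_on A lam (e i) b * cov_VU m b (us ! j)))" for s'
  have 1: "runs Kov (mat_sum ''G'' (cell l) (cell l) nU
      (RMul (RCell ''Q'' (NCell a vi) vk) (RCov QVU (NCell a vj) vk))) s (100 * ((n+1)*(n+1)*(?u+1))) P1"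
  proof (rule runs_mat_sum)
    fix s' assume s: "same loop_vars {''G''} s s'"
    have b: "base s'" by (rule base_same[OF base s]) auto
    show "nval (cell l) s' = n \<and> nval (cell l) s' = n \<and> nval nU s' = ?u"
      using b same_nmem[OF s names(2)] n by (simp add: base_def)
    show "rval Kov (RMul (RCell ''Q'' (NCell a vi) vk) (RCov QVU (NCell a vj) vk)) s'
        = (\<Sum>u\<in>set us. cov_VU m (e i) u * Ki u (us ! k)) * cov_VU m (e j) (us ! k)"
      if "i < n" "j < n" "k < ?u" "nmem s' ''i'' 0 = i" "nmem s' ''j'' 0 = j" "nmem s' ''k'' 0 = k" for i j k
      using that b eV by (simp add: same_nmem[OF s names(1)] base_def cov_entries_def)
  next
    fix s' assume s: "same loop_vars {''G''} s s'"
      and G: "\<And>i j. i < n \<Longrightarrow> j < n \<Longrightarrow> rmem s' ''G'' i j =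
        (\<Sum>k<?u. (\<Sum>u\<in>set us. cov_VU m (e i) u * Ki u (us ! k)) * cov_VU m (e j) (us ! k))"
    have "(\<Sum>k<?u. (\<Sum>u\<in>set us. cov_VU m x u * Ki u (us ! k)) * cov_VU m y (us ! k)) = gam x y" for x y
      unfolding sum_us[of "\<lambda>v. (\<Sum>u\<in>set us. cov_VU m x u * Ki u v) * cov_VU m y v"]
      unfolding gam_def sum_distrib_right
      by (rule sum.swap)
    then show "P1 s'" using s G by (simp add: P1_def)
  qed simp_all
  have 2: "runs Kov (mat_sum ''L'' (cell l) (cell l) (NConst 1)
       (RMul (delta (NCell ''type'' (NCell a vi)) (NCell ''type'' (NCell a vj)))
         (RSub (RCov QVV (NCell a vi) (NCell a vj)) (RCell ''G'' vi vj)))) s1 (100 * ((n+1)*(n+1)*(1+1))) P2"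
    if "P1 s1" for s1
  proof (rule runs_mat_sum)
    fix s' assume s': "same loop_vars {''L''} s1 s'"
    from that have s1: "same loop_vars {''G''} s s1" by (simp add: P1_def)
    have s: "same loop_vars {''G'', ''L''} s s'" by (rule same_mono[OF same_trans[OF s1 s']]) auto
    have b: "base s'" by (rule base_same[OF base s]) auto
    have ty: "nmem s' ''type'' (nmem s a k) = snd (e k)" if "k < n" for k
      using b idx[OF that] by (simp add: base_def e_def)
    show "nval (cell l) s' = n \<and> nval (cell l) s' = n \<and> nval (NConst 1) s' = 1"
      using same_nmem[OF s names(2)] n by simp
    show "rval Kov (RMul (delta (NCell ''type'' (NCell a vi)) (NCell ''type'' (NCell a vj)))
         (RSub (RCov QVV (NCell a vi) (NCell a vj)) (RCell ''G'' vi vj))) s' = lam (e i) (e j)"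
      if "i < n" "j < n" "k < 1" "nmem s' ''i'' 0 = i" "nmem s' ''j'' 0 = j" "nmem s' ''k'' 0 = k" for i j k
      using that eV \<open>P1 s1\<close> same_rmem[OF s', of "''G''"]
      by (simp add: rval_delta[OF b] same_nmem[OF s names(1)] cov_entries_def ty lam_def P1_def)
  next
    fix s' assume s': "same loop_vars {''L''} s1 s'"
      and L: "\<And>i j. i < n \<Longrightarrow> j < n \<Longrightarrow> rmem s' ''L'' i j = (\<Sum>k<1::nat. lam (e i) (e j))"
    from that have s1: "same loop_vars {''G''} s s1" by (simp add: P1_def)
    have s: "same loop_vars {''G'', ''L''} s s'" by (rule same_mono[OF same_trans[OF s1 s']]) auto
    then show "P2 s'" using L by (simp add: P2_def)
  qed (simp_all add: delta_def)
  have 3: "runs Kov (Invert ''LI'' (cell l) ''L'') s2 (n ^ 3 + 3) P3" if "P2 s2" for s2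
  proof (rule runs_Invert[OF _ bij lam_pos_def[OF A]])
    from that have s2: "same loop_vars {''G'', ''L''} s s2" by (simp add: P2_def)
    show "nval (cell l) s2 = n" using same_nmem[OF s2 names(2)] n by simp
    show "rmem s2 ''L'' k j = lam (e k) (e j)" if "k < n" "j < n" for k j
      using that \<open>P2 s2\<close> by (simp add: P2_def)
    fix s' assume s': "same {} {''LI''} s2 s'"
      and L: "\<And>k j. k < n \<Longrightarrow> j < n \<Longrightarrow> rmem s' ''LI'' k j = inv_on A lam (e k) (e j)"
    have "same loop_vars {''G'', ''L'', ''LI''} s s'" by (rule same_mono[OF same_trans[OF s2 s']]) auto
    then show "P3 s'" using L by (simp add: P3_def)
  qed simp
  have 4: "runs Kov (mat_sum ''P'' (cell l) nU (cell l) (RMul (RCell ''LI'' vi vk) (RCov QVU (NCell a vk) vj)))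
      s3 (100 * ((n+1)*(?u+1)*(n+1))) P4" if "P3 s3" for s3
  proof (rule runs_mat_sum)
    fix s' assume s': "same loop_vars {''P''} s3 s'"
    from that have s3: "same loop_vars {''G'', ''L'', ''LI''} s s3" by (simp add: P3_def)
    have s: "same loop_vars {''G'', ''L'', ''LI'', ''P''} s s'" by (rule same_mono[OF same_trans[OF s3 s']]) auto
    have b: "base s'" by (rule base_same[OF base s]) auto
    show "nval (cell l) s' = n \<and> nval nU s' = ?u \<and> nval (cell l) s' = n"
      using b same_nmem[OF s names(2)] n by (simp add: base_def)
    show "rval Kov (RMul (RCell ''LI'' vi vk) (RCov QVU (NCell a vk) vj)) s'
        = inv_on A lam (e i) (e k) * cov_VU m (e k) (us ! j)"
      if "i < n" "j < ?u" "k < n" "nmem s' ''i'' 0 = i" "nmem s' ''j'' 0 = j" "nmem s' ''k'' 0 = k" for i j k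
      using that eV \<open>P3 s3\<close> same_rmem[OF s', of "''LI''"]
      by (simp add: same_nmem[OF s names(1)] cov_entries_def P3_def)
  next
    fix s' assume s': "same loop_vars {''P''} s3 s'"
      and P: "\<And>i j. i < n \<Longrightarrow> j < ?u \<Longrightarrow> rmem s' ''P'' i j
        = (\<Sum>k<n. inv_on A lam (e i) (e k) * cov_VU m (e k) (us ! j))"
    from that have s3: "same loop_vars {''G'', ''L'', ''LI''} s s3" by (simp add: P3_def)
    have s: "same loop_vars {''G'', ''L'', ''LI'', ''P''} s s'" by (rule same_mono[OF same_trans[OF s3 s']]) auto
    show "P4 s'" using s P sumA[of "\<lambda>b. inv_on A lam _ b * cov_VU m b _"] by (simp add: P4_def)
  qed simp_all
  have 5: "runs Kov (mat_sum out nU nU (cell l) (RMul (RCov QVU (NCell a vk) vi) (RCell ''P'' vk vj)))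
      s4 (100 * ((?u+1)*(?u+1)*(n+1))) Q" if "P4 s4" for s4
  proof (rule runs_mat_sum)
    fix s' assume s': "same loop_vars {out} s4 s'"
    from that have s4: "same loop_vars {''G'', ''L'', ''LI'', ''P''} s s4" by (simp add: P4_def)
    have s: "same loop_vars {''G'', ''L'', ''LI'', ''P'', out} s s'"
      by (rule same_mono[OF same_trans[OF s4 s']]) auto
    have b: "base s'" by (rule base_same[OF base s]) (use names(3) in auto)
    show "nval nU s' = ?u \<and> nval nU s' = ?u \<and> nval (cell l) s' = n"
      using b same_nmem[OF s names(2)] n by (simp add: base_def)
    have out: "''P'' \<notin> {out}" using names(3) by auto
    show "rval Kov (RMul (RCov QVU (NCell a vk) vi) (RCell ''P'' vk vj)) s'
        = cov_VU m (e k) (us ! i) * (\<Sum>b\<in>A. inv_on A lam (e k) b * cov_VU m b (us ! j))"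
      if "i < ?u" "j < ?u" "k < n" "nmem s' ''i'' 0 = i" "nmem s' ''j'' 0 = j" "nmem s' ''k'' 0 = k" for i j k
      using that eV \<open>P4 s4\<close> same_rmem[OF s' out]
      by (simp add: same_nmem[OF s names(1)] cov_entries_def P4_def)
  next
    fix s' assume s': "same loop_vars {out} s4 s'"
      and P: "\<And>i j. i < ?u \<Longrightarrow> j < ?u \<Longrightarrow> rmem s' out i j
        = (\<Sum>k<n. cov_VU m (e k) (us ! i) * (\<Sum>b\<in>A. inv_on A lam (e k) b * cov_VU m b (us ! j)))"
    from that have s4: "same loop_vars {''G'', ''L'', ''LI'', ''P''} s s4" by (simp add: P4_def)
    have s: "same loop_vars {''G'', ''L'', ''LI'', ''P'', out} s s'"
      by (rule same_mono[OF same_trans[OF s4 s']]) auto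
    show "Q s'"
    proof (rule Q[OF s])
      fix i j assume "i < ?u" "j < ?u"
      then have "rmem s' out i j =
          (\<Sum>a\<in>A. cov_VU m a (us ! i) * (\<Sum>b\<in>A. inv_on A lam a b * cov_VU m b (us ! j)))"
        using P sumA[of "\<lambda>a. cov_VU m a (us ! i) * (\<Sum>b\<in>A. inv_on A lam a b * cov_VU m b (us ! j))"] by simp
      then show "rmem s' out i j = info A (us ! i) (us ! j)"
        by (simp add: info_def sum_distrib_left mult.assoc)
    qed
  qed simp_all
  \<comment> \<open>One cube covers the inversion and all products; after expansion the comparison
    is coefficientwise.\<close>
  have "100 * ((n+1)*(n+1)*(?u+1)) + (100 * ((n+1)*(n+1)*(1+1)) + (n ^ 3 + 3 +
      (100 * ((n+1)*(?u+1)*(n+1)) + 100 * ((?u+1)*(?u+1)*(n+1))))) \<le> 1000 * (n + ?u + 2) ^ 3"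
    by (simp add: power3_eq_cube algebra_simps)
  also note B
  finally have cost: "100 * ((n+1)*(n+1)*(?u+1)) + (100 * ((n+1)*(n+1)*(1+1)) + (n ^ 3 + 3 +
      (100 * ((n+1)*(?u+1)*(n+1)) + 100 * ((?u+1)*(?u+1)*(n+1))))) \<le> B" .
  show ?thesis
    unfolding info_prog_def
    by (rule runs_Seq[OF 1 runs_Seq[OF 2 runs_Seq[OF 3 runs_Seq[OF 4 5 order.refl] order.refl] order.refl] cost])
qed

end

section \<open>Selecting candidates: target test, collection, maximum\<close>

definition is_target :: "nexp \<Rightarrow> bexp" where
  "is_target z = BAnd (BNot (NLess (NCell ''type'' z) (cell ''t''))) (BNot (NLess (cell ''t'') (NCell ''type'' z)))"

definition push :: "string \<Rightarrow> string \<Rightarrow> nexp \<Rightarrow> com" where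
  "push a l e = Seq (NAssign a (cell l) e) (NAssign l (NConst 0) (NAdd (cell l) (NConst 1)))"

definition collect_prog :: com where
  "collect_prog = For ''z'' nV (If (is_target (cell ''z'')) (push ''W'' ''w'' (cell ''z'')) Skip)"

text \<open>
  The position \<open>nV\<close> just after the last candidate is marked as used, so that \<open>b = nV\<close> says that no candidate has been found yet.
\<close>

definition argmax_prog :: com where
  "argmax_prog = Seq (NAssign ''b'' (NConst 0) nV)
     (For ''z'' nV (If (BAnd (NLess (NCell ''used'' (cell ''z'')) (NConst 1))
         (BNot (BAnd (NLess (NCell ''used'' (cell ''b'')) (NConst 1))
           (BNot (RLess (RCell ''SC'' (cell ''b'') (NConst 0)) (RCell ''SC'' (cell ''z'') (NConst 0)))))))
       (NAssign ''b'' (NConst 0) (cell ''z'')) Skip))"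

lemma bval_is_target: "bval K (is_target z) s \<longleftrightarrow> nmem s ''type'' (nval z s) = nmem s ''t'' 0"
  by (auto simp: is_target_def)

lemma runs_push:
  assumes "nmem s l 0 = n" "nval e s = x" "a \<noteq> l" "ncost e + 10 \<le> B"
    and "\<And>s'. same {a, l} {} s s' \<Longrightarrow> nmem s' l 0 = Suc n \<Longrightarrow> nmem s' a = (nmem s a)(n := x) \<Longrightarrow> Q s'"
  shows "runs K (push a l e) s B Q"
  unfolding push_def
proof (rule runs_Seq[where E = "ncost e + 3" and F = 6 and P = "\<lambda>s'. s' = nupd s a n x"])
  show "runs K (NAssign a (cell l) e) s (ncost e + 3) (\<lambda>s'. s' = nupd s a n x)"
    using assms(1,2) by (intro runs_NAssign) auto
  show "runs K (NAssign l (NConst 0) (NAdd (cell l) (NConst 1))) s' 6 Q" if "s' = nupd s a n x" for s'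
    using assms(1,3) that by (intro runs_NAssign assms(5)) (auto simp: same_def)
qed (use assms(4) in simp)

lemma map_append_upd: "map (f(n := x)) [0..<Suc n] = map f [0..<n] @ [x]"
  by simp

lemma runs_argmax:
  assumes v: "nmem s ''sizeV'' 0 = v" and used: "nmem s ''used'' v \<noteq> 0"
    and ex: "\<exists>z<v. nmem s ''used'' z = 0" and B: "100 * (v + 1) \<le> B"
    and Q: "\<And>s'. same {''z'', ''b''} {} s s' \<Longrightarrow> nmem s' ''b'' 0 < v \<Longrightarrow> nmem s ''used'' (nmem s' ''b'' 0) = 0 \<Longrightarrow>
      (\<And>z. z < v \<Longrightarrow> nmem s ''used'' z = 0 \<Longrightarrow> rmem s ''SC'' z 0 \<le> rmem s ''SC'' (nmem s' ''b'' 0) 0) \<Longrightarrow> Q s'"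
  shows "runs K argmax_prog s B Q"
proof -
  let ?f = "\<lambda>z. rmem s ''SC'' z 0" and ?u = "nmem s ''used''"
  \<comment> \<open>The first alternative is the sentinel \<open>b = v\<close>. Since
    \<open>v\<close> is marked as used, the sentinel loses to any free candidate, and the existence
    of one excludes it at the end.\<close>
  define best where "best i b \<longleftrightarrow> b = v \<and> (\<forall>z<i. ?u z \<noteq> 0) \<or>
    b < i \<and> ?u b = 0 \<and> (\<forall>z<i. ?u z = 0 \<longrightarrow> ?f z \<le> ?f b)" for i b
  have new: "best (Suc i) i" if "best i b" "?u i = 0" "?u b = 0 \<longrightarrow> ?f b < ?f i" for i b
  proof -
    have "?f z \<le> ?f i" if "z < i" "?u z = 0" for z
      using that \<open>best i b\<close> \<open>?u b = 0 \<longrightarrow> _\<close> unfolding best_def by fastforce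
    then show ?thesis using \<open>?u i = 0\<close> by (auto simp: best_def less_Suc_eq)
  qed
  have old: "best (Suc i) b" if "best i b" "?u i = 0 \<longrightarrow> ?u b = 0 \<and> ?f i \<le> ?f b" for i b
    using that used by (auto simp: best_def less_Suc_eq)
  define I where "I i s' \<longleftrightarrow> same {''z'', ''b''} {} s s' \<and> best i (nmem s' ''b'' 0)" for i s'
  let ?c = "BAnd (NLess (NCell ''used'' (cell ''z'')) (NConst 1))
         (BNot (BAnd (NLess (NCell ''used'' (cell ''b'')) (NConst 1))
           (BNot (RLess (RCell ''SC'' (cell ''b'') (NConst 0)) (RCell ''SC'' (cell ''z'') (NConst 0))))))"
  have init: "runs K (NAssign ''b'' (NConst 0) nV) s 4 (I 0)"
    by (intro runs_NAssign) (auto simp: I_def best_def v intro!: same_nupd same_refl)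
  have loop: "runs K (For ''z'' nV (If ?c (NAssign ''b'' (NConst 0) (cell ''z'')) Skip)) s1 ((v + 1) * 40) Q"
    if "I 0 s1" for s1
  proof (rule runs_For[where I = I and n = v and B = 28])
    show "I 0 (nupd s1 ''z'' 0 0)" using that by (auto simp: I_def intro!: same_nupd)
    show "nval nV s' = v" if "I i s'" for i s'
      using that v by (simp add: I_def same_def)
    show "Q s'" if "I v s'" for s'
      using that ex by (intro Q) (auto simp: I_def best_def)
    show "runs K (If ?c (NAssign ''b'' (NConst 0) (cell ''z'')) Skip) s' 28
        (\<lambda>s''. nmem s'' ''z'' 0 = i \<and> I (Suc i) (nupd s'' ''z'' 0 (Suc i)))"
      if I: "I i s'" and i: "i < v" "nmem s' ''z'' 0 = i" for i s'
    proof -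
      let ?b = "nmem s' ''b'' 0"
      have s': "same {''z'', ''b''} {} s s'" and b: "best i ?b" using I by (auto simp: I_def)
      have c: "bval K ?c s' \<longleftrightarrow> ?u i = 0 \<and> \<not> (?u ?b = 0 \<and> \<not> ?f ?b < ?f i)"
        using s' i by (auto simp: same_def)
      show ?thesis
      proof (rule runs_If[where B = 4])
        assume "bval K ?c s'"
        with c have "?u i = 0" "?u ?b = 0 \<longrightarrow> ?f ?b < ?f i" by blast+
        then have "best (Suc i) i" by (rule new[OF b])
        then show "runs K (NAssign ''b'' (NConst 0) (cell ''z'')) s' 4
            (\<lambda>s''. nmem s'' ''z'' 0 = i \<and> I (Suc i) (nupd s'' ''z'' 0 (Suc i)))"
          using s' i by (intro runs_NAssign) (auto simp: I_def intro!: same_nupd)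
      next
        assume "\<not> bval K ?c s'"
        with c have "?u i = 0 \<longrightarrow> ?u ?b = 0 \<and> ?f i \<le> ?f ?b" by (metis not_less)
        then have "best (Suc i) ?b" by (rule old[OF b])
        then show "runs K Skip s' 4
            (\<lambda>s''. nmem s'' ''z'' 0 = i \<and> I (Suc i) (nupd s'' ''z'' 0 (Suc i)))"
          using s' i by (intro runs_Skip) (auto simp: I_def intro!: same_nupd)
      qed simp
    qed
  qed simp
  show ?thesis unfolding argmax_prog_def by (rule runs_Seq[OF init loop]) (use B in auto)
qed

lemma runs_collect:
  assumes v: "nmem s ''sizeV'' 0 = v" and w: "nmem s ''w'' 0 = 0" and B: "100 * (v + 1) \<le> B"
    and Q: "\<And>s'. same {''z'', ''W'', ''w''} {} s s' \<Longrightarrow>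
      map (nmem s' ''W'') [0..<nmem s' ''w'' 0] = filter (\<lambda>z. nmem s ''type'' z = nmem s ''t'' 0) [0..<v] \<Longrightarrow> Q s'"
  shows "runs K collect_prog s B Q"
  unfolding collect_prog_def
proof (rule runs_For[where n = v and B = 28 and I = "\<lambda>i s'. same {''z'', ''W'', ''w''} {} s s' \<and>
      map (nmem s' ''W'') [0..<nmem s' ''w'' 0] = filter (\<lambda>z. nmem s ''type'' z = nmem s ''t'' 0) [0..<i]"])
  let ?F = "\<lambda>i. filter (\<lambda>z. nmem s ''type'' z = nmem s ''t'' 0) [0..<i]"
  let ?I = "\<lambda>i s'. same {''z'', ''W'', ''w''} {} s s' \<and> map (nmem s' ''W'') [0..<nmem s' ''w'' 0] = ?F i"
  show "?I 0 (nupd s ''z'' 0 0)" using w by (auto intro!: same_nupd same_refl)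
  show "nval nV s' = v" if "?I i s'" for i s' using that v by (simp add: same_def)
  show "runs K (If (is_target (cell ''z'')) (push ''W'' ''w'' (cell ''z'')) Skip) s' 28
      (\<lambda>s''. nmem s'' ''z'' 0 = i \<and> ?I (Suc i) (nupd s'' ''z'' 0 (Suc i)))"
    if I: "?I i s'" and i: "i < v" "nmem s' ''z'' 0 = i" for i s'
  proof -
    have s': "same {''z'', ''W'', ''w''} {} s s'" using I by simp
    have t: "bval K (is_target (cell ''z'')) s' \<longleftrightarrow> nmem s ''type'' i = nmem s ''t'' 0"
      using s' i(2) by (simp add: bval_is_target same_def)
    show ?thesis
    proof (rule runs_If[where B = 12])
      assume "bval K (is_target (cell ''z'')) s'"
      then have t: "nmem s ''type'' i = nmem s ''t'' 0" using t by simp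
      show "runs K (push ''W'' ''w'' (cell ''z'')) s' 12
          (\<lambda>s''. nmem s'' ''z'' 0 = i \<and> ?I (Suc i) (nupd s'' ''z'' 0 (Suc i)))"
      proof (rule runs_push[OF refl])
        fix s'' assume s'': "same {''W'', ''w''} {} s' s''" and w: "nmem s'' ''w'' 0 = Suc (nmem s' ''w'' 0)"
          and W: "nmem s'' ''W'' = (nmem s' ''W'')(nmem s' ''w'' 0 := i)"
        have "same {''z'', ''W'', ''w''} {} s s''" by (rule same_mono[OF same_trans[OF s' s'']]) auto
        moreover have "map (nmem s'' ''W'') [0..<nmem s'' ''w'' 0] = ?F (Suc i)"
          using I t unfolding w W map_append_upd by simp
        moreover have "nmem s'' ''z'' 0 = i" using s'' i(2) by (simp add: same_def)
        ultimately show "nmem s'' ''z'' 0 = i \<and> ?I (Suc i) (nupd s'' ''z'' 0 (Suc i))"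
          by (auto intro!: same_nupd)
      qed (use i(2) in auto)
    next
      assume "\<not> bval K (is_target (cell ''z'')) s'"
      then show "runs K Skip s' 12
          (\<lambda>s''. nmem s'' ''z'' 0 = i \<and> ?I (Suc i) (nupd s'' ''z'' 0 (Suc i)))"
        using t I i(2) by (intro runs_Skip) (auto intro!: same_nupd)
    qed (simp add: is_target_def)
  qed
  show "Q s'" if "?I v s'" for s' using that Q by blast
  show "(v + 1) * (28 + ncost nV + 10) \<le> B" using B by simp
qed

context pitc_input
begin

text \<open>The program sees the conditioning set \<open>A\<close> only through the array
  \<open>S\<close>, so it serves both entropies of the score.\<close>

lemma runs_entropy:
  assumes base: "base s" and A: "finite A" "A \<subseteq> all_obs m"
    and S: "\<And>i j. i < length us \<Longrightarrow> j < length us \<Longrightarrow> rmem s S i j = info A (us ! i) (us ! j)"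
    and names: "S \<notin> {''M'', ''MI'', ''D'', ''F'', out}" "out \<notin> {''E'', ''KI'', ''Q'', ''M'', ''MI'', ''D'', ''F''}"
    and le: "length us \<le> length vs"
    and B: "1000 * ((length vs + 1) * (length us + 1) ^ 2) \<le> B"
    and Q: "\<And>s'. same loop_vars {''M'', ''MI'', ''D'', ''F'', out} s s' \<Longrightarrow>
      (\<And>z. z < length vs \<Longrightarrow> rmem s' out z 0 = entropy m (set us) (vs ! z) A) \<Longrightarrow> Q s'"
  shows "runs Kov (entropy_prog S out) s B Q"
proof -
  let ?u = "length us" and ?v = "length vs"
  let ?Mi = "inv_on (set us) (\<lambda>u v. cov_UU m u v + info A u v)"
  define d where "d z v = (\<Sum>u\<in>set us. cov_VU m z u * (Ki u v - ?Mi u v))" for z v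
  define q where "q z = (\<Sum>v\<in>set us. d z v * cov_VU m z v)" for z
  define P1 where "P1 s' \<longleftrightarrow> same loop_vars {''M''} s s' \<and>
    (\<forall>i<?u. \<forall>j<?u. rmem s' ''M'' i j = cov_UU m (us ! i) (us ! j) + info A (us ! i) (us ! j))" for s'
  define P2 where "P2 s' \<longleftrightarrow> same loop_vars {''M'', ''MI''} s s' \<and>
    (\<forall>i<?u. \<forall>j<?u. rmem s' ''MI'' i j = ?Mi (us ! i) (us ! j))" for s'
  define P3 where "P3 s' \<longleftrightarrow> same loop_vars {''M'', ''MI'', ''D''} s s' \<and>
    (\<forall>z<?v. \<forall>j<?u. rmem s' ''D'' z j = d (vs ! z) (us ! j))" for s'
  define P4 where "P4 s' \<longleftrightarrow> same loop_vars {''M'', ''MI'', ''D'', ''F''} s s' \<and>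
    (\<forall>z<?v. rmem s' ''F'' z 0 = q (vs ! z))" for s'
  have dims: "nval nU s' = ?u" "nval nV s' = ?v" if "base s'" for s'
    using that by (auto simp: base_def)
  have 1: "runs Kov (mat_sum ''M'' nU nU (NConst 1) (RAdd (RCov QUU vi vj) (RCell S vi vj))) s
      (100 * ((?u+1)*(?u+1)*(1+1))) P1"
  proof (rule runs_mat_sum)
    fix s' assume s: "same loop_vars {''M''} s s'"
    have b: "base s'" by (rule base_same[OF base s]) auto
    show "nval nU s' = ?u \<and> nval nU s' = ?u \<and> nval (NConst 1) s' = 1" using dims[OF b] by simp
    have SM: "S \<notin> {''M''}" using names(1) by auto
    show "rval Kov (RAdd (RCov QUU vi vj) (RCell S vi vj)) s'
        = cov_UU m (us ! i) (us ! j) + info A (us ! i) (us ! j)"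
      if "i < ?u" "j < ?u" "k < 1" "nmem s' ''i'' 0 = i" "nmem s' ''j'' 0 = j" "nmem s' ''k'' 0 = k" for i j k
      using that S by (simp add: same_rmem[OF s SM] cov_entries_def)
  qed (auto simp: P1_def)
  have 2: "runs Kov (Invert ''MI'' nU ''M'') s1 (?u ^ 3 + 3) P2" if "P1 s1" for s1
  proof (rule runs_Invert[OF _ bij_betw_nth[OF dist_us refl refl] info_pos_def[OF A]])
    from that have s1: "same loop_vars {''M''} s s1" by (simp add: P1_def)
    have b: "base s1" by (rule base_same[OF base s1]) auto
    show "nval nU s1 = ?u" using dims[OF b] by simp
    show "rmem s1 ''M'' k l = cov_UU m (us ! k) (us ! l) + info A (us ! k) (us ! l)"
      if "k < ?u" "l < ?u" for k l using that \<open>P1 s1\<close> by (simp add: P1_def)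
    fix s' assume s': "same {} {''MI''} s1 s'"
      and M: "\<And>k l. k < ?u \<Longrightarrow> l < ?u \<Longrightarrow> rmem s' ''MI'' k l = ?Mi (us ! k) (us ! l)"
    have "same loop_vars {''M'', ''MI''} s s'" by (rule same_mono[OF same_trans[OF s1 s']]) auto
    then show "P2 s'" using M by (simp add: P2_def)
  qed simp
  have 3: "runs Kov (mat_sum ''D'' nV nU nU (RMul (RCov QVU vi vk) (RSub (RCell ''KI'' vk vj) (RCell ''MI'' vk vj))))
      s2 (100 * ((?v+1)*(?u+1)*(?u+1))) P3" if "P2 s2" for s2
  proof (rule runs_mat_sum)
    fix s' assume s': "same loop_vars {''D''} s2 s'"
    from that have s2: "same loop_vars {''M'', ''MI''} s s2" by (simp add: P2_def)
    have s: "same loop_vars {''M'', ''MI'', ''D''} s s'" by (rule same_mono[OF same_trans[OF s2 s']]) auto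
    have b: "base s'" by (rule base_same[OF base s]) auto
    show "nval nV s' = ?v \<and> nval nU s' = ?u \<and> nval nU s' = ?u" using dims[OF b] by simp
    show "rval Kov (RMul (RCov QVU vi vk) (RSub (RCell ''KI'' vk vj) (RCell ''MI'' vk vj))) s'
        = cov_VU m (vs ! i) (us ! k) * (Ki (us ! k) (us ! j) - ?Mi (us ! k) (us ! j))"
      if "i < ?v" "j < ?u" "k < ?u" "nmem s' ''i'' 0 = i" "nmem s' ''j'' 0 = j" "nmem s' ''k'' 0 = k" for i j k
      using that \<open>P2 s2\<close> b same_rmem[OF s', of "''MI''"] by (simp add: cov_entries_def P2_def base_def)
  next
    fix s' assume s': "same loop_vars {''D''} s2 s'"
      and D: "\<And>i j. i < ?v \<Longrightarrow> j < ?u \<Longrightarrow> rmem s' ''D'' i j =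
        (\<Sum>k<?u. cov_VU m (vs ! i) (us ! k) * (Ki (us ! k) (us ! j) - ?Mi (us ! k) (us ! j)))"
    from that have s2: "same loop_vars {''M'', ''MI''} s s2" by (simp add: P2_def)
    have s: "same loop_vars {''M'', ''MI'', ''D''} s s'" by (rule same_mono[OF same_trans[OF s2 s']]) auto
    then show "P3 s'"
      using D sum_us[of "\<lambda>u. cov_VU m _ u * (Ki u _ - ?Mi u _)"] by (simp add: P3_def d_def)
  qed simp_all
  have 4: "runs Kov (mat_sum ''F'' nV (NConst 1) nU (RMul (RCell ''D'' vi vk) (RCov QVU vi vk)))
      s3 (100 * ((?v+1)*(1+1)*(?u+1))) P4" if "P3 s3" for s3
  proof (rule runs_mat_sum)
    fix s' assume s': "same loop_vars {''F''} s3 s'"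
    from that have s3: "same loop_vars {''M'', ''MI'', ''D''} s s3" by (simp add: P3_def)
    have s: "same loop_vars {''M'', ''MI'', ''D'', ''F''} s s'" by (rule same_mono[OF same_trans[OF s3 s']]) auto
    have b: "base s'" by (rule base_same[OF base s]) auto
    show "nval nV s' = ?v \<and> nval (NConst 1) s' = 1 \<and> nval nU s' = ?u" using dims[OF b] by simp
    show "rval Kov (RMul (RCell ''D'' vi vk) (RCov QVU vi vk)) s'
        = d (vs ! i) (us ! k) * cov_VU m (vs ! i) (us ! k)"
      if "i < ?v" "j < 1" "k < ?u" "nmem s' ''i'' 0 = i" "nmem s' ''j'' 0 = j" "nmem s' ''k'' 0 = k" for i j k
      using that \<open>P3 s3\<close> same_rmem[OF s', of "''D''"] by (simp add: cov_entries_def P3_def)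
  next
    fix s' assume s': "same loop_vars {''F''} s3 s'"
      and F: "\<And>i j. i < ?v \<Longrightarrow> j < 1 \<Longrightarrow> rmem s' ''F'' i j = (\<Sum>k<?u. d (vs ! i) (us ! k) * cov_VU m (vs ! i) (us ! k))"
    from that have s3: "same loop_vars {''M'', ''MI'', ''D''} s s3" by (simp add: P3_def)
    have s: "same loop_vars {''M'', ''MI'', ''D'', ''F''} s s'" by (rule same_mono[OF same_trans[OF s3 s']]) auto
    then show "P4 s'" using F sum_us[of "\<lambda>u. d _ u * cov_VU m _ u"] by (simp add: P4_def q_def)
  qed simp_all
  have 5: "runs Kov (mat_sum out nV (NConst 1) (NConst 1) (RMul (RConst (1/2)) (RLn (RMul (RConst (2 * pi * exp 1))
       (RSub (RCov QVV vi vi) (RCell ''F'' vi vj)))))) s4 (100 * ((?v+1)*(1+1)*(1+1))) Q" if "P4 s4" for s4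
  proof (rule runs_mat_sum)
    fix s' assume s': "same loop_vars {out} s4 s'"
    from that have s4: "same loop_vars {''M'', ''MI'', ''D'', ''F''} s s4" by (simp add: P4_def)
    have s: "same loop_vars {''M'', ''MI'', ''D'', ''F'', out} s s'"
      by (rule same_mono[OF same_trans[OF s4 s']]) auto
    have b: "base s'" by (rule base_same[OF base s]) (use names(2) in auto)
    show "nval nV s' = ?v \<and> nval (NConst 1) s' = 1 \<and> nval (NConst 1) s' = 1" using dims[OF b] by simp
    have out: "''F'' \<notin> {out}" using names(2) by auto
    show "rval Kov (RMul (RConst (1/2)) (RLn (RMul (RConst (2 * pi * exp 1))
       (RSub (RCov QVV vi vi) (RCell ''F'' vi vj))))) s'
       = 1/2 * ln (2 * pi * exp 1 * (cov_VV m (vs ! i) (vs ! i) - q (vs ! i)))"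
      if "i < ?v" "j < 1" "k < 1" "nmem s' ''i'' 0 = i" "nmem s' ''j'' 0 = j" "nmem s' ''k'' 0 = k" for i j k
      using that \<open>P4 s4\<close> same_rmem[OF s' out] by (simp add: cov_entries_def P4_def)
  next
    fix s' assume s': "same loop_vars {out} s4 s'"
      and O: "\<And>i j. i < ?v \<Longrightarrow> j < 1 \<Longrightarrow> rmem s' out i j =
        (\<Sum>k<1::nat. 1/2 * ln (2 * pi * exp 1 * (cov_VV m (vs ! i) (vs ! i) - q (vs ! i))))"
    from that have s4: "same loop_vars {''M'', ''MI'', ''D'', ''F''} s s4" by (simp add: P4_def)
    have s: "same loop_vars {''M'', ''MI'', ''D'', ''F'', out} s s'"
      by (rule same_mono[OF same_trans[OF s4 s']]) auto
    \<comment> \<open>The program sums over the second location last; exchanging the sums gives the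
      order in \<open>Sigma_PITC_eq\<close>.\<close>
    have "cov_VV m z z - q z = Sigma_PITC m (set us) {z} A $$ (0, 0)" for z
      unfolding Sigma_PITC_eq[OF A] q_def d_def sum_distrib_right by (subst sum.swap) simp
    then show "Q s'" using O by (intro Q[OF s]) (simp add: entropy_def)
  qed simp_all
  have "100 * ((?u+1)*(?u+1)*(1+1)) + (?u ^ 3 + 3 + (100 * ((?v+1)*(?u+1)*(?u+1)) +
      (100 * ((?v+1)*(1+1)*(?u+1)) + 100 * ((?v+1)*(1+1)*(1+1))))) \<le> 1000 * ((?v + 1) * (?u + 1) ^ 2)"
  proof -
    \<comment> \<open>The inversion of size |U| is absorbed by |V| |U|^2.\<close>
    have "?u ^ 3 \<le> ?v * ?u ^ 2" using le by (simp add: power3_eq_cube power2_eq_square)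
    then show ?thesis by (simp add: power2_eq_square algebra_simps)
  qed
  also note B
  finally have cost: "100 * ((?u+1)*(?u+1)*(1+1)) + (?u ^ 3 + 3 + (100 * ((?v+1)*(?u+1)*(?u+1)) +
      (100 * ((?v+1)*(1+1)*(?u+1)) + 100 * ((?v+1)*(1+1)*(1+1))))) \<le> B" .
  show ?thesis
    unfolding entropy_prog_def
    by (rule runs_Seq[OF 1 runs_Seq[OF 2 runs_Seq[OF 3 runs_Seq[OF 4 5 order.refl] order.refl] order.refl] cost])
qed

text \<open>Distinct positions in the distinct list \<open>vs\<close> enumerate a set of candidates
  bijectively, as \<open>runs_info\<close> requires.\<close>

lemma runs_info_list:
  assumes base: "base s" and l: "nmem s l 0 = n"
    and names: "a \<notin> loop_vars" "l \<notin> loop_vars" "out \<notin> {''E'', ''KI'', ''Q'', ''G'', ''L'', ''LI'', ''P''}"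
    and ks: "map (nmem s a) [0..<n] = ks" "distinct ks" "set ks \<subseteq> {..<length vs}"
    and B: "1000 * (n + length us + 2) ^ 3 \<le> B"
    and Q: "\<And>s'. same loop_vars {''G'', ''L'', ''LI'', ''P'', out} s s' \<Longrightarrow>
      (\<And>i j. i < length us \<Longrightarrow> j < length us \<Longrightarrow>
        rmem s' out i j = info ((!) vs ` set ks) (us ! i) (us ! j)) \<Longrightarrow> Q s'"
  shows "runs Kov (info_prog a l out) s B Q"
proof (rule runs_info[OF base l names])
  have ks': "set ks = nmem s a ` {..<n}" using ks(1) by (auto simp: lessThan_atLeast0)
  show "nmem s a k < length vs" if "k < n" for k using ks(3) ks' that by auto
  have "inj_on (nmem s a) {..<n}"
    using ks(1,2) by (simp add: distinct_map lessThan_atLeast0 flip: ks(1))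
  moreover have "inj_on ((!) vs) (nmem s a ` {..<n})"
    using bij_betw_nth[OF dist_vs refl refl] ks(3) unfolding ks' bij_betw_def
    by (blast intro: inj_on_subset)
  ultimately show "bij_betw (\<lambda>k. vs ! nmem s a k) {..<n} ((!) vs ` set ks)"
    using comp_inj_on[of "nmem s a" "{..<n}" "(!) vs"] by (auto simp: bij_betw_def ks' o_def)
qed (use B Q in auto)

end

text \<open>\<open>S1\<close> belongs to the first conditioning set. \<open>S2\<close> belongs to
  the selected observations outside type t, and adding the stored \<open>ST\<close> of the target
  candidates gives \<open>S3\<close> for the second set.\<close>

definition scores_prog :: com where
  "scores_prog =
     Seq (info_prog ''X'' ''n'' ''S1'')
    (Seq (info_prog ''Y'' ''y'' ''S2'')
    (Seq (mat_sum ''S3'' nU nU (NConst 1) (RAdd (RCell ''S2'' vi vj) (RCell ''ST'' vi vj)))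
    (Seq (entropy_prog ''S1'' ''H1'')
    (Seq (entropy_prog ''S3'' ''H2'')
     (mat_sum ''SC'' nV (NConst 1) (NConst 1) (RSub (RCell ''H1'' vi vj)
       (RMul (RSub (RConst 1) (delta (NCell ''type'' vi) (cell ''t''))) (RCell ''H2'' vi vj))))))))"

definition update_prog :: com where
  "update_prog =
     Seq (NAssign ''X'' (cell ''n'') (cell ''b''))
    (Seq (NAssign ''used'' (cell ''b'') (NConst 1))
     (If (is_target (cell ''b'')) Skip (push ''Y'' ''y'' (cell ''b''))))"

definition init_prog :: com where
  "init_prog =
     Seq (RAssign ''E'' (NConst 0) (NConst 0) (RConst 1))
    (Seq (mat_sum ''K'' nU nU (NConst 1) (RCov QUU vi vj))
    (Seq (Invert ''KI'' nU ''K'')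
    (Seq (mat_sum ''Q'' nV nU nU (RMul (RCov QVU vi vk) (RCell ''KI'' vk vj)))
    (Seq collect_prog
    (Seq (info_prog ''W'' ''w'' ''ST'')
     (NAssign ''used'' nV (NConst 1)))))))"

text \<open>For N = 0 the claimed bound is only a multiple of |V_t|^3, which need not cover the |V|
  |U|^2 spent by the initialisation; hence the test of \<open>N\<close> comes before everything
  else.\<close>

definition greedy_prog :: com where
  "greedy_prog = If (NLess (NConst 0) (cell ''N''))
     (Seq init_prog (For ''n'' (cell ''N'') (Seq scores_prog (Seq argmax_prog update_prog)))) Skip"

lemma runs_update:
  assumes n: "nmem s ''n'' 0 = n" and b: "nmem s ''b'' 0 = b" and B: "100 \<le> B"
    and Q: "\<And>s'. same {''X'', ''used'', ''Y'', ''y''} {} s s' \<Longrightarrow> nmem s' ''X'' = (nmem s ''X'')(n := b) \<Longrightarrow>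
      nmem s' ''used'' = (nmem s ''used'')(b := 1) \<Longrightarrow>
      map (nmem s' ''Y'') [0..<nmem s' ''y'' 0] = map (nmem s ''Y'') [0..<nmem s ''y'' 0] @
        (if nmem s ''type'' b = nmem s ''t'' 0 then [] else [b]) \<Longrightarrow> Q s'"
  shows "runs K update_prog s B Q"
  unfolding update_prog_def
proof (rule runs_Seq[where E = 5 and F = 95])
  let ?s1 = "nupd s ''X'' n b"
  let ?s2 = "nupd ?s1 ''used'' b 1"
  show "runs K (NAssign ''X'' (cell ''n'') (cell ''b'')) s 5 (\<lambda>s'. s' = ?s1)"
    using n b by (intro runs_NAssign) auto
  show "runs K (Seq (NAssign ''used'' (cell ''b'') (NConst 1))
      (If (is_target (cell ''b'')) Skip (push ''Y'' ''y'' (cell ''b'')))) s' 95 Q" if "s' = ?s1" for s'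
    unfolding that
  proof (rule runs_Seq[where E = 4 and F = 90])
    show "runs K (NAssign ''used'' (cell ''b'') (NConst 1)) ?s1 4 (\<lambda>s'. s' = ?s2)"
      using b by (intro runs_NAssign) auto
    have same2: "same {''X'', ''used'', ''Y'', ''y''} {} s ?s2"
      by (intro same_nupd same_refl) auto
    have t: "bval K (is_target (cell ''b'')) ?s2 \<longleftrightarrow> nmem s ''type'' b = nmem s ''t'' 0"
      using b by (simp add: bval_is_target)
    show "runs K (If (is_target (cell ''b'')) Skip (push ''Y'' ''y'' (cell ''b''))) s'' 90 Q" if "s'' = ?s2" for s''
      unfolding that
    proof (rule runs_If[where B = 12])
      assume "bval K (is_target (cell ''b'')) ?s2"
      then have "nmem s ''type'' b = nmem s ''t'' 0" using t by simp
      then show "runs K Skip ?s2 12 Q"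
        by (intro runs_Skip Q[OF same2]) auto
    next
      assume "\<not> bval K (is_target (cell ''b'')) ?s2"
      then have ne: "nmem s ''type'' b \<noteq> nmem s ''t'' 0" using t by simp
      show "runs K (push ''Y'' ''y'' (cell ''b'')) ?s2 12 Q"
      proof (rule runs_push[OF refl])
        show "nval (cell ''b'') ?s2 = b" using b by simp
        fix s' assume s': "same {''Y'', ''y''} {} ?s2 s'"
          and y: "nmem s' ''y'' 0 = Suc (nmem ?s2 ''y'' 0)"
          and Y: "nmem s' ''Y'' = (nmem ?s2 ''Y'')(nmem ?s2 ''y'' 0 := b)"
        have "map (nmem s' ''Y'') [0..<nmem s' ''y'' 0] = map (nmem s ''Y'') [0..<nmem s ''y'' 0] @ [b]"
          unfolding y Y map_append_upd by simp
        then show "Q s'"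
          using ne same_nmem[OF s', of "''X''"] same_nmem[OF s', of "''used''"]
          by (intro Q[OF same_mono[OF same_trans[OF same2 s']]]) auto
      qed auto
    qed (simp add: is_target_def)
  qed simp
qed (use B in simp)

section \<open>One iteration of the greedy algorithm\<close>

context pitc_input
begin

abbreviation work :: "string set" where
  "work \<equiv> {''G'', ''L'', ''LI'', ''P'', ''M'', ''MI'', ''D'', ''F'', ''S1'', ''S2'', ''S3'', ''H1'', ''H2'', ''SC''}"

lemma runs_scores:
  assumes base: "base s" and t: "nmem s ''t'' 0 = t" and n: "nmem s ''n'' 0 = n"
    and ST: "\<And>i j. i < length us \<Longrightarrow> j < length us \<Longrightarrow>
      rmem s ''ST'' i j = info (of_type t (set vs)) (us ! i) (us ! j)"
    and ks: "map (nmem s ''X'') [0..<n] = ks" "distinct ks" "set ks \<subseteq> {..<length vs}"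
    and Y: "map (nmem s ''Y'') [0..<nmem s ''y'' 0] = filter (\<lambda>k. snd (vs ! k) \<noteq> t) ks"
    and nN: "n \<le> N" and le: "length us \<le> length vs"
    and B: "2000 * (N + length us + 2) ^ 3 + 2600 * ((length vs + 1) * (length us + 1) ^ 2) \<le> B"
    and Q: "\<And>s'. same loop_vars work s s' \<Longrightarrow>
      (\<And>z. z < length vs \<Longrightarrow> rmem s' ''SC'' z 0 =
        score m (set us) (set vs) t ((!) vs ` set ks) (vs ! z)) \<Longrightarrow> Q s'"
  shows "runs Kov scores_prog s B Q"
proof -
  let ?u = "length us" and ?v = "length vs"
  let ?X = "(!) vs ` set ks" and ?T = "of_type t (set vs)"
  let ?Y = "(!) vs ` set (filter (\<lambda>k. snd (vs ! k) \<noteq> t) ks)"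
  let ?R = "?X \<union> (?T - of_type t ?X)"
  have X_vs: "?X \<subseteq> set vs" using ks(3) by auto
  have R: "?R = ?Y \<union> ?T" using X_vs by (auto simp: of_type_def)
  have X: "finite ?X" "?X \<subseteq> all_obs m" using X_vs vs_obs by auto
  have Yo: "finite ?Y" "?Y \<subseteq> all_obs m" using X by auto
  have To: "finite ?T" "?T \<subseteq> all_obs m" using vs_obs by (auto simp: of_type_def)
  have Ro: "finite ?R" "?R \<subseteq> all_obs m" unfolding R using Yo To by auto
  have infoR: "info ?R u v = info ?Y u v + info ?T u v" for u v
    unfolding R by (rule info_union[OF Yo To]) (auto simp: of_type_def)
  \<comment> \<open>The list \<open>Y\<close> is a sublist of the selections, so its inversion stays
    within the cubic budget in N.\<close>
  have y: "nmem s ''y'' 0 \<le> N"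
  proof -
    have "nmem s ''y'' 0 = length (filter (\<lambda>k. snd (vs ! k) \<noteq> t) ks)"
      using arg_cong[OF Y, of length] by simp
    also have "\<dots> \<le> length ks" by (rule length_filter_le)
    also have "\<dots> = n" using arg_cong[OF ks(1), of length] by simp
    finally show ?thesis using nN by simp
  qed
  define has where "has r A s' \<longleftrightarrow> (\<forall>i<?u. \<forall>j<?u. rmem s' r i j = info A (us ! i) (us ! j))" for r A and s' :: state
  define ent where "ent r A s' \<longleftrightarrow> (\<forall>z<?v. rmem s' r z 0 = entropy m (set us) (vs ! z) A)" for r A and s' :: state
  have has_same: "has r A s2" if "has r A s1" "same NS RS s1 s2" "r \<notin> RS" for r A NS RS s1 s2
    using that same_rmem[OF that(2,3)] by (simp add: has_def)
  have ent_same: "ent r A s2" if "ent r A s1" "same NS RS s1 s2" "r \<notin> RS" for r A NS RS s1 s2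
    using that same_rmem[OF that(2,3)] by (simp add: ent_def)
  have W: "base s'" "nmem s' x = nmem s x" "has ''ST'' ?T s'"
    if "same loop_vars work s s'" "x \<notin> loop_vars" for s' x
    using base_same[OF base that(1)] same_nmem[OF that] has_same[OF _ that(1), of "''ST''"] ST
    by (auto simp: has_def)
  let ?E = "1000 * (N + ?u + 2) ^ 3" and ?F = "1000 * ((?v + 1) * (?u + 1) ^ 2)"
  let ?S = "same loop_vars work s"
  have 1: "runs Kov (info_prog ''X'' ''n'' ''S1'') s ?E (\<lambda>s'. ?S s' \<and> has ''S1'' ?X s')"
  proof (rule runs_info_list[OF base n _ _ _ ks])
    have "(n + ?u + 2) ^ 3 \<le> (N + ?u + 2) ^ 3" using nN by (intro power_mono) auto
    then show "1000 * (n + ?u + 2) ^ 3 \<le> ?E" by simp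
    fix s' assume s': "same loop_vars {''G'', ''L'', ''LI'', ''P'', ''S1''} s s'"
      and S1: "\<And>i j. i < ?u \<Longrightarrow> j < ?u \<Longrightarrow> rmem s' ''S1'' i j = info ?X (us ! i) (us ! j)"
    have "?S s'" by (rule same_mono[OF s']) auto
    then show "?S s' \<and> has ''S1'' ?X s'" using S1 by (simp add: has_def)
  qed auto
  have 2: "runs Kov (info_prog ''Y'' ''y'' ''S2'') s1 ?E (\<lambda>s'. ?S s' \<and> has ''S1'' ?X s' \<and> has ''S2'' ?Y s')"
    if s1: "?S s1 \<and> has ''S1'' ?X s1" for s1
  proof (rule runs_info_list[OF _ refl])
    show "base s1" using W s1 by blast
    show "map (nmem s1 ''Y'') [0..<nmem s1 ''y'' 0] = filter (\<lambda>k. snd (vs ! k) \<noteq> t) ks"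
      using Y W(2)[of s1 "''Y''"] W(2)[of s1 "''y''"] s1 by simp
    show "distinct (filter (\<lambda>k. snd (vs ! k) \<noteq> t) ks)" using ks(2) by simp
    show "set (filter (\<lambda>k. snd (vs ! k) \<noteq> t) ks) \<subseteq> {..<?v}" using ks(3) by auto
    have "nmem s1 ''y'' 0 \<le> N" using y W(2)[of s1 "''y''"] s1 by simp
    then have "(nmem s1 ''y'' 0 + ?u + 2) ^ 3 \<le> (N + ?u + 2) ^ 3" by (intro power_mono) auto
    then show "1000 * (nmem s1 ''y'' 0 + ?u + 2) ^ 3 \<le> ?E" by simp
    fix s' assume s': "same loop_vars {''G'', ''L'', ''LI'', ''P'', ''S2''} s1 s'"
      and S2: "\<And>i j. i < ?u \<Longrightarrow> j < ?u \<Longrightarrow> rmem s' ''S2'' i j = info ?Y (us ! i) (us ! j)"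
    have "?S s'" by (rule same_trans_subset[OF _ s']) (use s1 in auto)
    moreover have "has ''S1'' ?X s'" using s1 by (intro has_same[OF _ s']) auto
    ultimately show "?S s' \<and> has ''S1'' ?X s' \<and> has ''S2'' ?Y s'" using S2 by (simp add: has_def)
  qed auto
  have 3: "runs Kov (mat_sum ''S3'' nU nU (NConst 1) (RAdd (RCell ''S2'' vi vj) (RCell ''ST'' vi vj))) s2
      (100 * ((?u+1)*(?u+1)*(1+1))) (\<lambda>s'. ?S s' \<and> has ''S1'' ?X s' \<and> has ''S3'' ?R s')"
    if s2: "?S s2 \<and> has ''S1'' ?X s2 \<and> has ''S2'' ?Y s2" for s2
  proof (rule runs_mat_sum)
    fix s' assume s': "same loop_vars {''S3''} s2 s'"
    have s: "?S s'" by (rule same_trans_subset[OF _ s']) (use s2 in auto)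
    have b: "base s'" using W(1)[OF s, of "''X''"] by simp
    show "nval nU s' = ?u \<and> nval nU s' = ?u \<and> nval (NConst 1) s' = 1" using b by (simp add: base_def)
    have "has ''S2'' ?Y s'" using s2 by (intro has_same[OF _ s']) auto
    moreover have "has ''ST'' ?T s'" using W(3)[OF s, of "''X''"] by simp
    ultimately show "rval Kov (RAdd (RCell ''S2'' vi vj) (RCell ''ST'' vi vj)) s' = info ?R (us ! i) (us ! j)"
      if "i < ?u" "j < ?u" "k < 1" "nmem s' ''i'' 0 = i" "nmem s' ''j'' 0 = j" "nmem s' ''k'' 0 = k" for i j k
      unfolding infoR using that by (simp add: has_def)
  next
    fix s' assume s': "same loop_vars {''S3''} s2 s'"
      and S3: "\<And>i j. i < ?u \<Longrightarrow> j < ?u \<Longrightarrow> rmem s' ''S3'' i j = (\<Sum>k<1::nat. info ?R (us ! i) (us ! j))"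
    have "?S s'" by (rule same_trans_subset[OF _ s']) (use s2 in auto)
    moreover have "has ''S1'' ?X s'" using s2 by (intro has_same[OF _ s']) auto
    ultimately show "?S s' \<and> has ''S1'' ?X s' \<and> has ''S3'' ?R s'" using S3 by (simp add: has_def)
  qed simp_all
  have 4: "runs Kov (entropy_prog ''S1'' ''H1'') s3 ?F (\<lambda>s'. ?S s' \<and> ent ''H1'' ?X s' \<and> has ''S3'' ?R s')"
    if s3: "?S s3 \<and> has ''S1'' ?X s3 \<and> has ''S3'' ?R s3" for s3
  proof (rule runs_entropy[OF _ X _ _ _ le order.refl])
    show "base s3" using W(1)[of s3 "''X''"] s3 by simp
    show "rmem s3 ''S1'' i j = info ?X (us ! i) (us ! j)" if "i < ?u" "j < ?u" for i j
      using s3 that by (simp add: has_def)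
    fix s' assume s': "same loop_vars {''M'', ''MI'', ''D'', ''F'', ''H1''} s3 s'"
      and H: "\<And>z. z < ?v \<Longrightarrow> rmem s' ''H1'' z 0 = entropy m (set us) (vs ! z) ?X"
    have "?S s'" by (rule same_trans_subset[OF _ s']) (use s3 in auto)
    moreover have "has ''S3'' ?R s'" using s3 by (intro has_same[OF _ s']) auto
    ultimately show "?S s' \<and> ent ''H1'' ?X s' \<and> has ''S3'' ?R s'" using H by (simp add: ent_def)
  qed auto
  have 5: "runs Kov (entropy_prog ''S3'' ''H2'') s4 ?F (\<lambda>s'. ?S s' \<and> ent ''H1'' ?X s' \<and> ent ''H2'' ?R s')"
    if s4: "?S s4 \<and> ent ''H1'' ?X s4 \<and> has ''S3'' ?R s4" for s4
  proof (rule runs_entropy[OF _ Ro _ _ _ le order.refl])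
    show "base s4" using W(1)[of s4 "''X''"] s4 by simp
    show "rmem s4 ''S3'' i j = info ?R (us ! i) (us ! j)" if "i < ?u" "j < ?u" for i j
      using s4 that by (simp add: has_def)
    fix s' assume s': "same loop_vars {''M'', ''MI'', ''D'', ''F'', ''H2''} s4 s'"
      and H: "\<And>z. z < ?v \<Longrightarrow> rmem s' ''H2'' z 0 = entropy m (set us) (vs ! z) ?R"
    have "?S s'" by (rule same_trans_subset[OF _ s']) (use s4 in auto)
    moreover have "ent ''H1'' ?X s'" using s4 by (intro ent_same[OF _ s']) auto
    ultimately show "?S s' \<and> ent ''H1'' ?X s' \<and> ent ''H2'' ?R s'" using H by (simp add: ent_def)
  qed auto
  have 6: "runs Kov (mat_sum ''SC'' nV (NConst 1) (NConst 1) (RSub (RCell ''H1'' vi vj)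
       (RMul (RSub (RConst 1) (delta (NCell ''type'' vi) (cell ''t''))) (RCell ''H2'' vi vj)))) s5
      (100 * ((?v+1)*(1+1)*(1+1))) Q"
    if s5: "?S s5 \<and> ent ''H1'' ?X s5 \<and> ent ''H2'' ?R s5" for s5
  proof (rule runs_mat_sum)
    fix s' assume s': "same loop_vars {''SC''} s5 s'"
    have s: "?S s'" by (rule same_trans_subset[OF _ s']) (use s5 in auto)
    have b: "base s'" using W(1)[OF s, of "''X''"] by simp
    show "nval nV s' = ?v \<and> nval (NConst 1) s' = 1 \<and> nval (NConst 1) s' = 1" using b by (simp add: base_def)
    have H: "ent ''H1'' ?X s'" "ent ''H2'' ?R s'" using s5 by (auto intro: ent_same[OF _ s'])
    have t': "nmem s' ''t'' 0 = t" using W(2)[OF s, of "''t''"] t by simp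
    \<comment> \<open>For target candidates \<open>1 - delta\<close> is 0, as in
      \<open>score\<close>; computing the second entropy for them as well keeps the program
      uniform.\<close>
    show "rval Kov (RSub (RCell ''H1'' vi vj) (RMul (RSub (RConst 1)
        (delta (NCell ''type'' vi) (cell ''t''))) (RCell ''H2'' vi vj))) s'
        = score m (set us) (set vs) t ?X (vs ! i)"
      if "i < ?v" "j < 1" "k < 1" "nmem s' ''i'' 0 = i" "nmem s' ''j'' 0 = j" "nmem s' ''k'' 0 = k" for i j k
    proof -
      have "nmem s' ''type'' i = snd (vs ! i)" using b that(1) by (simp add: base_def)
      then show ?thesis using that H t' by (simp add: rval_delta[OF b] ent_def score_def)
    qed
  next
    fix s' assume s': "same loop_vars {''SC''} s5 s'"
      and SC: "\<And>i j. i < ?v \<Longrightarrow> j < 1 \<Longrightarrow> rmem s' ''SC'' i j =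
        (\<Sum>k<1::nat. score m (set us) (set vs) t ?X (vs ! i))"
    have "?S s'" by (rule same_trans_subset[OF _ s']) (use s5 in auto)
    then show "Q s'" using SC by (intro Q) simp_all
  qed (simp_all add: delta_def)
  \<comment> \<open>2600 is 2000 for the two entropies, 200 for \<open>S3\<close> and 400 for the
    final scores.\<close>
  have "?E + (?E + (100 * ((?u+1)*(?u+1)*(1+1)) + (?F + (?F + 100 * ((?v+1)*(1+1)*(1+1))))))
      \<le> 2000 * (N + ?u + 2) ^ 3 + 2600 * ((?v + 1) * (?u + 1) ^ 2)"
    by (simp add: power2_eq_square algebra_simps)
  also note B
  finally have cost: "?E + (?E + (100 * ((?u+1)*(?u+1)*(1+1)) + (?F + (?F + 100 * ((?v+1)*(1+1)*(1+1)))))) \<le> B" .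
  show ?thesis
    unfolding scores_prog_def
    by (rule runs_Seq[OF 1 runs_Seq[OF 2 runs_Seq[OF 3 runs_Seq[OF 4 runs_Seq[OF 5 6
      order.refl] order.refl] order.refl] order.refl] cost])
qed

text \<open>\<open>ks\<close> lists the selected positions in order; the arrays \<open>X\<close>,
  \<open>used\<close> and \<open>Y\<close> are three views of it: sequence, membership, and the part
  outside type t.\<close>

definition loop_inv :: "nat \<Rightarrow> nat \<Rightarrow> nat \<Rightarrow> state \<Rightarrow> bool" where
  "loop_inv t N n s \<longleftrightarrow> base s \<and> nmem s ''t'' 0 = t \<and> nmem s ''N'' 0 = N \<and> nmem s ''used'' (length vs) \<noteq> 0 \<and>
     (\<forall>i<length us. \<forall>j<length us. rmem s ''ST'' i j = info (of_type t (set vs)) (us ! i) (us ! j)) \<and>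
     (\<exists>ks. map (nmem s ''X'') [0..<n] = ks \<and> distinct ks \<and> set ks \<subseteq> {..<length vs} \<and>
        (\<forall>z<length vs. nmem s ''used'' z = 0 \<longleftrightarrow> z \<notin> set ks) \<and>
        map (nmem s ''Y'') [0..<nmem s ''y'' 0] = filter (\<lambda>k. snd (vs ! k) \<noteq> t) ks \<and>
        greedy_run m (set us) (set vs) t (map ((!) vs) ks))"

lemma runs_step:
  assumes inv: "loop_inv t N n s" and n: "nmem s ''n'' 0 = n" and nN: "n < N" "N \<le> length vs"
    and le: "length us \<le> length vs"
    and B: "2000 * (N + length us + 2) ^ 3 + 3000 * ((length vs + 1) * (length us + 1) ^ 2) \<le> B"
  shows "runs Kov (Seq scores_prog (Seq argmax_prog update_prog)) s B
    (\<lambda>s'. nmem s' ''n'' 0 = n \<and> loop_inv t N (Suc n) (nupd s' ''n'' 0 (Suc n)))"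
proof -
  let ?v = "length vs" and ?u = "length us"
  have base: "base s" and t: "nmem s ''t'' 0 = t" and N: "nmem s ''N'' 0 = N" and uv: "nmem s ''used'' ?v \<noteq> 0"
    and ST: "\<And>i j. i < ?u \<Longrightarrow> j < ?u \<Longrightarrow> rmem s ''ST'' i j = info (of_type t (set vs)) (us ! i) (us ! j)"
    using inv by (auto simp: loop_inv_def)
  obtain ks where ks: "map (nmem s ''X'') [0..<n] = ks" "distinct ks" "set ks \<subseteq> {..<?v}"
    and used: "\<And>z. z < ?v \<Longrightarrow> nmem s ''used'' z = 0 \<longleftrightarrow> z \<notin> set ks"
    and Y: "map (nmem s ''Y'') [0..<nmem s ''y'' 0] = filter (\<lambda>k. snd (vs ! k) \<noteq> t) ks"
    and run: "greedy_run m (set us) (set vs) t (map ((!) vs) ks)"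
    using inv by (auto simp: loop_inv_def)
  have len: "length ks = n" using arg_cong[OF ks(1), of length] by simp
  \<comment> \<open>Fewer than N, hence fewer than |V|, positions have been used, so a candidate is
    left.\<close>
  have free: "\<exists>z<?v. nmem s ''used'' z = 0"
  proof (rule ccontr)
    assume "\<not> ?thesis"
    then have "{..<?v} \<subseteq> set ks" using used by blast
    then have "?v \<le> card (set ks)" using card_mono[of "set ks" "{..<?v}"] by simp
    then show False using card_length[of ks] len nN by simp
  qed
  let ?sc = "score m (set us) (set vs) t ((!) vs ` set ks)"
  define P1 where "P1 s' \<longleftrightarrow> same loop_vars work s s' \<and> (\<forall>z<?v. rmem s' ''SC'' z 0 = ?sc (vs ! z))" for s'
  define P2 where "P2 s' \<longleftrightarrow> same (loop_vars \<union> {''z'', ''b''}) work s s' \<and> nmem s' ''b'' 0 < ?v \<and>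
    nmem s' ''b'' 0 \<notin> set ks \<and> (\<forall>z<?v. z \<notin> set ks \<longrightarrow> ?sc (vs ! z) \<le> ?sc (vs ! nmem s' ''b'' 0))" for s'
  have 1: "runs Kov scores_prog s (2000 * (N + ?u + 2) ^ 3 + 2600 * ((?v + 1) * (?u + 1) ^ 2)) P1"
    by (rule runs_scores[OF base t n ST ks Y _ le order.refl]) (use nN in \<open>auto simp: P1_def\<close>)
  have 2: "runs Kov argmax_prog s1 (100 * (?v + 1)) P2" if "P1 s1" for s1
  proof (rule runs_argmax[OF _ _ _ order.refl])
    have s1: "same loop_vars work s s1" using that by (simp add: P1_def)
    have u: "nmem s1 ''used'' = nmem s ''used''" by (rule same_nmem[OF s1]) simp
    show "nmem s1 ''sizeV'' 0 = ?v"
      using base same_nmem[OF s1, of "''sizeV''"] by (simp add: base_def)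
    show "nmem s1 ''used'' ?v \<noteq> 0" "\<exists>z<?v. nmem s1 ''used'' z = 0" unfolding u using uv free .
    fix s' assume s': "same {''z'', ''b''} {} s1 s'" and b: "nmem s' ''b'' 0 < ?v"
      "nmem s1 ''used'' (nmem s' ''b'' 0) = 0"
      and max: "\<And>z. z < ?v \<Longrightarrow> nmem s1 ''used'' z = 0 \<Longrightarrow> rmem s1 ''SC'' z 0 \<le> rmem s1 ''SC'' (nmem s' ''b'' 0) 0"
    have "same (loop_vars \<union> {''z'', ''b''}) work s s'" using same_trans[OF s1 s'] by simp
    then show "P2 s'" using b max that used unfolding u by (auto simp: P1_def P2_def)
  qed
  have 3: "runs Kov update_prog s2 100
      (\<lambda>s'. nmem s' ''n'' 0 = n \<and> loop_inv t N (Suc n) (nupd s' ''n'' 0 (Suc n)))" if "P2 s2" for s2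
  proof (rule runs_update[OF _ refl order.refl])
    let ?b = "nmem s2 ''b'' 0"
    have s2: "same (loop_vars \<union> {''z'', ''b''}) work s s2" and b: "?b < ?v" "?b \<notin> set ks"
      and max: "\<And>z. z < ?v \<Longrightarrow> z \<notin> set ks \<Longrightarrow> ?sc (vs ! z) \<le> ?sc (vs ! ?b)"
      using that by (auto simp: P2_def)
    show "nmem s2 ''n'' 0 = n" using same_nmem[OF s2, of "''n''"] n by simp
    fix s' assume s': "same {''X'', ''used'', ''Y'', ''y''} {} s2 s'"
      and X': "nmem s' ''X'' = (nmem s2 ''X'')(n := ?b)"
      and used': "nmem s' ''used'' = (nmem s2 ''used'')(?b := 1)"
      and Y': "map (nmem s' ''Y'') [0..<nmem s' ''y'' 0] = map (nmem s2 ''Y'') [0..<nmem s2 ''y'' 0] @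
        (if nmem s2 ''type'' ?b = nmem s2 ''t'' 0 then [] else [?b])"
    let ?s = "nupd s' ''n'' 0 (Suc n)"
    have s: "same (loop_vars \<union> {''z'', ''b'', ''X'', ''used'', ''Y'', ''y''}) work s s'"
      by (rule same_mono[OF same_trans[OF s2 s']]) auto
    have sn: "same (insert ''n'' (loop_vars \<union> {''z'', ''b'', ''X'', ''used'', ''Y'', ''y''})) work s ?s"
      by (rule same_nupd[OF _ same_mono[OF s]]) auto
    have old: "nmem s2 ''X'' = nmem s ''X''" "nmem s2 ''used'' = nmem s ''used''" "nmem s2 ''Y'' = nmem s ''Y''"
      "nmem s2 ''y'' = nmem s ''y''" "nmem s2 ''type'' = nmem s ''type''" "nmem s2 ''t'' = nmem s ''t''"
      by (rule same_nmem[OF s2]; simp)+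
    have ty: "nmem s ''type'' ?b = snd (vs ! ?b)" using base b(1) by (simp add: base_def)
    have b': "base ?s" by (rule base_same[OF base sn]) auto
    have n': "nmem s' ''n'' 0 = n" using same_nmem[OF s, of "''n''"] n by simp
    have X: "map (nmem ?s ''X'') [0..<Suc n] = ks @ [?b]"
      using X' ks(1) by (simp add: old map_append_upd del: upt_Suc)
    have Yn: "map (nmem ?s ''Y'') [0..<nmem ?s ''y'' 0] = filter (\<lambda>k. snd (vs ! k) \<noteq> t) (ks @ [?b])"
      using Y' Y t ty by (simp add: old)
    \<comment> \<open>The maximum over free positions is one over unselected candidates because
      \<open>vs\<close> has no repetitions.\<close>
    have amax: "is_arg_max (score m (set us) (set vs) t (set (map ((!) vs) ks)))
        (\<lambda>z. z \<in> set vs - set (map ((!) vs) ks)) (vs ! ?b)"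
    proof -
      have "vs ! ?b \<notin> (!) vs ` set ks"
      proof
        assume "vs ! ?b \<in> (!) vs ` set ks"
        then obtain k where k: "k \<in> set ks" "vs ! ?b = vs ! k" by blast
        with ks(3) have "k < ?v" by auto
        then have "?b = k" using nth_eq_iff_index_eq[OF dist_vs b(1)] k(2) by blast
        then show False using k(1) b(2) by simp
      qed
      moreover have "?sc z \<le> ?sc (vs ! ?b)" if z: "z \<in> set vs" "z \<notin> (!) vs ` set ks" for z
      proof -
        obtain k where k: "k < ?v" "z = vs ! k" using z(1) by (auto simp: in_set_conv_nth)
        then have "k \<notin> set ks" using z(2) by blast
        then show ?thesis using max k by blast
      qed
      ultimately show ?thesis using b(1) by (auto simp: is_arg_max_def not_less)
    qed
    have "greedy_run m (set us) (set vs) t (map ((!) vs) (ks @ [?b]))"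
      using greedy_run.select[OF run amax] by simp
    moreover have "nmem ?s ''used'' z = 0 \<longleftrightarrow> z \<notin> set (ks @ [?b])" if "z < ?v" for z
      using used[OF that] by (simp add: used' old)
    moreover have "nmem ?s ''used'' ?v \<noteq> 0" using uv by (simp add: used' old)
    moreover have "nmem ?s ''t'' 0 = t" "nmem ?s ''N'' 0 = N"
      using same_nmem[OF sn, of "''t''"] same_nmem[OF sn, of "''N''"] t N by simp_all
    moreover have "rmem ?s ''ST'' = rmem s ''ST''" by (rule same_rmem[OF sn]) simp
    ultimately have "loop_inv t N (Suc n) ?s"
      unfolding loop_inv_def using b' ST X Yn ks(2,3) b by auto
    then show "nmem s' ''n'' 0 = n \<and> loop_inv t N (Suc n) ?s" using n' by simp
  qed
  have "2000 * (N + ?u + 2) ^ 3 + 2600 * ((?v + 1) * (?u + 1) ^ 2) + (100 * (?v + 1) + 100)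
      \<le> 2000 * (N + ?u + 2) ^ 3 + 3000 * ((?v + 1) * (?u + 1) ^ 2)"
    by (simp add: power2_eq_square algebra_simps)
  also note B
  finally show ?thesis by (intro runs_Seq[OF 1 runs_Seq[OF 2 3 order.refl]])
qed

section \<open>Initialisation, the whole run and its total cost\<close>

lemma target_positions:
  fixes t :: nat
  defines "ks \<equiv> filter (\<lambda>k. snd (vs ! k) = t) [0..<length vs]"
  shows "(!) vs ` set ks = of_type t (set vs)" "length ks = card (of_type t (set vs))"
proof -
  show im: "(!) vs ` set ks = of_type t (set vs)"
    unfolding ks_def of_type_def by (force simp: in_set_conv_nth image_iff)
  have "inj_on ((!) vs) (set ks)"
    using bij_betw_nth[OF dist_vs refl refl] unfolding bij_betw_def
    by (rule inj_on_subset[OF conjunct1]) (auto simp: ks_def)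
  then have "card ((!) vs ` set ks) = length ks"
    using distinct_card[of ks] by (simp add: card_image ks_def)
  then show "length ks = card (of_type t (set vs))" by (simp add: im)
qed

text \<open>The postcondition speaks of the state with counter \<open>n\<close> set to 0 because
  that is the initial premise of \<open>runs_For\<close>.\<close>

lemma runs_init:
  assumes le: "length us \<le> length vs"
    and B: "1000 * ((length vs + 1) * (length us + 1) ^ 2)
      + 1000 * (card (of_type t (set vs)) + length us + 2) ^ 3 \<le> B"
  shows "runs Kov init_prog (initial_state us vs t N) B (\<lambda>s. loop_inv t N 0 (nupd s ''n'' 0 0))"
proof -
  let ?u = "length us" and ?v = "length vs" and ?w = "card (of_type t (set vs))"
  let ?st = "initial_state us vs t N"
  have s0: "nmem ?st ''sizeU'' 0 = ?u" "nmem ?st ''sizeV'' 0 = ?v" "nmem ?st ''t'' 0 = t" "nmem ?st ''N'' 0 = N"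
    "\<And>k. k < ?v \<Longrightarrow> nmem ?st ''type'' k = snd (vs ! k)" "nmem ?st ''w'' 0 = 0" "nmem ?st ''y'' 0 = 0"
    "\<And>z. nmem ?st ''used'' z = 0" "\<And>y k l. rmem ?st y k l = 0"
    by (simp_all add: initial_state_def)
  let ?S = "same loop_vars {''E'', ''K'', ''KI'', ''Q''} ?st"
  let ?delta = "\<lambda>s :: state. \<forall>k. rmem s ''E'' k 0 = (if k = 0 then 1 else 0)"
  let ?KI = "\<lambda>s :: state. \<forall>i<?u. \<forall>j<?u. rmem s ''KI'' i j = Ki (us ! i) (us ! j)"
  have S: "nval nU s = ?u" "nval nV s = ?v" if "?S s" for s
    using same_nmem[OF that, of "''sizeU''"] same_nmem[OF that, of "''sizeV''"] s0 by simp_all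
  have 1: "runs Kov (RAssign ''E'' (NConst 0) (NConst 0) (RConst 1)) ?st 4 (\<lambda>s. ?S s \<and> ?delta s)"
    using s0(9) by (intro runs_RAssign) (auto intro!: same_rupd same_refl)
  have 2: "runs Kov (mat_sum ''K'' nU nU (NConst 1) (RCov QUU vi vj)) s1 (100 * ((?u+1)*(?u+1)*(1+1)))
      (\<lambda>s. ?S s \<and> ?delta s \<and> (\<forall>i<?u. \<forall>j<?u. rmem s ''K'' i j = cov_UU m (us ! i) (us ! j)))"
    if s1: "?S s1 \<and> ?delta s1" for s1
  proof (rule runs_mat_sum)
    fix s' assume s': "same loop_vars {''K''} s1 s'"
    have s: "?S s'" by (rule same_trans_subset[OF _ s']) (use s1 in auto)
    show "nval nU s' = ?u \<and> nval nU s' = ?u \<and> nval (NConst 1) s' = 1" using S[OF s] by simp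
    show "rval Kov (RCov QUU vi vj) s' = cov_UU m (us ! i) (us ! j)"
      if "i < ?u" "j < ?u" "k < 1" "nmem s' ''i'' 0 = i" "nmem s' ''j'' 0 = j" "nmem s' ''k'' 0 = k" for i j k
      using that by (simp add: cov_entries_def)
  next
    fix s' assume s': "same loop_vars {''K''} s1 s'"
      and K: "\<And>i j. i < ?u \<Longrightarrow> j < ?u \<Longrightarrow> rmem s' ''K'' i j = (\<Sum>k<1::nat. cov_UU m (us ! i) (us ! j))"
    have s: "?S s'" by (rule same_trans_subset[OF _ s']) (use s1 in auto)
    have "?delta s'" using s1 same_rmem[OF s', of "''E''"] by simp
    then show "?S s' \<and> ?delta s' \<and> (\<forall>i<?u. \<forall>j<?u. rmem s' ''K'' i j = cov_UU m (us ! i) (us ! j))"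
      using s K by simp
  qed simp_all
  have 3: "runs Kov (Invert ''KI'' nU ''K'') s2 (?u ^ 3 + 3) (\<lambda>s. ?S s \<and> ?delta s \<and> ?KI s)"
    if s2: "?S s2 \<and> ?delta s2 \<and> (\<forall>i<?u. \<forall>j<?u. rmem s2 ''K'' i j = cov_UU m (us ! i) (us ! j))" for s2
  proof (rule runs_Invert[OF _ bij_betw_nth[OF dist_us refl refl] cov_UU_pos_def])
    show "nval nU s2 = ?u" using S s2 by blast
    show "rmem s2 ''K'' k l = cov_UU m (us ! k) (us ! l)" if "k < ?u" "l < ?u" for k l
      using s2 that by simp
    fix s' assume s': "same {} {''KI''} s2 s'"
      and KI: "\<And>k l. k < ?u \<Longrightarrow> l < ?u \<Longrightarrow> rmem s' ''KI'' k l = Ki (us ! k) (us ! l)"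
    have s: "?S s'" by (rule same_trans_subset[OF _ s']) (use s2 in auto)
    have "?delta s'" using s2 same_rmem[OF s', of "''E''"] by simp
    then show "?S s' \<and> ?delta s' \<and> ?KI s'" using s KI by simp
  qed simp
  have 4: "runs Kov (mat_sum ''Q'' nV nU nU (RMul (RCov QVU vi vk) (RCell ''KI'' vk vj))) s3
      (100 * ((?v+1)*(?u+1)*(?u+1))) (\<lambda>s. ?S s \<and> base s)"
    if s3: "?S s3 \<and> ?delta s3 \<and> ?KI s3" for s3
  proof (rule runs_mat_sum)
    fix s' assume s': "same loop_vars {''Q''} s3 s'"
    have s: "?S s'" by (rule same_trans_subset[OF _ s']) (use s3 in auto)
    show "nval nV s' = ?v \<and> nval nU s' = ?u \<and> nval nU s' = ?u" using S[OF s] by simp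
    have KI: "?KI s'" using s3 same_rmem[OF s', of "''KI''"] by simp
    show "rval Kov (RMul (RCov QVU vi vk) (RCell ''KI'' vk vj)) s'
        = cov_VU m (vs ! i) (us ! k) * Ki (us ! k) (us ! j)"
      if "i < ?v" "j < ?u" "k < ?u" "nmem s' ''i'' 0 = i" "nmem s' ''j'' 0 = j" "nmem s' ''k'' 0 = k" for i j k
      using that KI by (simp add: cov_entries_def)
  next
    fix s' assume s': "same loop_vars {''Q''} s3 s'"
      and Q: "\<And>i j. i < ?v \<Longrightarrow> j < ?u \<Longrightarrow> rmem s' ''Q'' i j =
        (\<Sum>k<?u. cov_VU m (vs ! i) (us ! k) * Ki (us ! k) (us ! j))"
    have s: "?S s'" by (rule same_trans_subset[OF _ s']) (use s3 in auto)
    have "?delta s'" using s3 same_rmem[OF s', of "''E''"] by simp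
    moreover have "?KI s'" using s3 same_rmem[OF s', of "''KI''"] by simp
    moreover have "nmem s' ''type'' = nmem ?st ''type''" by (rule same_nmem[OF s]) simp
    ultimately have "base s'"
      using S[OF s] Q sum_us[of "\<lambda>u. cov_VU m _ u * Ki u _"] s0(5) by (simp add: base_def)
    then show "?S s' \<and> base s'" using s by simp
  qed simp_all
  let ?C = "same (loop_vars \<union> {''z'', ''W'', ''w''}) {''E'', ''K'', ''KI'', ''Q''} ?st"
  let ?ks = "filter (\<lambda>k. snd (vs ! k) = t) [0..<?v]"
  have 5: "runs Kov collect_prog s4 (100 * (?v + 1)) (\<lambda>s. ?C s \<and> base s \<and> map (nmem s ''W'') [0..<nmem s ''w'' 0] = ?ks)"
    if s4: "?S s4 \<and> base s4" for s4
  proof (rule runs_collect[OF _ _ order.refl])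
    show "nmem s4 ''sizeV'' 0 = ?v" using s4 by (simp add: base_def)
    show "nmem s4 ''w'' 0 = 0" using s4 same_nmem[of _ _ ?st s4 "''w''"] s0(6) by fastforce
    have t4: "nmem s4 ''t'' 0 = t" using s4 same_nmem[of _ _ ?st s4 "''t''"] s0(3) by fastforce
    fix s' assume s': "same {''z'', ''W'', ''w''} {} s4 s'"
      and W: "map (nmem s' ''W'') [0..<nmem s' ''w'' 0] = filter (\<lambda>z. nmem s4 ''type'' z = nmem s4 ''t'' 0) [0..<?v]"
    have "filter (\<lambda>z. nmem s4 ''type'' z = nmem s4 ''t'' 0) [0..<?v] = ?ks"
      using s4 t4 by (intro filter_cong) (auto simp: base_def)
    moreover have "?C s'" by (rule same_mono[OF same_trans[OF conjunct1[OF s4] s']]) auto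
    moreover have "base s'" by (rule base_same[OF conjunct2[OF s4] s']) auto
    ultimately show "?C s' \<and> base s' \<and> map (nmem s' ''W'') [0..<nmem s' ''w'' 0] = ?ks" using W by simp
  qed
  let ?D = "same (loop_vars \<union> {''z'', ''W'', ''w''}) {''E'', ''K'', ''KI'', ''Q'', ''G'', ''L'', ''LI'', ''P'', ''ST''} ?st"
  let ?ST = "\<lambda>s :: state. \<forall>i<?u. \<forall>j<?u. rmem s ''ST'' i j = info (of_type t (set vs)) (us ! i) (us ! j)"
  have 6: "runs Kov (info_prog ''W'' ''w'' ''ST'') s5 (1000 * (?w + ?u + 2) ^ 3) (\<lambda>s. ?D s \<and> base s \<and> ?ST s)"
    if s5: "?C s5 \<and> base s5 \<and> map (nmem s5 ''W'') [0..<nmem s5 ''w'' 0] = ?ks" for s5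
  proof (rule runs_info_list[OF _ refl _ _ _ conjunct2[OF conjunct2[OF s5]]])
    show "base s5" using s5 by simp
    have "nmem s5 ''w'' 0 = length ?ks"
      using arg_cong[OF conjunct2[OF conjunct2[OF s5]], of length] by simp
    then show "1000 * (nmem s5 ''w'' 0 + ?u + 2) ^ 3 \<le> 1000 * (?w + ?u + 2) ^ 3"
      using target_positions(2)[of t] by simp
    fix s' assume s': "same loop_vars {''G'', ''L'', ''LI'', ''P'', ''ST''} s5 s'"
      and ST: "\<And>i j. i < ?u \<Longrightarrow> j < ?u \<Longrightarrow> rmem s' ''ST'' i j = info ((!) vs ` set ?ks) (us ! i) (us ! j)"
    have "?D s'" by (rule same_mono[OF same_trans[OF conjunct1[OF s5] s']]) auto
    moreover have "base s'" using s5 by (intro base_same[OF _ s']) auto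
    ultimately show "?D s' \<and> base s' \<and> ?ST s'" using ST target_positions(1)[of t] by simp
  qed auto
  have 7: "runs Kov (NAssign ''used'' nV (NConst 1)) s6 4 (\<lambda>s. loop_inv t N 0 (nupd s ''n'' 0 0))"
    if s6: "?D s6 \<and> base s6 \<and> ?ST s6" for s6
  proof (rule runs_NAssign)
    have V: "nval nV s6 = ?v" using s6 by (simp add: base_def)
    let ?s = "nupd (nupd s6 ''used'' ?v 1) ''n'' 0 0"
    have old: "nmem s6 ''used'' = nmem ?st ''used''" "nmem s6 ''y'' = nmem ?st ''y''"
      "nmem s6 ''t'' = nmem ?st ''t''" "nmem s6 ''N'' = nmem ?st ''N''"
      by (rule same_nmem[OF conjunct1[OF s6]]; simp)+
    have "base ?s"
      by (rule base_same[of s6 "{''used'', ''n''}" "{}"]) (use s6 in \<open>auto simp: same_def\<close>)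
    then show "loop_inv t N 0 (nupd (nupd s6 ''used'' (nval nV s6) (nval (NConst 1) s6)) ''n'' 0 0)"
      using s6 s0 unfolding V by (auto simp: loop_inv_def old intro: greedy_run.start)
  qed simp
  have "4 + (100 * ((?u+1)*(?u+1)*(1+1)) + (?u ^ 3 + 3 + (100 * ((?v+1)*(?u+1)*(?u+1)) + (100 * (?v + 1)
      + (1000 * (?w + ?u + 2) ^ 3 + 4))))) \<le> 1000 * ((?v + 1) * (?u + 1) ^ 2) + 1000 * (?w + ?u + 2) ^ 3"
  proof -
    have "?u ^ 3 \<le> ?v * ?u ^ 2" using le by (simp add: power3_eq_cube power2_eq_square)
    then show ?thesis by (simp add: power2_eq_square algebra_simps)
  qed
  also note B
  finally have cost: "4 + (100 * ((?u+1)*(?u+1)*(1+1)) + (?u ^ 3 + 3 + (100 * ((?v+1)*(?u+1)*(?u+1)) + (100 * (?v + 1)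
      + (1000 * (?w + ?u + 2) ^ 3 + 4))))) \<le> B" .
  show ?thesis
    unfolding init_prog_def
    by (rule runs_Seq[OF 1 runs_Seq[OF 2 runs_Seq[OF 3 runs_Seq[OF 4 runs_Seq[OF 5 runs_Seq[OF 6 7
      order.refl] order.refl] order.refl] order.refl] order.refl] cost])
qed

text \<open>The test of \<open>N\<close> costs 5 with its branching, and \<open>Skip\<close> one
  more, giving 6 for N = 0. The 12 per iteration is the loop overhead 10 plus 2 for reading
  \<open>N\<close>.\<close>

lemma runs_greedy:
  assumes le: "length us \<le> length vs" and N: "N \<le> length vs"
    and B: "N = 0 \<Longrightarrow> 6 \<le> B"
      "0 < N \<Longrightarrow> 1000 * ((length vs + 1) * (length us + 1) ^ 2)
        + 1000 * (card (of_type t (set vs)) + length us + 2) ^ 3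
        + (N + 1) * (2000 * (N + length us + 2) ^ 3 + 3000 * ((length vs + 1) * (length us + 1) ^ 2) + 12) + 5 \<le> B"
  shows "runs Kov greedy_prog (initial_state us vs t N) B
    (\<lambda>s. (\<forall>k<N. nmem s ''X'' k < length vs) \<and> greedy_run m (set us) (set vs) t (selections vs N s))"
proof (cases "N = 0")
  case True
  have "nmem (initial_state us vs t N) ''N'' 0 = 0" using True by (simp add: initial_state_def)
  then show ?thesis
    unfolding greedy_prog_def using True B(1)
    by (intro runs_If[where B = 1] runs_Skip) (auto simp: selections_def intro: greedy_run.start)
next
  case False
  let ?u = "length us" and ?v = "length vs"
  let ?I = "1000 * ((?v + 1) * (?u + 1) ^ 2) + 1000 * (card (of_type t (set vs)) + ?u + 2) ^ 3"
  let ?L = "2000 * (N + ?u + 2) ^ 3 + 3000 * ((?v + 1) * (?u + 1) ^ 2)"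
  let ?Q = "\<lambda>s. (\<forall>k<N. nmem s ''X'' k < length vs) \<and> greedy_run m (set us) (set vs) t (selections vs N s)"
  have N0: "nmem (initial_state us vs t N) ''N'' 0 = N" by (simp add: initial_state_def)
  have loop: "runs Kov (For ''n'' (cell ''N'') (Seq scores_prog (Seq argmax_prog update_prog))) s
      ((N + 1) * (?L + 12)) ?Q" if "loop_inv t N 0 (nupd s ''n'' 0 0)" for s
  proof (rule runs_For[where I = "loop_inv t N" and n = N and B = ?L, OF that])
    show "nval (cell ''N'') s' = N" if "loop_inv t N i s'" for i s' using that by (simp add: loop_inv_def)
    show "runs Kov (Seq scores_prog (Seq argmax_prog update_prog)) s' ?L
        (\<lambda>s''. nmem s'' ''n'' 0 = i \<and> loop_inv t N (Suc i) (nupd s'' ''n'' 0 (Suc i)))"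
      if "loop_inv t N i s'" "i < N" "nmem s' ''n'' 0 = i" for i s'
      using runs_step[OF that(1,3,2) N le order.refl] .
    show "?Q s'" if "loop_inv t N N s'" for s'
    proof -
      obtain ks where ks: "map (nmem s' ''X'') [0..<N] = ks" "set ks \<subseteq> {..<?v}"
        and run: "greedy_run m (set us) (set vs) t (map ((!) vs) ks)"
        using \<open>loop_inv t N N s'\<close> by (auto simp: loop_inv_def)
      have "map ((!) vs) ks = selections vs N s'" unfolding ks(1)[symmetric] by (simp add: selections_def)
      moreover have "nmem s' ''X'' k < ?v" if "k < N" for k
        using ks(2) that by (simp add: ks(1)[symmetric] image_subset_iff)
      ultimately show ?thesis using run by simp
    qed
  qed simp
  have init: "runs Kov (Seq init_prog (For ''n'' (cell ''N'') (Seq scores_prog (Seq argmax_prog update_prog))))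
      (initial_state us vs t N) (?I + (N + 1) * (?L + 12)) ?Q"
    by (rule runs_Seq[OF runs_init[OF le order.refl] loop order.refl])
  show ?thesis
    unfolding greedy_prog_def
    by (rule runs_If[OF init]) (use False N0 B(2) in auto)
qed

end

text \<open>Convexity of the cube. Writing the larger number as \<open>p + d\<close> avoids
  subtraction and makes the inequality coefficientwise.\<close>

lemma pow3_add_le:
  fixes x y :: nat
  shows "(x + y) ^ 3 \<le> 4 * (x ^ 3 + y ^ 3)"
proof -
  have *: "(p + (p + d)) ^ 3 \<le> 4 * (p ^ 3 + (p + d) ^ 3)" for p d :: nat
    by (simp add: power3_eq_cube algebra_simps)
  show ?thesis
  proof (cases "x \<le> y")
    case True
    then show ?thesis using *[of x "y - x"] by simp
  next
    case False
    then show ?thesis using *[of y "x - y"] by (simp add: add.commute)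
  qed
qed

text \<open>Positivity of N and u lets every additive constant be absorbed into a factor, and
  \<open>u \<le> w\<close> reduces the initial cube to a multiple of \<open>w ^ 3\<close>. The final
  constant is a generous round number.\<close>

lemma cost_bound:
  fixes N u v w :: nat
  assumes "0 < N" "0 < u" "u \<le> w" "w \<le> v"
  shows "1000 * ((v + 1) * (u + 1) ^ 2) + 1000 * (w + u + 2) ^ 3
      + (N + 1) * (2000 * (N + u + 2) ^ 3 + 3000 * ((v + 1) * (u + 1) ^ 2) + 12) + 5
    \<le> 1000000 * (N * (v * u ^ 2 + N ^ 3) + w ^ 3)"
proof -
  define a where "a = v * u ^ 2 + N ^ 3"
  have a: "u ^ 3 + N ^ 3 \<le> a" "v * u ^ 2 \<le> a" "1 \<le> a"
  proof -
    have "u ^ 3 \<le> v * u ^ 2" using assms by (simp add: power3_eq_cube power2_eq_square)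
    then show "u ^ 3 + N ^ 3 \<le> a" by (simp add: a_def)
    show "v * u ^ 2 \<le> a" by (simp add: a_def)
    have "1 \<le> N ^ 3" using assms(1) by simp
    then show "1 \<le> a" unfolding a_def by linarith
  qed
  have "(v + 1) * (u + 1) ^ 2 \<le> (2 * v) * (2 * u) ^ 2"
    using assms by (intro mult_le_mono power_mono) auto
  also have "\<dots> \<le> 8 * a" using a(2) by (simp add: power2_eq_square algebra_simps)
  finally have 1: "(v + 1) * (u + 1) ^ 2 \<le> 8 * a" .
  have "(N + u + 2) ^ 3 \<le> (2 * (u + N)) ^ 3" using assms by (intro power_mono) auto
  also have "\<dots> = 8 * (u + N) ^ 3" unfolding power_mult_distrib by simp
  also have "\<dots> \<le> 32 * a" using order.trans[OF pow3_add_le mult_le_mono2[OF a(1)]] by simp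
  finally have 2: "(N + u + 2) ^ 3 \<le> 32 * a" .
  have "(w + u + 2) ^ 3 \<le> (4 * w) ^ 3" using assms by (intro power_mono) auto
  then have 3: "(w + u + 2) ^ 3 \<le> 64 * w ^ 3" by (simp add: power_mult_distrib)
  \<comment> \<open>88012 = 2000 * 32 + 3000 * 8 + 12, and \<open>N + 1 \<le> 2 * N\<close>.\<close>
  have "(N + 1) * (2000 * (N + u + 2) ^ 3 + 3000 * ((v + 1) * (u + 1) ^ 2) + 12) \<le> (2 * N) * (88012 * a)"
    using assms(1) 1 2 a(3) by (intro mult_le_mono) auto
  then have 4: "(N + 1) * (2000 * (N + u + 2) ^ 3 + 3000 * ((v + 1) * (u + 1) ^ 2) + 12) \<le> 176024 * (N * a)"
    by simp
  have 5: "a \<le> N * a" using assms(1) by simp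
  \<comment> \<open>Naming the nonlinear products makes the remaining comparison linear.\<close>
  have "1000 * p + 1000 * q + r + 5 \<le> 1000000 * (b + c)"
    if *: "p \<le> 8 * a" "q \<le> 64 * c" "r \<le> 176024 * b" "a \<le> b" for p q r b c :: nat
  proof -
    have "1000 * p \<le> 8000 * b" "1000 * q \<le> 64000 * c" "5 \<le> 5 * b" using * a(3) by linarith+
    then have "1000 * p + 1000 * q + r + 5 \<le> 8000 * b + 64000 * c + 176024 * b + 5 * b"
      using *(3) by (intro add_mono)
    then show ?thesis by simp
  qed
  from this[OF 1 3 4 5] show ?thesis unfolding a_def .
qed

theorem theorem1:
  shows "\<exists>(prog :: com) (C :: nat).
    \<forall>(m :: ('d::finite) mogp) U V us vs t N.
      mogp_model m \<and>
      finite U \<and> U \<noteq> {} \<and> U \<subseteq> locs m \<and>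
      finite V \<and> V \<subseteq> all_obs m \<and>
      distinct us \<and> set us = U \<and>
      distinct vs \<and> set vs = V \<and>
      t \<in> {1..num_types m} \<and>
      N \<le> card V \<and>
      card U \<le> card (of_type t V)
      \<longrightarrow>
      (\<exists>T s. exec (cov_entries m us vs) prog (initial_state us vs t N) T s \<and>
        (\<forall>k < N. nmem s ''X'' k < length vs) \<and>
        greedy_run m U V t (selections vs N s) \<and>
        T \<le> C * (N * (card V * card U ^ 2 + N ^ 3) + card (of_type t V) ^ 3))"
proof (rule exI[of _ greedy_prog], rule exI[of _ 1000000], intro allI impI, elim conjE)
  fix m :: "'d mogp" and U V and us :: "(real ^ 'd) list" and vs :: "'d obs list" and t N :: nat
  assume model: "mogp_model m" and U: "finite U" "U \<noteq> {}" and V: "finite V" "V \<subseteq> all_obs m"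
    and us: "distinct us" "set us = U" and vs: "distinct vs" "set vs = V"
    and N: "N \<le> card V" and le: "card U \<le> card (of_type t V)"
  interpret pitc_input m us vs
    using model us vs V by unfold_locales auto
  have len: "length us = card U" "length vs = card V"
    using distinct_card us vs by metis+
  have wv: "card (of_type t V) \<le> card V"
    using V(1) by (intro card_mono) (auto simp: of_type_def)
  have u: "0 < card U" using U by (simp add: card_gt_0_iff)
  let ?B = "1000000 * (N * (card V * card U ^ 2 + N ^ 3) + card (of_type t V) ^ 3)"
  have "runs (cov_entries m us vs) greedy_prog (initial_state us vs t N) ?B
      (\<lambda>s. (\<forall>k<N. nmem s ''X'' k < length vs) \<and> greedy_run m (set us) (set vs) t (selections vs N s))"
  proof (rule runs_greedy)
    \<comment> \<open>Even for N = 0 six units are spent; they are covered because U, and so V_t, is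
      nonempty.\<close>
    have "1 \<le> card (of_type t V) ^ 3" using u le by simp
    then show "6 \<le> ?B" by simp
  qed (use N le u wv cost_bound[of N "card U" "card (of_type t V)" "card V"] in \<open>auto simp: len vs\<close>)
  then show "\<exists>T s. exec (cov_entries m us vs) greedy_prog (initial_state us vs t N) T s \<and>
        (\<forall>k < N. nmem s ''X'' k < length vs) \<and>
        greedy_run m U V t (selections vs N s) \<and> T \<le> ?B"
    unfolding us(2) vs(2) runs_def by blast
qed

end
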